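(* Let $n\ge1$. Let $\mathcal W_1$ be the linear span of the functions $W(f)$, $f\in\mathcal P_{2n}$, on $\mathcal S_{2n}$, and let $\mathcal M_1$ be the linear span of the matrix coefficients $g\mapsto(\omega(g)u,v)$, $u,v\in\mathcal P_n$, of the oscillator representation of $Mp(n,\mathbb R)$. Then $$\mathcal W_1=\bigoplus_{i\in\mathbb N}C_{(0,0,\dots,0,-2i)}(\mathcal S_{2n})$$ (algebraic direct sum, $\mathbb N=\{0,1,2,\dots\}$). In particular $\mathcal W_1$ is a space of algebraic functions on $\mathcal S_{2n}$. Furthermore, $\mathcal W_1$ is the push-forward under $\mathcal H$ of $\mathcal M_1/\Lambda=\{f/\Lambda: f\in\mathcal M_1\}$, regarded as a set of functions on $Sp(n,\mathbb R)$.
   Context: $J=\begin{pmatrix}0&I_n\\-I_n&0\end{pmatrix}$, $Sp(n,\mathbb R)=\{g\in GL(2n,\mathbb R): g^tJg=J\}$; $Sp(n,\mathbb R)\cap O(2n)$ is identified with $U(n)$ by $\begin{pmatrix}A&B\\-B&A\end{pmatrix}\leftrightarrow A+iB$. $\mathcal S_{2n}$ is the space of symmetric unitary complex $2n\times2n$ matrices, identified with $U(2n)/O(2n)$ by $gO(2n)\mapsto gg^t$. For $g=k_1\exp(H)k_2\in Sp(n,\mathbb R)$ with $k_1,k_2\in U(n)$, $H=\mathrm{diag}(\lambda_1,\dots,\lambda_n,-\lambda_1,\dots,-\lambda_n)$, $H^{\mathbb C}=\mathrm{diag}(\lambda_1,\dots,\lambda_n)$, $$\mathcal H(g)=\begin{pmatrix}\overline{k_1}&0\\0&\overline{k_2}^t\end{pmatrix}\begin{pmatrix}\tanh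 H^{\mathbb C}&-i\,\mathrm{sech}\,H^{\mathbb C}\\-i\,\mathrm{sech}\,H^{\mathbb C}&\tanh H^{\mathbb C}\end{pmatrix}\begin{pmatrix}k_1^{-1}&0\\0&\overline{k_2}\end{pmatrix};$$ $\mathcal H:Sp(n,\mathbb R)\to\mathcal S_{2n}$ is a well-defined analytic embedding with open dense image. The push-forward $f^0$ of a function $f$ on $Sp(n,\mathbb R)$ is given by $f^0(\mathcal H(g))=f(g)$, extended to $\mathcal S_{2n}$ by continuity when possible. For $g=\begin{pmatrix}A&B\\C&D\end{pmatrix}$ put $C_g^{\mathbb C}=\frac{A+D}2+i\frac{B-C}2$. $Mp(n,\mathbb R)=\{(\lambda,g): g\in Sp(n,\mathbb R),\ \lambda^2\det C_g^{\mathbb C}=1\}$ is the connected double cover of $Sp(n,\mathbb R)$ with identity $(1,I)$; $\Lambda(\lambda,g)=\lambda$. Let $d\mu(z)=\exp(-\frac12\|z\|^2)dz$ on $\mathbb C^n$, with $dz$ normalized so that $\mu$ has total mass 1; $\mathcal P_m$ denotes polynomials in $m$ complex variables; $\mathcal F_n$ is the completion of $\mathcal P_n$ under $(f,h)=\int f\overline h\,d\mu$. The oscillator representation on $\mathcal F_n$ is $$\omega(\lambda,g)f(z)=\int_{\mathbb C^n}\lambda\exp\Big(\tfrac14(iz^t,\overline w^t)\mathcal H(g)\begin{pmatrix}iz\\\overline w\end{pmatrix}\Big)f(w)\,d\mu(w).$$ For $f\in\mathcal P_{2n}$ and $s\in\mathcal S_{2n}$, $$W(f)(s)=\int_{\mathbb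 C^n\times\mathbb C^n}\exp\Big(\tfrac14(\overline z^t,\overline w^t)s\begin{pmatrix}\overline z\\\overline w\end{pmatrix}\Big)f(z,w)\,d\mu(z)\,d\mu(w).$$ $U(2n)$ acts on functions on $\mathcal S_{2n}$ by $(g\cdot f)(s)=f(g^{-1}s(g^{-1})^t)$. The irreducible representations occurring in $L^2(\mathcal S_{2n})$ are exactly those with highest weight $\lambda=(\lambda_1\ge\dots\ge\lambda_{2n})$, all $\lambda_i$ even integers, each with multiplicity one; $C_\lambda(\mathcal S_{2n})$ is the corresponding irreducible subspace. *)

theory Defs
  imports "HOL-Analysis.Analysis" "HOL-Library.Function_Algebras"
begin

text \<open>
  The dimension \<open>n \<ge> 1\<close> is \<open>CARD('n)\<close> for an index type \<open>'n\<close>, and \<open>'n + 'n\<close> indexes \<open>2n\<close>-dimensional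
  objects in two consecutive blocks. Weights require the indices to be linearly ordered, so
  \<open>'n\<close> is a finite linear order and \<open>'n + 'n\<close> is ordered with the \<open>Inl\<close> block first.
\<close>

instantiation sum :: (linorder, linorder) linorder
begin

definition less_eq_sum :: "'a + 'b \<Rightarrow> 'a + 'b \<Rightarrow> bool" where
  "less_eq_sum x y = (case x of
      Inl a \<Rightarrow> (case y of Inl b \<Rightarrow> a \<le> b | Inr _ \<Rightarrow> True)
    | Inr a \<Rightarrow> (case y of Inl _ \<Rightarrow> False | Inr b \<Rightarrow> a \<le> b))"

definition less_sum :: "'a + 'b \<Rightarrow> 'a + 'b \<Rightarrow> bool" where
  "less_sum x y = (x \<le> y \<and> \<not> y \<le> x)"

instance
  by standard (auto simp: less_eq_sum_def less_sum_def split: sum.splits)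

end


section \<open>Complex vector spaces of functions\<close>

definition cscale :: "complex \<Rightarrow> ('a \<Rightarrow> complex) \<Rightarrow> 'a \<Rightarrow> complex" where
  "cscale c f = (\<lambda>x. c * f x)"

global_interpretation cfun: vector_space "cscale :: complex \<Rightarrow> ('a \<Rightarrow> complex) \<Rightarrow> 'a \<Rightarrow> complex"
  by standard (auto simp: cscale_def fun_eq_iff algebra_simps)

definition algebraic_direct_sum :: "('a \<Rightarrow> complex) set \<Rightarrow> ('i \<Rightarrow> ('a \<Rightarrow> complex) set) \<Rightarrow> bool" where
  "algebraic_direct_sum W C \<longleftrightarrow>
     (\<forall>i. cfun.subspace (C i)) \<and>
     W = cfun.span (\<Union>i. C i) \<and>
     (\<forall>v. (\<forall>i. v i \<in> C i) \<and> finite {i. v i \<noteq> 0} \<and> (\<Sum>i | v i \<noteq> 0. v i) = 0 \<longrightarrow> (\<forall>i. v i = 0))"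


section \<open>Matrices\<close>

definition cnj_mat :: "complex^'m^'k \<Rightarrow> complex^'m^'k" where
  "cnj_mat A = (\<chi> i j. cnj (A $ i $ j))"

definition diag_mat :: "('m \<Rightarrow> 'a::zero) \<Rightarrow> 'a^'m^'m" where
  "diag_mat d = (\<chi> i j. if i = j then d i else 0)"

definition block_mat ::
  "'a^'n^'n \<Rightarrow> 'a^'n^'n \<Rightarrow> 'a^'n^'n \<Rightarrow> 'a^'n^'n \<Rightarrow> 'a^('n::finite + 'n)^('n + 'n)" where
  "block_mat A B C D = (\<chi> i j.
     case i of
       Inl a \<Rightarrow> (case j of Inl b \<Rightarrow> A $ a $ b | Inr b \<Rightarrow> B $ a $ b)
     | Inr a \<Rightarrow> (case j of Inl b \<Rightarrow> C $ a $ b | Inr b \<Rightarrow> D $ a $ b))"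

definition join :: "'a^'n \<Rightarrow> 'a^'n \<Rightarrow> 'a^('n + 'n)" where
  "join z w = (\<chi> i. case i of Inl a \<Rightarrow> z $ a | Inr a \<Rightarrow> w $ a)"

definition cnj_vec :: "complex^'m \<Rightarrow> complex^'m" where
  "cnj_vec z = (\<chi> i. cnj (z $ i))"

text \<open>The quadratic form \<open>v\<^sup>t s v\<close>; it is complex bilinear, not sesquilinear.\<close>

definition quad_form :: "complex^'m^'m \<Rightarrow> complex^'m \<Rightarrow> complex" where
  "quad_form s v = (\<Sum>i\<in>UNIV. v $ i * (s *v v) $ i)"

definition unitary_group :: "(complex^'m^'m) set" where
  "unitary_group = {k. transpose (cnj_mat k) ** k = mat 1 \<and> k ** transpose (cnj_mat k) = mat 1}"

definition sym_unitary :: "(complex^'m^'m) set" where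
  "sym_unitary = {s \<in> unitary_group. transpose s = s}"

definition symp_J :: "real^('n::finite + 'n)^('n + 'n)" where
  "symp_J = block_mat 0 (mat 1) (- mat 1) 0"

definition Sp :: "(real^('n::finite + 'n)^('n + 'n)) set" where
  "Sp = {g. invertible g \<and> transpose g ** symp_J ** g = symp_J}"

text \<open>The matrix of \<open>Sp \<inter> O(2n)\<close> corresponding to \<open>A + iB\<close> in \<open>U(n)\<close>.\<close>

definition realify :: "complex^'n^'n \<Rightarrow> real^('n::finite + 'n)^('n + 'n)" where
  "realify k = (let A = (\<chi> i j. Re (k $ i $ j)); B = (\<chi> i j. Im (k $ i $ j))
                in block_mat A B (- B) A)"


section \<open>The embedding of the symplectic group into symmetric unitary matrices\<close>

definition exp_H :: "('n \<Rightarrow> real) \<Rightarrow> real^('n::finite + 'n)^('n + 'n)" where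
  "exp_H l = diag_mat (case_sum (\<lambda>i. exp (l i)) (\<lambda>i. exp (- l i)))"

definition HH_formula ::
  "complex^'n^'n \<Rightarrow> ('n \<Rightarrow> real) \<Rightarrow> complex^'n^'n \<Rightarrow> complex^('n::finite + 'n)^('n + 'n)" where
  "HH_formula k1 l k2 =
     (let T = diag_mat (\<lambda>i. complex_of_real (tanh (l i)));
          S = diag_mat (\<lambda>i. - \<i> * complex_of_real (1 / cosh (l i)))
      in block_mat (cnj_mat k1) 0 0 (transpose (cnj_mat k2))
         ** block_mat T S S T
         ** block_mat (matrix_inv k1) 0 0 (cnj_mat k2))"

definition HH :: "real^('n::finite + 'n)^('n + 'n) \<Rightarrow> complex^('n::finite + 'n)^('n + 'n)" where
  "HH g = (THE s. \<exists>k1\<in>unitary_group. \<exists>k2\<in>unitary_group. \<exists>l.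
             g = realify k1 ** exp_H l ** realify k2 \<and> s = HH_formula k1 l k2)"


section \<open>The metaplectic group and the oscillator representation\<close>

definition C_part :: "real^('n::finite + 'n)^('n + 'n) \<Rightarrow> complex^'n^'n" where
  "C_part g = (\<chi> i j. Complex ((g $ Inl i $ Inl j + g $ Inr i $ Inr j) / 2)
                              ((g $ Inl i $ Inr j - g $ Inr i $ Inl j) / 2))"

definition Mp :: "(complex \<times> (real^('n::finite + 'n)^('n + 'n))) set" where
  "Mp = {(l, g). g \<in> Sp \<and> l\<^sup>2 * det (C_part g) = 1}"

definition gauss :: "(complex^'m) measure" where
  "gauss = density lborel (\<lambda>z. ennreal
     (exp (- (norm z)\<^sup>2 / 2) / (\<integral>w. exp (- (norm (w :: complex^'m))\<^sup>2 / 2) \<partial>lborel)))"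

definition polys :: "((complex^'m) \<Rightarrow> complex) set" where
  "polys = cfun.span (range (\<lambda>k :: 'm \<Rightarrow> nat. \<lambda>z. \<Prod>i\<in>UNIV. (z $ i) ^ k i))"

text \<open>
  The inner product of the Fock space. The Fock space is a space of functions (the entire
  functions that are square integrable for the Gaussian measure), so no abstract completion
  is needed to pair \<open>osc (l, g) u\<close> with a polynomial.
\<close>

definition fock_inner :: "((complex^'m) \<Rightarrow> complex) \<Rightarrow> ((complex^'m) \<Rightarrow> complex) \<Rightarrow> complex" where
  "fock_inner f h = (\<integral>z. f z * cnj (h z) \<partial>gauss)"

definition osc :: "complex \<times> (real^('n::finite + 'n)^('n + 'n)) \<Rightarrow>
    ((complex^'n) \<Rightarrow> complex) \<Rightarrow> (complex^'n) \<Rightarrow> complex" where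
  "osc = (\<lambda>(l, g) f z.
     \<integral>w. l * exp (1 / 4 * quad_form (HH g) (join (\<chi> i. \<i> * z $ i) (cnj_vec w))) * f w \<partial>gauss)"

text \<open>
  A function on a subset of a type is encoded as a function on the whole type that vanishes
  outside of the subset; this applies to \<open>Mp\<close>, \<open>Sp\<close> and \<open>sym_unitary\<close>.
\<close>

definition matrix_coeff :: "((complex^'n) \<Rightarrow> complex) \<Rightarrow> ((complex^'n) \<Rightarrow> complex) \<Rightarrow>
    complex \<times> (real^('n::finite + 'n)^('n + 'n)) \<Rightarrow> complex" where
  "matrix_coeff u v = (\<lambda>x. if x \<in> Mp then fock_inner (osc x u) v else 0)"

definition M1 :: "(complex \<times> (real^('n::finite + 'n)^('n + 'n)) \<Rightarrow> complex) set" where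
  "M1 = cfun.span {matrix_coeff u v | u v. u \<in> polys \<and> v \<in> polys}"

definition descends_to :: "(complex \<times> (real^('n::finite + 'n)^('n + 'n)) \<Rightarrow> complex) \<Rightarrow>
    (real^('n::finite + 'n)^('n + 'n) \<Rightarrow> complex) \<Rightarrow> bool" where
  "descends_to f F \<longleftrightarrow> (\<forall>g. g \<notin> Sp \<longrightarrow> F g = 0) \<and> (\<forall>(l, g)\<in>Mp. F g = f (l, g) / l)"

definition M1_over_Lambda :: "(real^('n::finite + 'n)^('n + 'n) \<Rightarrow> complex) set" where
  "M1_over_Lambda = {F. \<exists>f\<in>M1. descends_to f F}"


section \<open>Functions on the space of symmetric unitary matrices\<close>

definition WW :: "((complex^('n::finite + 'n)) \<Rightarrow> complex) \<Rightarrow> complex^('n::finite + 'n)^('n + 'n) \<Rightarrow> complex" where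
  "WW f s = (if s \<in> sym_unitary then
       (\<integral>(z, w). exp (1 / 4 * quad_form s (join (cnj_vec z) (cnj_vec w))) * f (join z w)
          \<partial>(gauss \<Otimes>\<^sub>M gauss))
     else 0)"

definition W1 :: "(complex^('n::finite + 'n)^('n + 'n) \<Rightarrow> complex) set" where
  "W1 = cfun.span {WW f | f. f \<in> polys}"

definition cont_fun :: "(complex^'m^'m \<Rightarrow> complex) set" where
  "cont_fun = {f. continuous_on sym_unitary f \<and> (\<forall>s. s \<notin> sym_unitary \<longrightarrow> f s = 0)}"

text \<open>
  The matrix space is taken as a real vector space in \<open>polynomial_function\<close>, so these are the
  restrictions of polynomials in the entries of \<open>s\<close> and their conjugates: the (complex valued)
  regular functions of the real algebraic variety \<open>sym_unitary\<close>.
\<close>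

definition algebraic_fun :: "(complex^'m^'m \<Rightarrow> complex) set" where
  "algebraic_fun = {f. (\<exists>p. polynomial_function p \<and> (\<forall>s\<in>sym_unitary. f s = p s)) \<and>
                       (\<forall>s. s \<notin> sym_unitary \<longrightarrow> f s = 0)}"

text \<open>\<open>\<phi>\<close> is the push-forward of \<open>F\<close> under \<open>HH\<close>, extended by continuity to all of \<open>sym_unitary\<close>.\<close>

definition is_push_forward :: "(real^('n::finite + 'n)^('n + 'n) \<Rightarrow> complex) \<Rightarrow>
    (complex^('n::finite + 'n)^('n + 'n) \<Rightarrow> complex) \<Rightarrow> bool" where
  "is_push_forward F \<phi> \<longleftrightarrow> \<phi> \<in> cont_fun \<and> (\<forall>g\<in>Sp. \<phi> (HH g) = F g)"


section \<open>Irreducible subspaces and highest weights for the unitary group\<close>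

definition act :: "complex^'m^'m \<Rightarrow> (complex^'m^'m \<Rightarrow> complex) \<Rightarrow> complex^'m^'m \<Rightarrow> complex" where
  "act g f = (\<lambda>s. f (matrix_inv g ** s ** transpose (matrix_inv g)))"

definition invariant_subspace :: "(complex^'m^'m \<Rightarrow> complex) set \<Rightarrow> bool" where
  "invariant_subspace V \<longleftrightarrow>
     cfun.subspace V \<and> V \<subseteq> cont_fun \<and> (\<forall>g\<in>unitary_group. \<forall>f\<in>V. act g f \<in> V)"

definition irreducible_subspace :: "(complex^'m^'m \<Rightarrow> complex) set \<Rightarrow> bool" where
  "irreducible_subspace V \<longleftrightarrow>
     invariant_subspace V \<and> V \<noteq> {0} \<and> (\<exists>B. finite B \<and> V = cfun.span B) \<and>
     (\<forall>U. invariant_subspace U \<and> U \<subseteq> V \<longrightarrow> U = {0} \<or> U = V)"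

definition is_weight :: "(complex^'m^'m \<Rightarrow> complex) set \<Rightarrow> ('m \<Rightarrow> int) \<Rightarrow> bool" where
  "is_weight V \<nu> \<longleftrightarrow> (\<exists>f\<in>V. f \<noteq> 0 \<and>
     (\<forall>t. (\<forall>i. norm (t i) = 1) \<longrightarrow>
        act (diag_mat t) f = cscale (\<Prod>i\<in>UNIV. t i powi \<nu> i) f))"

text \<open>
  The positive roots are \<open>e\<^sub>i - e\<^sub>j\<close> for \<open>i < j\<close>. Every weight is obtained from the highest one by
  subtracting a combination \<open>\<Sum> c i j (e\<^sub>i - e\<^sub>j)\<close> with natural number coefficients.
\<close>

definition has_highest_weight ::
  "(complex^('m::{finite,linorder})^('m::{finite,linorder}) \<Rightarrow> complex) set \<Rightarrow> ('m \<Rightarrow> int) \<Rightarrow> bool" where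
  "has_highest_weight V \<nu> \<longleftrightarrow> is_weight V \<nu> \<and>
     (\<forall>\<mu>. is_weight V \<mu> \<longrightarrow>
        (\<exists>c :: 'm \<Rightarrow> 'm \<Rightarrow> nat. \<forall>k.
           \<nu> k - \<mu> k = (\<Sum>j | k < j. int (c k j)) - (\<Sum>i | i < k. int (c i k))))"

definition C_irr :: "('m \<Rightarrow> int) \<Rightarrow> (complex^('m::{finite,linorder})^('m::{finite,linorder}) \<Rightarrow> complex) set" where
  "C_irr \<nu> = (THE V. irreducible_subspace V \<and> has_highest_weight V \<nu>)"

text \<open>The weight \<open>(0, \<dots>, 0, a)\<close>.\<close>

definition last_weight :: "int \<Rightarrow> 'm::{finite,linorder} \<Rightarrow> int" where
  "last_weight a = (\<lambda>k. if k = Max UNIV then a else 0)"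

end

theory Submission
  imports Defs "HOL-Computational_Algebra.Polynomial_Factorial" "HOL-Computational_Algebra.Field_as_Ring"
begin

text \<open>
  Expanding the exponential and using orthogonality of monomials for the Gaussian measure, \<open>W\<close> maps a
  monomial of degree \<open>2i\<close> to a nonzero multiple of the corresponding coefficient of \<open>u \<mapsto> (u\<^sup>t s u)\<^sup>i\<close>, and
  monomials of odd degree to \<open>0\<close>. So \<open>\<W>\<^sub>1\<close> is the sum of the spaces \<open>V\<^sub>i\<close> spanned by the functions
  \<open>s \<mapsto> (u\<^sup>t s u)\<^sup>i\<close>. Averaging over roots of unity in the torus shows that each \<open>V\<^sub>i\<close> is irreducible, with
  highest weight vector \<open>(s\<^sub>N\<^sub>N)\<^sup>i\<close> of weight \<open>(0,\<dots>,0,-2i)\<close>, where \<open>N = 2n\<close>.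

  That no other irreducible space of continuous functions has this highest weight is proved without
  Lie algebras or Haar measure. All weights of such a space are nonpositive with sum \<open>-2i\<close>, so a vector
  of the extreme weight is fixed by every torus, hence by every complex reflection, of the
  stabilizer \<open>U(N-1)\<close> of the last basis vector. By Takagi's factorization it is a function of
  \<open>s\<^sub>N\<^sub>N\<close>, and restricting it to conjugate tori shows that it is a multiple of \<open>(s\<^sub>N\<^sub>N)\<^sup>i\<close>.

  For the push-forward, write \<open>g\<close> as \<open>z \<mapsto> P z + Q cnj z\<close>; then \<open>\<H>(g)\<close> has the blocks \<open>cnj Q P\<^sup>-\<^sup>1\<close>,
  \<open>-i P\<^sup>-\<^sup>t\<close>, \<open>-i P\<^sup>-\<^sup>1\<close>, \<open>P\<^sup>-\<^sup>1 Q\<close>, so it is well defined, and its image contains the dense set of all \<open>s\<close> with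
  invertible lower left block. Substituting \<open>z \<mapsto> -i cnj z\<close> in the matrix coefficient of \<open>u\<close> and \<open>v\<close>
  turns it into \<open>\<Lambda>\<close> times \<open>W\<close> of a polynomial with variables separated.
\<close>

subsection \<open>Matrices and Hermitian forms\<close>

text \<open>\<open>HH\<close> and \<open>C_irr\<close> are definite descriptions, so neither says
  anything until uniqueness is known; this decides where the work lies. For \<open>C_irr\<close> the
  only information about weights is the dominance order in \<open>has_highest_weight\<close>. Roots
  have coordinate sum zero, which fixes the sum of every weight. No index precedes the first one, so
  the first coordinate of a weight is at most that of the highest weight, which is \<open>0\<close>
  because \<open>2n\<close> is at least \<open>2\<close>; permutation matrices carry this bound to
  all coordinates. Hence every coordinate lies between \<open>-2i\<close> and \<open>0\<close>.
  These bounds act twice: the circle at the last index alone detects the extreme weight, and the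
  restriction of a vector to a circle is a polynomial of degree at most \<open>2i\<close> instead of
  a Laurent polynomial. The degree bound leaves only a constant once
  \<open>(a z^2 + 1 - a)^i\<close> has been divided out.\<close>

definition adj :: "complex^'m^'k \<Rightarrow> complex^'k^'m" where
  "adj A = transpose (cnj_mat A)"

definition herm :: "complex^'m \<Rightarrow> complex^'m \<Rightarrow> complex" where
  "herm x y = (\<Sum>i\<in>UNIV. x $ i * cnj (y $ i))"

lemma adj_nth [simp]: "adj A $ i $ j = cnj (A $ j $ i)"
  by (simp add: adj_def transpose_def cnj_mat_def)

lemma cnj_mat_nth [simp]: "cnj_mat A $ i $ j = cnj (A $ i $ j)"
  by (simp add: cnj_mat_def)

lemma transpose_nth: "transpose A $ i $ j = A $ j $ i"
  by (simp add: transpose_def)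

lemma diag_mat_nth: "diag_mat d $ i $ j = (if i = j then d i else 0)"
  by (simp add: diag_mat_def)

lemma mat_nth: "mat c $ i $ j = (if i = j then c else 0)"
  by (simp add: mat_def)

lemma cnj_vec_nth [simp]: "cnj_vec z $ i = cnj (z $ i)"
  by (simp add: cnj_vec_def)

lemma matrix_mult_nth: "(A ** B) $ i $ j = (\<Sum>k\<in>UNIV. A $ i $ k * B $ k $ j)"
  by (simp add: matrix_matrix_mult_def)

lemma matrix_vec_nth: "(A *v x) $ i = (\<Sum>k\<in>UNIV. A $ i $ k * x $ k)"
  by (simp add: matrix_vector_mult_def)

lemma adj_adj [simp]: "adj (adj A) = A"
  by (simp add: vec_eq_iff)

lemma adj_mat_1 [simp]: "adj (mat 1) = mat 1"
  by (simp add: vec_eq_iff mat_nth)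

lemma adj_mult: "adj (A ** B) = adj B ** adj A"
  by (simp add: vec_eq_iff matrix_mult_nth mult.commute)

lemma cnj_mat_mult: "cnj_mat (A ** B) = cnj_mat A ** cnj_mat B"
  by (simp add: vec_eq_iff matrix_mult_nth)

lemma cnj_mat_cnj_mat [simp]: "cnj_mat (cnj_mat A) = A"
  by (simp add: vec_eq_iff)

lemma cnj_mat_1 [simp]: "cnj_mat (mat 1) = mat 1"
  by (simp add: vec_eq_iff mat_nth)

lemma transpose_adj: "transpose (adj A) = cnj_mat A" "adj (transpose A) = cnj_mat A"
  "cnj_mat (transpose A) = adj A" "transpose (cnj_mat A) = adj A" "cnj_mat (adj A) = transpose A"
  "adj (cnj_mat A) = transpose A"
  by (simp_all add: vec_eq_iff transpose_nth)

lemma unitary_iff: "k \<in> unitary_group \<longleftrightarrow> adj k ** k = mat 1 \<and> k ** adj k = mat 1"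
  by (simp add: unitary_group_def adj_def)

lemma unitaryI: "adj k ** k = mat 1 \<Longrightarrow> k \<in> unitary_group"
  using matrix_left_right_inverse[of "adj k" k] by (simp add: unitary_iff)

lemma unitaryI': "k ** adj k = mat 1 \<Longrightarrow> k \<in> unitary_group"
  using matrix_left_right_inverse[of k "adj k"] by (simp add: unitary_iff)

lemma unitaryD: assumes "k \<in> unitary_group" shows "adj k ** k = mat 1" "k ** adj k = mat 1"
  using assms by (simp_all add: unitary_iff)

lemma unitary_1 [simp]: "mat 1 \<in> unitary_group"
  by (simp add: unitary_iff)

lemma unitary_adj [simp]: "k \<in> unitary_group \<Longrightarrow> adj k \<in> unitary_group"
  by (simp add: unitary_iff)

lemma unitary_mult [simp]:
  assumes "k \<in> unitary_group" "h \<in> unitary_group" shows "k ** h \<in> unitary_group"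
proof (rule unitaryI)
  have "adj (k ** h) ** (k ** h) = adj h ** (adj k ** k) ** h"
    by (simp only: adj_mult matrix_mul_assoc)
  then show "adj (k ** h) ** (k ** h) = mat 1"
    using assms by (simp add: unitaryD)
qed

lemma unitary_cnj [simp]: "k \<in> unitary_group \<Longrightarrow> cnj_mat k \<in> unitary_group"
proof (rule unitaryI)
  assume "k \<in> unitary_group"
  then have "cnj_mat (adj k ** k) = mat 1" by (simp add: unitaryD)
  then show "adj (cnj_mat k) ** cnj_mat k = mat 1" by (simp add: cnj_mat_mult transpose_adj)
qed

lemma unitary_transpose [simp]: "k \<in> unitary_group \<Longrightarrow> transpose k \<in> unitary_group"
  by (metis unitary_adj unitary_cnj transpose_adj(5))

lemma matrix_inv_eqI:
  fixes A B :: "'a::field^'m^'m"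
  assumes "A ** B = mat 1"
  shows "matrix_inv A = B"
proof -
  have BA: "B ** A = mat 1" using assms matrix_left_right_inverse by metis
  have "\<exists>A'. A ** A' = mat 1 \<and> A' ** A = mat 1" using assms BA by blast
  then have "A ** matrix_inv A = mat 1"
    unfolding matrix_inv_def by (rule someI2_ex) blast
  then have "B ** (A ** matrix_inv A) = B" by simp
  then show ?thesis by (simp add: matrix_mul_assoc BA)
qed

lemma matrix_inv_unitary: "k \<in> unitary_group \<Longrightarrow> matrix_inv k = adj k"
  by (rule matrix_inv_eqI) (simp add: unitaryD)

lemma herm_adj: "herm (A *v x) y = herm x (adj A *v y)"
proof -
  have "herm (A *v x) y = (\<Sum>i\<in>UNIV. \<Sum>k\<in>UNIV. A $ i $ k * x $ k * cnj (y $ i))"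
    by (simp add: herm_def matrix_vec_nth sum_distrib_right)
  also have "\<dots> = (\<Sum>k\<in>UNIV. \<Sum>i\<in>UNIV. A $ i $ k * x $ k * cnj (y $ i))"
    by (rule sum.swap)
  also have "\<dots> = herm x (adj A *v y)"
    by (simp add: herm_def matrix_vec_nth sum_distrib_left mult_ac)
  finally show ?thesis .
qed

lemma herm_unitary: "u \<in> unitary_group \<Longrightarrow> herm (u *v x) (u *v y) = herm x y"
  by (simp add: herm_adj matrix_vector_mul_assoc unitaryD)

lemma herm_commute: "herm y x = cnj (herm x y)"
  by (simp add: herm_def mult.commute)

lemma herm_simps: "herm (x + y) z = herm x z + herm y z" "herm (x - y) z = herm x z - herm y z"
  "herm z (x + y) = herm z x + herm z y" "herm z (x - y) = herm z x - herm z y"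
  "herm (c *s x) z = c * herm x z" "herm z (c *s x) = cnj c * herm z x"
  "herm (r *\<^sub>R x) z = r * herm x z" "herm z (r *\<^sub>R x) = r * herm z x"
  "herm 0 z = 0" "herm z 0 = 0"
  by (simp_all add: herm_def algebra_simps sum.distrib sum_subtractf sum_distrib_left
      scaleR_conv_of_real[where 'a=complex])

lemma inner_herm: "x \<bullet> y = Re (herm x y)"
  by (simp add: inner_vec_def herm_def inner_complex_def)

lemma herm_self: "herm x x = complex_of_real ((norm x)\<^sup>2)"
proof -
  have "Im (herm x x) = 0" by (simp add: herm_def)
  moreover have "Re (herm x x) = (norm x)\<^sup>2"
    using inner_herm[of x x] by (simp add: power2_norm_eq_inner)
  ultimately show ?thesis by (simp add: complex_eq_iff)
qed

lemma herm_self_eq_0 [simp]: "herm x x = 0 \<longleftrightarrow> x = 0"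
  by (simp add: herm_self)

lemma herm_self_eq_1: "herm x x = 1 \<longleftrightarrow> norm x = 1"
proof -
  have "herm x x = 1 \<longleftrightarrow> (norm x)\<^sup>2 = 1"
    by (metis herm_self of_real_eq_1_iff)
  then show ?thesis by (simp add: power2_eq_1_iff) (metis norm_ge_zero neg_0_le_iff_le not_one_le_zero)
qed

lemma norm_unitary: "u \<in> unitary_group \<Longrightarrow> norm (u *v x) = norm x"
  using herm_unitary[of u x x] unfolding herm_self of_real_eq_iff by simp

lemma herm_axis: "herm x (axis j 1) = x $ j" "herm (axis j 1) x = cnj (x $ j)"
  unfolding herm_def axis_def
  by (simp_all add: if_distrib[of "\<lambda>c. _ * cnj c"] if_distrib[of "\<lambda>c. c * _"] cong: if_cong)

lemma matrix_vec_axis: "(A *v axis j 1) $ i = (A $ i $ j :: complex)"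
  unfolding matrix_vec_nth axis_def
  by (simp add: if_distrib[of "\<lambda>c. _ * c"] cong: if_cong)

lemma matrix_eq_axis: "A = B \<longleftrightarrow> (\<forall>j. A *v axis j 1 = B *v axis j (1::complex))"
  by (auto simp: vec_eq_iff matrix_vec_axis)

subsection \<open>Complex reflections\<close>

text \<open>For a unit vector \<open>w\<close>, the complex reflection that multiplies
  \<open>w\<close> by \<open>l\<close> and fixes the orthogonal complement of \<open>w\<close>. The
  eigenvalue is left free because a Householder matrix, \<open>l = -1\<close>, joins distinct
  vectors \<open>x\<close>, \<open>y\<close> of equal norm only if \<open>herm x y\<close> is
  real.\<close>

definition refl_mat :: "complex^'m \<Rightarrow> complex \<Rightarrow> complex^'m^'m" where
  "refl_mat w l = (\<chi> i j. (if i = j then 1 else 0) - (1 - l) * w $ i * cnj (w $ j))"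

lemma refl_mat_vec: "refl_mat w l *v x = x - ((1 - l) * herm x w) *s w"
proof -
  have "(refl_mat w l *v x) $ i = x $ i - (1 - l) * herm x w * w $ i" for i
  proof -
    have "(refl_mat w l *v x) $ i =
        (\<Sum>k\<in>UNIV. (if i = k then x $ k else 0) - (1 - l) * w $ i * (x $ k * cnj (w $ k)))"
      unfolding matrix_vec_nth refl_mat_def by (rule sum.cong) (auto simp: algebra_simps)
    also have "\<dots> = x $ i - (1 - l) * w $ i * herm x w"
      by (simp add: sum_subtractf sum_distrib_left herm_def)
    finally show ?thesis by simp
  qed
  then show ?thesis by (simp add: vec_eq_iff)
qed

lemma refl_mat_1 [simp]: "refl_mat w 1 = mat 1"
  by (simp add: vec_eq_iff refl_mat_def mat_nth)

lemma refl_mat_mult: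
  assumes "herm w w = 1"
  shows "refl_mat w a ** refl_mat w b = refl_mat w (a * b)"
proof -
  have "refl_mat w a *v (refl_mat w b *v x) = refl_mat w (a * b) *v x" for x
    unfolding refl_mat_vec herm_simps assms by (simp add: vec_eq_iff algebra_simps)
  then show ?thesis
    unfolding matrix_eq_axis by (simp add: matrix_vector_mul_assoc[symmetric])
qed

lemma adj_refl_mat: "adj (refl_mat w l) = refl_mat w (cnj l)"
  by (simp add: vec_eq_iff refl_mat_def)

lemma refl_mat_unitary:
  assumes "herm w w = 1" "norm l = 1"
  shows "refl_mat w l \<in> unitary_group"
proof (rule unitaryI)
  have "cnj l * l = 1" using assms(2) by (metis complex_norm_square mult.commute of_real_1 power_one)
  then show "adj (refl_mat w l) ** refl_mat w l = mat 1"
    by (simp add: adj_refl_mat refl_mat_mult assms)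
qed

lemma refl_mat_fix: "herm x w = 0 \<Longrightarrow> refl_mat w l *v x = x"
  by (simp add: refl_mat_vec)

text \<open>The vector of the reflection must be parallel to \<open>d = x - y\<close>. With
  \<open>h = herm x d\<close>, equal norms give \<open>herm d d = h + cnj h\<close>, and reaching
  \<open>y\<close> asks for \<open>(1 - l) * h = herm d d\<close>; so
  \<open>l = - cnj h / h\<close>, of modulus 1. The scalar \<open>a\<close> is exported so that
  linear conditions on \<open>x - y\<close> pass to \<open>w\<close>.\<close>

lemma reflection_between:
  assumes eq: "herm x x = herm y y" and ne: "x \<noteq> y"
  obtains w l a where "herm w w = 1" "norm l = 1" "refl_mat w l *v x = y"
    "w = complex_of_real a *s (x - y)" "Im (herm x y) = 0 \<longrightarrow> l = -1"
proof -
  define d where "d = x - y"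
  have d0: "d \<noteq> 0" using ne by (simp add: d_def)
  define h where "h = herm x d"
  have hd: "herm d d = h + cnj h"
    unfolding h_def d_def herm_simps using eq herm_commute[of x y] herm_commute[of y y]
    by (simp add: herm_commute[symmetric])
  have h0: "h \<noteq> 0" using hd d0 by auto
  define l where "l = - cnj h / h"
  have l1: "norm l = 1" using h0 by (simp add: l_def norm_divide)
  define w where "w = complex_of_real (1 / norm d) *s d"
  have nd: "complex_of_real (norm d) \<noteq> 0" using d0 by simp
  have hdn: "herm d d = complex_of_real (norm d) * complex_of_real (norm d)"
    by (simp add: herm_self power2_eq_square)
  have ww: "herm w w = 1"
    unfolding w_def herm_simps hdn using nd by (simp add: divide_simps)
  have "(1 - l) * h = herm d d" using h0 hd by (simp add: l_def field_simps)
  then have "(1 - l) * herm x w * (1 / complex_of_real (norm d)) = 1"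
    unfolding w_def herm_simps h_def[symmetric] hdn using nd by (simp add: divide_simps)
  moreover have "refl_mat w l *v x = x - ((1 - l) * herm x w * (1 / complex_of_real (norm d))) *s d"
    unfolding refl_mat_vec by (simp add: w_def vec_eq_iff)
  ultimately have "refl_mat w l *v x = y" by (simp add: d_def)
  moreover have "l = -1" if "Im (herm x y) = 0"
  proof -
    have "Im h = 0" using that by (simp add: h_def d_def herm_simps herm_self)
    then have "cnj h = h" by (simp add: complex_eq_iff)
    then show ?thesis using h0 by (simp add: l_def)
  qed
  ultimately show thesis using that[OF ww l1] w_def d_def by blast
qed

text \<open>Each step sends one more column back to its axis vector and keeps those already in
  place, so the number of displaced axes drops. Carrying \<open>A\<close> along makes one induction
  serve the full group (\<open>A\<close> empty) and the stabilizer of the last axis.\<close>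

lemma unitary_refl_induct [consumes 2, case_names one refl]:
  assumes "u \<in> unitary_group" "\<forall>j\<in>A. u *v axis j 1 = axis j 1"
    and one: "P (mat 1)"
    and refl: "\<And>u w l. u \<in> unitary_group \<Longrightarrow> (\<forall>j\<in>A. u *v axis j 1 = axis j 1) \<Longrightarrow> P u \<Longrightarrow>
       herm w w = 1 \<Longrightarrow> norm l = 1 \<Longrightarrow> (\<forall>j\<in>A. w $ j = 0) \<Longrightarrow> P (refl_mat w l ** u)"
  shows "P u"
  using assms(1,2)
proof (induction "card {j. u *v axis j 1 \<noteq> axis j 1}" arbitrary: u rule: less_induct)
  case less
  show ?case
  proof (cases "{j. u *v axis j 1 \<noteq> axis j 1} = {}")
    case True
    then have "u = mat 1" by (simp add: matrix_eq_axis)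
    then show ?thesis using one by simp
  next
    case False
    then obtain j where j: "u *v axis j 1 \<noteq> axis j 1" by blast
    have eq: "herm (u *v axis j 1) (u *v axis j 1) = herm (axis j 1) (axis j (1::complex))"
      by (rule herm_unitary[OF less.prems(1)])
    obtain w l a where w: "herm w w = 1" "norm l = 1" "refl_mat w l *v (u *v axis j 1) = axis j 1"
      "w = complex_of_real a *s (u *v axis j 1 - axis j 1)"
      using reflection_between[OF eq j] by metis
    \<comment> \<open>Both \<open>u e_j\<close> and \<open>e_j\<close> are orthogonal to an axis
      that \<open>u\<close> fixes, hence so is \<open>w\<close>.\<close>
    have w0: "w $ i = 0" if "u *v axis i 1 = axis i 1" for i
    proof -
      have ij: "i \<noteq> j" using that j by auto
      have "herm (u *v axis j 1) (axis i 1) = herm (u *v axis j 1) (u *v axis i 1)"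
        using that by simp
      also have "\<dots> = herm (axis j 1) (axis i 1)" by (rule herm_unitary[OF less.prems(1)])
      finally have "(u *v axis j 1) $ i = axis j 1 $ i" by (simp only: herm_axis)
      then show ?thesis by (simp add: w(4))
    qed
    have u': "refl_mat w l ** u \<in> unitary_group"
      using less.prems w by (simp add: refl_mat_unitary)
    have fixi: "refl_mat w l ** u *v axis i 1 = axis i 1" if "u *v axis i 1 = axis i 1" for i
      using w0[OF that] that by (simp add: matrix_vector_mul_assoc[symmetric] refl_mat_fix herm_axis)
    have "{i. refl_mat w l ** u *v axis i 1 \<noteq> axis i 1} \<subset> {i. u *v axis i 1 \<noteq> axis i 1}"
      using fixi j w(3) by (auto simp: matrix_vector_mul_assoc)
    then have "card {i. refl_mat w l ** u *v axis i 1 \<noteq> axis i 1} < card {i. u *v axis i 1 \<noteq> axis i 1}"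
      by (intro psubset_card_mono) simp_all
    moreover have fixA: "\<forall>i\<in>A. refl_mat w l ** u *v axis i 1 = axis i 1"
      using fixi less.prems by blast
    ultimately have "P (refl_mat w l ** u)" using less.hyps u' by blast
    moreover have "\<forall>i\<in>A. w $ i = 0" using w0 less.prems by blast
    \<comment> \<open>The conjugate eigenvalue gives the inverse reflection, which leads back to
      \<open>u\<close>.\<close>
    ultimately have "P (refl_mat w (cnj l) ** (refl_mat w l ** u))"
      using refl[OF u' fixA, of w "cnj l"] w by simp
    moreover have "cnj l * l = 1"
      using w(2) by (metis complex_norm_square mult.commute of_real_1 power_one)
    ultimately show ?thesis by (simp add: matrix_mul_assoc refl_mat_mult[OF w(1)])
  qed
qed

text \<open>The reflection taking \<open>axis i 1\<close> to \<open>w\<close> has its vector in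
  their span, which is orthogonal to the axes in \<open>A\<close>.\<close>

lemma unitary_extend:
  assumes "herm w w = 1" "\<forall>j\<in>A. w $ j = 0" "i \<notin> A"
  obtains k where "k \<in> unitary_group" "k *v axis i 1 = w" "\<forall>j\<in>A. k *v axis j 1 = axis j 1"
proof (cases "w = axis i 1")
  case True
  then show ?thesis using that[of "mat 1"] by simp
next
  case False
  have "herm (axis i 1) (axis i 1) = herm w w" by (simp add: assms herm_axis)
  then obtain v l a where v: "herm v v = 1" "norm l = 1" "refl_mat v l *v axis i 1 = w"
    "v = complex_of_real a *s (axis i 1 - w)"
    using reflection_between False by metis
  have "refl_mat v l *v axis j 1 = axis j 1" if "j \<in> A" for j
  proof (rule refl_mat_fix)
    have "v $ j = 0" using that assms by (auto simp: v(4) axis_def)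
    then show "herm (axis j 1) v = 0" by (simp add: herm_axis)
  qed
  then show ?thesis using that[of "refl_mat v l"] v refl_mat_unitary by blast
qed

text \<open>Diagonalizing a reflection places it in a conjugate of a coordinate circle, so
  invariance under reflections becomes a question about torus weights.\<close>

lemma refl_mat_conj_diag:
  assumes "k \<in> unitary_group" "k *v axis i 1 = w"
  shows "refl_mat w l = k ** diag_mat (\<lambda>j. if j = i then l else 1) ** adj k"
proof -
  have "(k ** diag_mat (\<lambda>j. if j = i then l else 1) ** adj k) $ a $ b =
      (k ** adj k) $ a $ b - (1 - l) * k $ a $ i * cnj (k $ b $ i)" for a b
  proof -
    have "(k ** diag_mat (\<lambda>j. if j = i then l else 1)) $ a $ c = k $ a $ c * (if c = i then l else 1)" for c
      unfolding matrix_mult_nth diag_mat_nth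
      by (simp add: if_distrib[of "\<lambda>c. _ * c"] cong: if_cong)
    then have "(k ** diag_mat (\<lambda>j. if j = i then l else 1) ** adj k) $ a $ b =
       (\<Sum>c\<in>UNIV. k $ a $ c * cnj (k $ b $ c) - (if c = i then (1 - l) * k $ a $ c * cnj (k $ b $ c) else 0))"
      unfolding matrix_mult_nth[of _ "adj k"] by (intro sum.cong) (auto simp: algebra_simps)
    then show ?thesis by (simp add: sum_subtractf matrix_mult_nth)
  qed
  moreover have "w $ a = k $ a $ i" for a
    using assms(2) matrix_vec_axis by metis
  ultimately show ?thesis
    by (simp add: vec_eq_iff unitaryD[OF assms(1)] mat_nth refl_mat_def)
qed

text \<open>Real vectors have real \<open>herm x y\<close>, so the eigenvalue is \<open>-1\<close>
  and the matrix is a real symmetric Householder matrix. The last conclusion lets a second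
  reflection leave the work of the first untouched.\<close>

lemma real_reflection:
  assumes "\<forall>i. Im (x $ i) = 0" "\<forall>i. Im (y $ i) = 0" "herm x x = herm y y"
  obtains k where "k \<in> unitary_group" "\<forall>i j. Im (k $ i $ j) = 0" "transpose k = k" "k *v x = y"
    "\<forall>v. herm v (x - y) = 0 \<longrightarrow> k *v v = v"
proof (cases "x = y")
  case True
  then show ?thesis using that[of "mat 1"] by (simp add: mat_nth)
next
  case False
  obtain w l a where w: "herm w w = 1" "norm l = 1" "refl_mat w l *v x = y"
    "w = complex_of_real a *s (x - y)" "Im (herm x y) = 0 \<longrightarrow> l = -1"
    using reflection_between[OF assms(3) False] by metis
  have "Im (herm x y) = 0" using assms(1,2) by (simp add: herm_def)
  then have l: "l = -1" using w by simp
  have wr: "Im (w $ i) = 0" for i using assms(1,2) by (simp add: w(4))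
  then have wc: "cnj (w $ i) = w $ i" for i by (simp add: complex_eq_iff)
  show ?thesis
  proof (rule that[of "refl_mat w l"])
    show "refl_mat w l \<in> unitary_group" using w refl_mat_unitary by blast
    show "\<forall>i j. Im (refl_mat w l $ i $ j) = 0" by (simp add: refl_mat_def l wr wc)
    show "transpose (refl_mat w l) = refl_mat w l" by (simp add: vec_eq_iff refl_mat_def transpose_nth wc)
    show "refl_mat w l *v x = y" by fact
    show "\<forall>v. herm v (x - y) = 0 \<longrightarrow> refl_mat w l *v v = v"
      by (auto simp: w(4) herm_simps intro!: refl_mat_fix)
  qed
qed

text \<open>Together the two hypotheses say that the real and imaginary parts of \<open>r\<close>
  have the same Gram matrix as those of \<open>s\<close>. One reflection matches the real parts; a
  second one matches the imaginary parts and, the mixed products being equal, fixes the real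
  part.\<close>

lemma real_unitary_transitive:
  assumes h: "herm r r = herm s s" and q: "(\<Sum>i\<in>UNIV. r $ i * r $ i) = (\<Sum>i\<in>UNIV. s $ i * s $ i)"
  obtains k where "k \<in> unitary_group" "\<forall>i j. Im (k $ i $ j) = 0" "k *v r = s"
proof -
  define re where "re v = (\<chi> i. complex_of_real (Re (v $ i)))" for v :: "complex^'a"
  define im where "im v = (\<chi> i. complex_of_real (Im (v $ i)))" for v :: "complex^'a"
  have reim: "v = re v + \<i> *s im v" for v
    by (simp add: vec_eq_iff re_def im_def complex_eq)
  have nn: "herm v v = herm (re v) (re v) + herm (im v) (im v)" for v
    by (simp add: herm_def re_def im_def sum.distrib[symmetric] complex_eq_iff)
  have qq: "(\<Sum>i\<in>UNIV. v $ i * v $ i) = herm (re v) (re v) - herm (im v) (im v) + 2 * \<i> * herm (re v) (im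
      v)" for v
    by (simp add: herm_def re_def im_def sum_distrib_left sum.distrib[symmetric]
        sum_subtractf[symmetric] complex_eq_iff mult.commute)
  have real: "Im (herm (re v) (re v')) = 0" "Im (herm (im v) (im v')) = 0" "Im (herm (re v) (im v')) =
      0" for v v'
    by (simp_all add: herm_def re_def im_def)
  have *: "Re (herm (re r) (re r)) + Re (herm (im r) (im r)) = Re (herm (re s) (re s)) + Re (herm (im s)
      (im s))"
    "Re (herm (re r) (re r)) - Re (herm (im r) (im r)) = Re (herm (re s) (re s)) - Re (herm (im s) (im s))"
    "Re (herm (re r) (im r)) = Re (herm (re s) (im s))"
    using arg_cong[OF h, of Re] arg_cong[OF q, of Re] arg_cong[OF q, of Im]
    unfolding nn[of r] nn[of s] qq by (simp_all add: real)
  have h1: "herm (re r) (re r) = herm (re s) (re s)"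
    and h2: "herm (im r) (im r) = herm (im s) (im s)"
    and h3: "herm (re r) (im r) = herm (re s) (im s)"
    using * by (simp_all add: complex_eq_iff real)
  obtain k1 where k1: "k1 \<in> unitary_group" "\<forall>i j. Im (k1 $ i $ j) = 0" "k1 *v re r = re s"
    using real_reflection[OF _ _ h1] by (metis (no_types, lifting) Im_complex_of_real re_def vec_lambda_beta)
  define y where "y = k1 *v im r"
  have yr: "\<forall>i. Im (y $ i) = 0" unfolding y_def by (simp add: matrix_vec_nth im_def k1)
  have hy: "herm y y = herm (im s) (im s)" by (simp add: y_def herm_unitary k1 h2)
  have hx: "herm (re s) y = herm (re s) (im s)"
    unfolding y_def k1(3)[symmetric] herm_unitary[OF k1(1)] h3 by (simp add: k1(3))
  have ims: "\<forall>i. Im (im s $ i) = 0" by (simp add: im_def)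
  obtain k2 where k2: "k2 \<in> unitary_group" "\<forall>i j. Im (k2 $ i $ j) = 0" "k2 *v y = im s"
    "\<forall>v. herm v (y - im s) = 0 \<longrightarrow> k2 *v v = v"
    using real_reflection[OF yr ims hy] by metis
  have k2r: "k2 *v re s = re s" using k2(4) by (simp add: herm_simps hx)
  show ?thesis
  proof (rule that[of "k2 ** k1"])
    show "k2 ** k1 \<in> unitary_group" using k1 k2 by simp
    show "\<forall>i j. Im ((k2 ** k1) $ i $ j) = 0" by (simp add: matrix_mult_nth k1 k2)
    have "(k2 ** k1) *v r = k2 *v (k1 *v (re r + \<i> *s im r))"
      using reim[of r] by (simp add: matrix_vector_mul_assoc)
    also have "\<dots> = re s + \<i> *s im s"
      by (simp add: matrix_vector_right_distrib vector_scalar_commute k1 k2r k2 y_def[symmetric])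
    finally show "(k2 ** k1) *v r = s" using reim[of s] by simp
  qed
qed

subsection \<open>Takagi factorization\<close>

text \<open>The map \<open>T x = Z *v cnj_vec x\<close> is antilinear, but symmetric for the real
  inner product, so a maximum of \<open>T x \<bullet> x\<close> on the unit sphere of the orthogonal
  complement \<open>S\<close> is a real eigenvector. \<open>T\<close> preserves \<open>S\<close>
  because the \<open>v j\<close> are eigenvectors.\<close>

lemma takagi_step:
  fixes Z :: "complex^'m^'m" and v :: "'m \<Rightarrow> complex^'m"
  assumes sym: "transpose Z = Z"
    and ev: "\<forall>j\<in>A. Z *v cnj_vec (v j) = complex_of_real (\<sigma> j) *s v j"
    and A: "A \<noteq> UNIV"
  obtains u t where "herm u u = 1" "\<forall>j\<in>A. herm u (v j) = 0" "0 \<le> t"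
    "Z *v cnj_vec u = complex_of_real t *s u"
proof -
  define T where "T x = Z *v cnj_vec x" for x
  have Tsym: "herm (T x) y = herm (T y) x" for x y
  proof -
    have Zs: "Z $ i $ k = Z $ k $ i" for i k using sym by (metis transpose_nth)
    have "herm (T x) y = (\<Sum>i\<in>UNIV. \<Sum>k\<in>UNIV. Z $ i $ k * cnj (x $ k) * cnj (y $ i))"
      by (simp add: herm_def T_def matrix_vec_nth sum_distrib_right)
    also have "\<dots> = (\<Sum>k\<in>UNIV. \<Sum>i\<in>UNIV. Z $ i $ k * cnj (x $ k) * cnj (y $ i))"
      by (rule sum.swap)
    also have "\<dots> = (\<Sum>k\<in>UNIV. \<Sum>i\<in>UNIV. Z $ k $ i * cnj (y $ i) * cnj (x $ k))"
      by (intro sum.cong refl) (metis Zs mult.commute mult.assoc)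
    also have "\<dots> = herm (T y) x"
      by (simp add: herm_def T_def matrix_vec_nth sum_distrib_right)
    finally show ?thesis .
  qed
  have Tadd: "T (x + y) = T x + T y" for x y
    by (simp add: T_def vec_eq_iff matrix_vec_nth algebra_simps sum.distrib)
  have Tscale: "T (c *s x) = cnj c *s T x" for c x
    by (simp add: T_def vec_eq_iff matrix_vec_nth sum_distrib_left mult_ac)
  have sR: "r *\<^sub>R x = complex_of_real r *s x" for r and x :: "complex^'m"
    by (simp add: vec_eq_iff scaleR_conv_of_real[where 'a=complex])
  have TscaleR: "T (r *\<^sub>R x) = r *\<^sub>R T x" for r x
    unfolding sR Tscale by simp
  define S where "S = {x. \<forall>j\<in>A. herm x (v j) = 0}"
  have Sadd: "x + y \<in> S" if "x \<in> S" "y \<in> S" for x y using that by (simp add: S_def herm_simps)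
  have Sscale: "c *s x \<in> S" if "x \<in> S" for c x using that by (simp add: S_def herm_simps)
  have ST: "T x \<in> S" if "x \<in> S" for x
  proof -
    have "herm (T x) (v j) = 0" if j: "j \<in> A" for j
    proof -
      have "herm (T x) (v j) = \<sigma> j * herm (v j) x"
        using ev j Tsym[of x] by (simp add: T_def herm_simps)
      then show ?thesis using \<open>x \<in> S\<close> j herm_commute[of "v j" x] by (simp add: S_def)
    qed
    then show ?thesis by (simp add: S_def)
  qed
  have "\<exists>x. x \<in> S \<and> norm x = 1"
  proof -
    \<comment> \<open>Complex orthogonality to \<open>v j\<close> is real orthogonality to
      \<open>v j\<close> and \<open>\<i> *s v j\<close>. These are at most \<open>2 * card A\<close>
      vectors, fewer than the real dimension.\<close>
    define B where "B = v ` A \<union> (\<lambda>j. \<i> *s v j) ` A"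
    have "card B \<le> card A + card A"
      unfolding B_def by (meson add_mono card_Un_le card_image_le finite le_trans)
    moreover have "card A < CARD('m)" using A by (simp add: psubset_card_mono psubset_eq)
    ultimately have "card B < DIM(complex^'m)" by simp
    moreover have "dim B \<le> card B" by (simp add: B_def dim_le_card')
    ultimately have "span B \<noteq> UNIV" by (metis dim_UNIV dim_span not_le)
    then obtain a where a: "a \<noteq> 0" "\<forall>x\<in>span B. a \<bullet> x = 0"
      using span_not_UNIV_orthogonal by metis
    have "herm a (v j) = 0" if "j \<in> A" for j
    proof -
      have "a \<bullet> v j = 0" "a \<bullet> (\<i> *s v j) = 0"
        using a that by (auto simp: B_def intro: span_base)
      then show ?thesis by (simp add: inner_herm herm_simps complex_eq_iff)
    qed
    then have "complex_of_real (1 / norm a) *s a \<in> S" by (simp add: S_def herm_simps)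
    moreover have "norm (complex_of_real (1 / norm a) *s a) = 1"
      unfolding sR[symmetric] using a by simp
    ultimately show ?thesis by blast
  qed
  then have ne: "S \<inter> sphere 0 1 \<noteq> {}" by auto
  have cont_herm: "continuous_on UNIV (\<lambda>x. herm x y)" for y
    unfolding herm_def by (intro continuous_intros)
  have "closed S"
  proof -
    have "S = (\<Inter>j\<in>A. (\<lambda>x. herm x (v j)) -` {0})" by (auto simp: S_def)
    then show ?thesis using cont_herm by (auto intro!: closed_vimage)
  qed
  then have cpt: "compact (S \<inter> sphere 0 1)" by (simp add: closed_Int_compact)
  define g where "g x = T x \<bullet> x" for x
  have "continuous_on (S \<inter> sphere 0 1) g"
    unfolding g_def inner_herm herm_def T_def matrix_vec_nth cnj_vec_nth by (intro continuous_intros)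
  then obtain u where u: "u \<in> S" "norm u = 1" and umax: "\<And>y. y \<in> S \<Longrightarrow> norm y = 1 \<Longrightarrow> g y \<le> g u"
    using continuous_attains_sup[OF cpt ne, of g] by auto
  define M where "M = g u"
  have gle: "g x \<le> M * (norm x)\<^sup>2" if "x \<in> S" for x
  proof (cases "x = 0")
    case True then show ?thesis by (simp add: g_def)
  next
    case False
    have "(1 / norm x) *\<^sub>R x \<in> S" using Sscale that by (simp add: sR)
    then have "g ((1 / norm x) *\<^sub>R x) \<le> M" using umax False by (simp add: M_def)
    then have "g x / (norm x)\<^sup>2 \<le> M" by (simp add: g_def TscaleR power2_eq_square)
    then show ?thesis using False by (simp add: field_simps)
  qed
  have symm: "T x \<bullet> y = T y \<bullet> x" for x y using Tsym by (simp add: inner_herm)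
  have crit: "T u \<bullet> w = M * (u \<bullet> w)" if w: "w \<in> S" for w
  proof -
    \<comment> \<open>First and second order coefficients of the variation along
      \<open>u + t w\<close>.\<close>
    define a where "a = 2 * (T u \<bullet> w - M * (u \<bullet> w))"
    define b where "b = M * (norm w)\<^sup>2 - g w"
    have le: "t * a \<le> t\<^sup>2 * b" for t
    proof -
      have "u + t *\<^sub>R w \<in> S" using Sadd Sscale u w by (simp add: sR)
      from gle[OF this] have "g (u + t *\<^sub>R w) \<le> M * (norm (u + t *\<^sub>R w))\<^sup>2" .
      moreover have "g (u + t *\<^sub>R w) = M + 2 * t * (T u \<bullet> w) + t\<^sup>2 * g w"
        by (simp add: g_def M_def Tadd TscaleR inner_add_left inner_add_right power2_eq_square symm[of w
            u] algebra_simps)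
      moreover have "(norm (u + t *\<^sub>R w))\<^sup>2 = 1 + 2 * t * (u \<bullet> w) + t\<^sup>2 * (norm w)\<^sup>2"
      proof -
        have "u \<bullet> u = 1" using u(2) by (simp add: norm_eq_1)
        then show ?thesis
          unfolding power2_norm_eq_inner inner_add_left inner_add_right inner_scaleR_left inner_scaleR_right
            inner_commute[of w u] by (simp add: power2_eq_square algebra_simps)
      qed
      ultimately show ?thesis by (simp add: a_def b_def algebra_simps)
    qed
    have "a = 0"
    proof (rule ccontr)
      assume a0: "a \<noteq> 0"
      \<comment> \<open>For this \<open>t\<close> the product \<open>t * a\<close> is
        \<open>t^2 * (\<bar>b\<bar> + 1)\<close>, which exceeds \<open>t^2 * b\<close> unless
        \<open>t = 0\<close>.\<close>
      define t where "t = a / (\<bar>b\<bar> + 1)"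
      have "t * a \<le> t\<^sup>2 * b" by (rule le)
      also have "\<dots> \<le> t\<^sup>2 * \<bar>b\<bar>" by (simp add: mult_left_mono)
      finally have "t * a \<le> t\<^sup>2 * \<bar>b\<bar>" .
      moreover have at: "a = t * (\<bar>b\<bar> + 1)" by (simp add: t_def)
      ultimately have "t * (t * (\<bar>b\<bar> + 1)) \<le> t\<^sup>2 * \<bar>b\<bar>" by simp
      then have "t\<^sup>2 \<le> 0" by (simp add: power2_eq_square algebra_simps)
      then show False using a0 at by simp
    qed
    then show ?thesis by (simp add: a_def)
  qed
  define w where "w = T u - M *\<^sub>R u"
  have "w \<in> S" using ST[OF u(1)] Sadd Sscale[OF u(1), of "- complex_of_real M"]
    by (metis (no_types, lifting) diff_conv_add_uminus of_real_minus sR scaleR_minus_left w_def)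
  then have "w \<bullet> w = 0" using crit[of w] by (simp add: w_def inner_diff_left)
  then have Tu: "T u = complex_of_real M *s u" by (simp add: w_def sR)
  \<comment> \<open>By antilinearity, multiplication by \<open>\<i>\<close> reverses the sign of
    \<open>g\<close>, so the maximum is nonnegative.\<close>
  have "g (\<i> *s u) = - M"
    unfolding g_def M_def Tscale inner_herm herm_simps by simp
  moreover have "g (\<i> *s u) \<le> M"
  proof -
    have "herm (\<i> *s u) (\<i> *s u) = 1" using u(2) by (simp add: herm_simps herm_self_eq_1)
    then have "norm (\<i> *s u) = 1" by (simp only: herm_self_eq_1)
    then show ?thesis using umax[OF Sscale[OF u(1)]] by (simp add: M_def)
  qed
  ultimately have M0: "0 \<le> M" by linarith
  have "herm u u = 1" using u(2) by (simp only: herm_self_eq_1)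
  moreover have "\<forall>j\<in>A. herm u (v j) = 0" using u(1) by (simp add: S_def)
  ultimately show thesis
    by (rule that[OF _ _ M0]) (use Tu in \<open>simp only: T_def\<close>)
qed

text \<open>The columns of \<open>U\<close> are the eigenvectors of the preceding step, added one at
  a time to an orthonormal family until the index set is exhausted.\<close>

theorem takagi:
  fixes Z :: "complex^'m^'m"
  assumes "transpose Z = Z"
  obtains U \<sigma> where "U \<in> unitary_group" "\<forall>j. 0 \<le> \<sigma> j"
    "Z = U ** diag_mat (\<lambda>j. complex_of_real (\<sigma> j)) ** transpose U"
proof -
  have "\<exists>v \<sigma>. (\<forall>i\<in>A. \<forall>j\<in>A. herm (v i) (v j) = (if i = j then 1 else 0)) \<and>
     (\<forall>j\<in>A. 0 \<le> \<sigma> j \<and> Z *v cnj_vec (v j) = complex_of_real (\<sigma> j) *s v j)" for A :: "'m set"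
  proof (induction A rule: infinite_finite_induct)
    case (insert a A)
    then obtain v \<sigma> where IH: "\<forall>i\<in>A. \<forall>j\<in>A. herm (v i) (v j) = (if i = j then 1 else 0)"
      "\<forall>j\<in>A. 0 \<le> \<sigma> j \<and> Z *v cnj_vec (v j) = complex_of_real (\<sigma> j) *s v j" by blast
    have ev: "\<forall>j\<in>A. Z *v cnj_vec (v j) = complex_of_real (\<sigma> j) *s v j" using IH by blast
    have A: "A \<noteq> UNIV" using insert by auto
    obtain u t where u: "herm u u = 1" "\<forall>j\<in>A. herm u (v j) = 0" "0 \<le> t"
      "Z *v cnj_vec u = complex_of_real t *s u"
      using takagi_step[OF assms ev A] .
    have u': "\<forall>j\<in>A. herm (v j) u = 0" using u(2) herm_commute[of _ u] by simp
    show ?case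
      by (rule exI[of _ "v(a := u)"], rule exI[of _ "\<sigma>(a := t)"])
        (use IH u u' insert.hyps in auto)
  qed auto
  then obtain v \<sigma> where v: "\<And>i j. herm (v i) (v j) = (if i = j then 1 else 0)"
     "\<And>j. 0 \<le> \<sigma> j" "\<And>j. Z *v cnj_vec (v j) = complex_of_real (\<sigma> j) *s v (j::'m)"
    by (metis UNIV_I)
  define U where "U = (\<chi> i j. v j $ i)"
  have U: "U \<in> unitary_group"
  proof (rule unitaryI)
    have "(adj U ** U) $ i $ j = herm (v j) (v i)" for i j
      by (simp add: matrix_mult_nth U_def herm_def mult.commute)
    then show "adj U ** U = mat 1" by (auto simp: vec_eq_iff mat_nth v)
  qed
  have "(Z ** cnj_mat U) $ i $ j = (U ** diag_mat (\<lambda>j. complex_of_real (\<sigma> j))) $ i $ j" for i j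
  proof -
    have "(Z ** cnj_mat U) $ i $ j = (Z *v cnj_vec (v j)) $ i"
      by (simp add: matrix_mult_nth matrix_vec_nth U_def)
    also have "\<dots> = \<sigma> j * v j $ i" by (simp add: v)
    also have "\<dots> = (U ** diag_mat (\<lambda>j. complex_of_real (\<sigma> j))) $ i $ j"
      unfolding matrix_mult_nth diag_mat_nth
      by (simp add: U_def if_distrib[of "\<lambda>c. _ * c"] cong: if_cong)
    finally show ?thesis .
  qed
  then have "Z ** cnj_mat U = U ** diag_mat (\<lambda>j. complex_of_real (\<sigma> j))" by (simp add: vec_eq_iff)
  then have "Z ** (cnj_mat U ** transpose U) = U ** diag_mat (\<lambda>j. complex_of_real (\<sigma> j)) ** transpose U"
    by (simp add: matrix_mul_assoc)
  moreover have "cnj_mat U ** transpose U = mat 1"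
    using unitaryD(2)[OF unitary_cnj[OF U]] by (simp add: transpose_adj)
  ultimately show thesis using that[OF U, of \<sigma>] v by simp
qed

section \<open>Symmetric unitary matrices as one orbit of the unitary group\<close>

lemma sym_unitary_iff: "s \<in> sym_unitary \<longleftrightarrow> s \<in> unitary_group \<and> transpose s = s"
  by (simp add: sym_unitary_def)

lemma sym_unitary_mat_1 [simp]: "mat 1 \<in> sym_unitary"
  by (simp add: sym_unitary_iff)

lemma sym_unitary_conj [simp]:
  assumes "u \<in> unitary_group" "s \<in> sym_unitary"
  shows "u ** s ** transpose u \<in> sym_unitary"
  using assms by (auto simp: sym_unitary_iff matrix_transpose_mul matrix_mul_assoc)

text \<open>For unitary \<open>s\<close> the diagonal Takagi factor is unitary with nonnegative
  entries, hence the identity.\<close>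

theorem sym_unitary_transitive:
  assumes "s \<in> sym_unitary"
  obtains u where "u \<in> unitary_group" "s = u ** transpose u"
proof -
  have s: "s \<in> unitary_group" "transpose s = s" using assms by (auto simp: sym_unitary_iff)
  obtain U \<sigma> where U: "U \<in> unitary_group" "\<forall>j. 0 \<le> \<sigma> j"
    "s = U ** diag_mat (\<lambda>j. complex_of_real (\<sigma> j)) ** transpose U"
    using takagi[OF s(2)] .
  let ?D = "diag_mat (\<lambda>j. complex_of_real (\<sigma> j))"
  have "adj U ** s ** cnj_mat U = (adj U ** U) ** ?D ** (transpose U ** cnj_mat U)"
    unfolding U(3) by (simp only: matrix_mul_assoc)
  moreover have "transpose U ** cnj_mat U = mat 1"
    using unitaryD(1)[OF unitary_cnj[OF U(1)]] by (simp add: transpose_adj)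
  ultimately have "adj U ** s ** cnj_mat U = ?D" by (simp add: unitaryD[OF U(1)])
  then have D: "?D \<in> unitary_group" using U(1) s(1) by (metis unitary_adj unitary_cnj unitary_mult)
  have "\<sigma> j = 1" for j
  proof -
    have "?D *v axis j 1 = complex_of_real (\<sigma> j) *s axis j 1"
      by (simp only: vec_eq_iff matrix_vec_axis vector_smult_component) (auto simp: diag_mat_nth axis_def)
    then have "norm (complex_of_real (\<sigma> j) *s axis j (1::complex)) = norm (axis j (1::complex) :: complex^'a)"
      using norm_unitary[OF D, of "axis j 1"] by simp
    moreover have "complex_of_real (\<sigma> j) *s axis j (1::complex) = \<sigma> j *\<^sub>R (axis j (1::complex) :: complex^'a)"
      by (simp add: vec_eq_iff scaleR_conv_of_real[where 'a=complex])
    moreover have "norm (axis j (1::complex) :: complex^'a) = 1"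
      using herm_self_eq_1 herm_axis by (metis axis_nth)
    ultimately show ?thesis using U(2) by simp
  qed
  then have "?D = mat 1" by (simp add: vec_eq_iff diag_mat_nth mat_nth)
  then show thesis using that[OF U(1)] U(3) by simp
qed

subsection \<open>Fourier coefficients on the unit circle\<close>

definition circle_mean :: "(complex \<Rightarrow> complex) \<Rightarrow> complex" where
  "circle_mean h = integral {0..1} (\<lambda>x. h (cis (2 * pi * x)))"

definition fourier_coeff :: "(complex \<Rightarrow> complex) \<Rightarrow> int \<Rightarrow> complex" where
  "fourier_coeff g k = circle_mean (\<lambda>z. g z * z powi (- k))"

lemma continuous_on_cis_comp:
  assumes "continuous_on (sphere 0 1) h"
  shows "continuous_on S (\<lambda>x. h (cis (2 * pi * x)))"
  by (rule continuous_on_compose2[OF assms]) (auto intro!: continuous_intros)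

lemma cis_comp_integrable:
  "continuous_on (sphere 0 1) h \<Longrightarrow> (\<lambda>x. h (cis (2 * pi * x)) :: complex) integrable_on {a..b}"
  by (intro integrable_continuous_interval continuous_on_cis_comp)

lemma circle_mean_add:
  assumes "continuous_on (sphere 0 1) f" "continuous_on (sphere 0 1) g"
  shows "circle_mean (\<lambda>z. f z + g z) = circle_mean f + circle_mean g"
  unfolding circle_mean_def by (intro integral_add cis_comp_integrable assms)

lemma circle_mean_diff:
  assumes "continuous_on (sphere 0 1) f" "continuous_on (sphere 0 1) g"
  shows "circle_mean (\<lambda>z. f z - g z) = circle_mean f - circle_mean g"
  unfolding circle_mean_def by (intro integral_diff cis_comp_integrable assms)

lemma circle_mean_mult: "circle_mean (\<lambda>z. c * f z) = c * circle_mean f"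
  unfolding circle_mean_def by (rule integral_mult_right)

lemma circle_mean_cong:
  "(\<And>z. norm z = 1 \<Longrightarrow> f z = g z) \<Longrightarrow> circle_mean f = circle_mean g"
  unfolding circle_mean_def by simp

lemma circle_mean_const [simp]: "circle_mean (\<lambda>z. c) = c"
  by (simp add: circle_mean_def)

text \<open>A rotation shifts the angle by a fraction \<open>a\<close> of the period; the
  overhanging piece is moved back by periodicity.\<close>

lemma circle_mean_rotate:
  assumes cont: "continuous_on (sphere 0 1) h" and c: "norm c = 1"
  shows "circle_mean (\<lambda>z. h (c * z)) = circle_mean h"
proof -
  define a where "a = Arg2pi c / (2 * pi)"
  have a: "0 \<le> a" "a \<le> 1" "cis (2 * pi * a) = c"
    using Arg2pi[of c] c by (auto simp: a_def is_Arg_def cis_conv_exp)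
  define k where "k x = h (cis (2 * pi * x))" for x
  have kper: "k (1 + x) = k x" for x
    by (simp add: k_def distrib_left cis_mult[symmetric])
  have int: "k integrable_on {x..y}" for x y
    unfolding k_def by (intro cis_comp_integrable cont)
  have "circle_mean (\<lambda>z. h (c * z)) = integral {0..1} (k \<circ> (+) a)"
    unfolding circle_mean_def a(3)[symmetric] by (simp add: k_def cis_mult o_def distrib_left)
  also have "\<dots> = integral {0 + a..1 + a} k" by (rule integral_shift_Icc_real)
  also have "\<dots> = integral {a..1} k + integral {1..1 + a} k"
    using Henstock_Kurzweil_Integration.integral_combine[of a 1 "1 + a" k] a int by simp
  also have "integral {1..1 + a} k = integral {0..a} (k \<circ> (+) 1)"
    using integral_shift_Icc_real[of 0 a k 1] by (simp add: add.commute)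
  also have "k \<circ> (+) 1 = k" by (simp add: fun_eq_iff kper)
  also have "integral {a..1} k + integral {0..a} k = integral {0..1} k"
    using Henstock_Kurzweil_Integration.integral_combine[of 0 a 1 k] a int by (simp add: add.commute)
  finally show ?thesis unfolding circle_mean_def k_def .
qed

lemma continuous_on_powi_circle [continuous_intros]:
  "continuous_on (sphere 0 1) (\<lambda>z :: complex. z powi k)"
  by (intro continuous_intros) auto

lemma fourier_coeff_rotate:
  assumes cont: "continuous_on (sphere 0 1) g" and c: "norm c = 1"
  shows "fourier_coeff (\<lambda>z. g (c * z)) k = c powi k * fourier_coeff g k"
proof -
  have c0: "c \<noteq> 0" using c by auto
  have "circle_mean (\<lambda>z. g (c * z) * z powi (- k)) =
      circle_mean (\<lambda>z. c powi k * (g (c * z) * (c * z) powi (- k)))"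
    using c0 by (intro circle_mean_cong) (simp add: power_int_mult_distrib power_int_minus field_simps)
  also have "\<dots> = c powi k * circle_mean (\<lambda>z. g z * z powi (- k))"
    unfolding circle_mean_mult
    by (subst circle_mean_rotate[of "\<lambda>z. g z * z powi (- k)"]) (auto intro!: continuous_intros cont c)
  finally show ?thesis by (simp add: fourier_coeff_def)
qed

lemma fourier_coeff_add:
  assumes "continuous_on (sphere 0 1) f" "continuous_on (sphere 0 1) g"
  shows "fourier_coeff (\<lambda>z. f z + g z) k = fourier_coeff f k + fourier_coeff g k"
  unfolding fourier_coeff_def ring_distribs
  by (intro circle_mean_add continuous_intros assms)

lemma fourier_coeff_mult: "fourier_coeff (\<lambda>z. c * f z) k = c * fourier_coeff f k"
  unfolding fourier_coeff_def mult.assoc circle_mean_mult ..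

lemma fourier_coeff_cong:
  "(\<And>z. norm z = 1 \<Longrightarrow> f z = g z) \<Longrightarrow> fourier_coeff f k = fourier_coeff g k"
  unfolding fourier_coeff_def by (rule circle_mean_cong) simp

lemma fourier_coeff_0 [simp]: "fourier_coeff (\<lambda>z. 0) k = 0"
  by (simp add: fourier_coeff_def)

lemma fourier_coeff_sum:
  assumes "finite P" "\<And>p. p \<in> P \<Longrightarrow> continuous_on (sphere 0 1) (f p)"
  shows "fourier_coeff (\<lambda>z. \<Sum>p\<in>P. f p z) k = (\<Sum>p\<in>P. fourier_coeff (f p) k)"
  using assms
  by (induction P) (simp_all add: fourier_coeff_add continuous_on_sum)

lemma fourier_coeff_powi: "fourier_coeff (\<lambda>z. z powi l) k = (if k = l then 1 else 0)"
proof (cases "k = l")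
  case True
  have "fourier_coeff (\<lambda>z. z powi l) k = circle_mean (\<lambda>z. 1)"
    unfolding fourier_coeff_def True
    by (rule circle_mean_cong) (auto simp: power_int_minus field_simps)
  then show ?thesis using True by simp
next
  case False
  \<comment> \<open>Chosen so that \<open>c powi (k - l) = -1\<close>. Rotating by \<open>c\<close>
    multiplies the coefficient both by \<open>c powi l\<close> and by \<open>c powi k\<close>, so it
    vanishes.\<close>
  define c where "c = cis (pi / (k - l))"
  have c: "norm c = 1" "c \<noteq> 0" by (simp_all add: c_def)
  have "c powi l * fourier_coeff (\<lambda>z. z powi l) k = fourier_coeff (\<lambda>z. (c * z) powi l) k"
    unfolding power_int_mult_distrib fourier_coeff_mult ..
  also have "\<dots> = c powi k * fourier_coeff (\<lambda>z. z powi l) k"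
    by (rule fourier_coeff_rotate) (auto intro: continuous_intros c)
  finally have "(c powi l - c powi k) * fourier_coeff (\<lambda>z. z powi l) k = 0"
    by (simp add: algebra_simps)
  moreover have "c powi k = c powi l * c powi (k - l)"
    using c by (simp add: power_int_diff)
  moreover have "c powi (k - l) = -1"
  proof -
    have "c powi (k - l) = cis (real_of_int (k - l) * (pi / real_of_int (k - l)))"
      unfolding c_def by (rule cis_power_int)
    also have "real_of_int (k - l) * (pi / real_of_int (k - l)) = pi" using False by simp
    finally show ?thesis by (simp only: cis_pi)
  qed
  ultimately show ?thesis using False c by simp
qed

text \<open>
  The functions whose product with a function with vanishing Fourier coefficients again has
  vanishing Fourier coefficients form an algebra that contains the polynomials in \<open>z\<close> and its
  conjugate; by Stone and Weierstrass it is dense.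
\<close>

theorem fourier_coeff_unique:
  assumes cont: "continuous_on (sphere 0 1) g" and zero: "\<And>k. fourier_coeff g k = 0"
    and z: "norm z = 1"
  shows "g z = 0"
proof -
  define N where "N g \<longleftrightarrow> continuous_on (sphere 0 1) g \<and> (\<forall>k. fourier_coeff g k = 0)" for g
  define Good where "Good h \<longleftrightarrow> continuous_on (sphere 0 1) h \<and> (\<forall>g. N g \<longrightarrow> N (\<lambda>z. g z * h z))" for h
  have Gadd: "Good (\<lambda>z. f z + h z)" if "Good f" "Good h" for f h
  proof -
    have "N (\<lambda>z. g z * (f z + h z))" if "N g" for g
    proof -
      have "N (\<lambda>z. g z * f z)" "N (\<lambda>z. g z * h z)" using \<open>Good f\<close> \<open>Good h\<close> that by (auto simp: Good_def)
      then show ?thesis unfolding N_def distrib_left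
        by (auto intro: continuous_intros simp: fourier_coeff_add)
    qed
    then show ?thesis using that by (auto simp: Good_def intro: continuous_intros)
  qed
  have Gmult: "Good (\<lambda>z. f z * h z)" if "Good f" "Good h" for f h
  proof -
    have "N (\<lambda>z. g z * (f z * h z))" if "N g" for g
    proof -
      have "N (\<lambda>z. g z * f z)" using \<open>Good f\<close> that by (auto simp: Good_def)
      then have "N (\<lambda>z. (g z * f z) * h z)" using \<open>Good h\<close> by (simp add: Good_def)
      then show ?thesis by (simp add: mult.assoc)
    qed
    then show ?thesis using that by (auto simp: Good_def intro: continuous_intros)
  qed
  have Gconst: "Good (\<lambda>z. c)" for c
  proof -
    have "fourier_coeff (\<lambda>z. g z * c) k = c * fourier_coeff g k" for g k
      using fourier_coeff_mult[of c g k] by (simp add: mult.commute)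
    then show ?thesis by (auto simp: Good_def N_def intro: continuous_intros)
  qed
  have Gcong: "Good h" if "Good f" "\<And>z. norm z = 1 \<Longrightarrow> f z = h z" for f h
  proof -
    have c: "continuous_on (sphere 0 1) h"
      using that(1) continuous_on_cong[of "sphere 0 1" "sphere 0 1" f h] that(2) by (auto simp: Good_def)
    have "N (\<lambda>z. g z * h z)" if "N g" for g
    proof -
      have "N (\<lambda>z. g z * f z)" using \<open>Good f\<close> that by (auto simp: Good_def)
      moreover have "fourier_coeff (\<lambda>z. g z * f z) k = fourier_coeff (\<lambda>z. g z * h z) k" for k
        by (rule fourier_coeff_cong) (simp add: \<open>\<And>z. norm z = 1 \<Longrightarrow> f z = h z\<close>)
      ultimately show ?thesis using c that by (auto simp: N_def intro: continuous_intros)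
    qed
    then show ?thesis using c by (simp add: Good_def)
  qed
  have Gpow: "Good (\<lambda>z. z powi m)" for m
  proof -
    \<comment> \<open>Multiplication by a power of \<open>z\<close> only shifts the index of the
      coefficients.\<close>
    have "fourier_coeff (\<lambda>z. g z * z powi m) k = fourier_coeff g (k - m)" for g k
    proof -
      have "z powi m * z powi (- k) = z powi (- (k - m))" if "norm z = 1" for z :: complex
      proof -
        have "z \<noteq> 0" using that by auto
        then show ?thesis by (simp add: power_int_add[symmetric])
      qed
      then show ?thesis unfolding fourier_coeff_def by (intro circle_mean_cong) (simp add: mult.assoc)
    qed
    then show ?thesis by (auto simp: Good_def N_def intro: continuous_intros)
  qed
  have inv: "z powi (-1) = cnj z" if "norm z = 1" for z
    using that by (simp add: power_int_minus inverse_complex_def complex_eq_iff cmod_power2[symmetric])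
  have GRe: "Good (\<lambda>z. complex_of_real (Re z))"
  proof (rule Gcong)
    show "Good (\<lambda>z. (1 / 2) * (z powi 1 + z powi (-1)))" by (intro Gmult Gadd Gconst Gpow)
  qed (subst inv, simp_all add: complex_eq_iff)
  have GIm: "Good (\<lambda>z. complex_of_real (Im z))"
  proof (rule Gcong)
    show "Good (\<lambda>z. (- \<i> / 2) * (z powi 1 + (-1) * z powi (-1)))" by (intro Gmult Gadd Gconst Gpow)
  qed (subst inv, simp_all add: complex_eq_iff)
  have Greal: "Good (\<lambda>z. complex_of_real (p z))" if "real_polynomial_function p" for p :: "complex \<Rightarrow> real"
    using that
  proof induction
    case (linear f)
    interpret bounded_linear f by fact
    have "f z = Re z * f 1 + Im z * f \<i>" for z
    proof -
      have "z = Re z *\<^sub>R 1 + Im z *\<^sub>R \<i>" by (simp add: complex_eq_iff)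
      then have "f z = f (Re z *\<^sub>R 1 + Im z *\<^sub>R \<i>)" by simp
      then show ?thesis by (simp only: add scaleR real_scaleR_def)
    qed
    then have "(\<lambda>z. complex_of_real (f z)) =
        (\<lambda>z. complex_of_real (Re z) * complex_of_real (f 1) + complex_of_real (Im z) * complex_of_real (f \<i>))"
      by (metis of_real_add of_real_mult)
    then show ?case by (simp only:) (intro Gadd Gmult GRe GIm Gconst)
  qed (auto intro: Gadd Gmult Gconst)
  have Gpoly: "Good q" if "polynomial_function q" for q
  proof -
    have "real_polynomial_function (Re \<circ> q)" "real_polynomial_function (Im \<circ> q)"
      using that bounded_linear_Re bounded_linear_Im unfolding polynomial_function_def by auto
    then have "Good (\<lambda>z. complex_of_real (Re (q z)) + \<i> * complex_of_real (Im (q z)))"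
      by (intro Gadd Gmult Gconst) (auto dest: Greal simp: o_def)
    then show ?thesis by (simp add: complex_eq[symmetric])
  qed
  have Ng: "N g" using cont zero by (simp add: N_def)
  have "bounded (g ` sphere 0 1)"
    using cont by (intro compact_imp_bounded compact_continuous_image) auto
  then obtain M where M: "M > 0" "\<And>z. norm z = 1 \<Longrightarrow> norm (g z) \<le> M"
    by (auto simp: bounded_pos)
  \<comment> \<open>For a good \<open>q\<close> the mean of \<open>g z * q z\<close> is
    \<open>0\<close>, so \<open>cnj (g z)\<close> may be replaced by the small difference
    \<open>cnj (g z) - q z\<close> in the mean of the squared modulus of \<open>g\<close>.\<close>
  have small: "norm (circle_mean (\<lambda>z. g z * cnj (g z))) \<le> e" if "e > 0" for e
  proof -
    have "continuous_on (sphere 0 1) (\<lambda>z. cnj (g z))" by (intro continuous_intros cont)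
    then obtain q where q: "polynomial_function q" "\<And>z. norm z = 1 \<Longrightarrow> norm (cnj (g z) - q z) < e / M"
      using Stone_Weierstrass_polynomial_function[of "sphere 0 1" "\<lambda>z. cnj (g z)" "e / M"] \<open>e > 0\<close> M(1)
          by auto
    have Gq: "Good q" by (rule Gpoly) fact
    have cq: "continuous_on (sphere 0 1) q" using Gq by (simp add: Good_def)
    have "fourier_coeff (\<lambda>z. g z * q z) 0 = 0" using Gq Ng by (simp add: Good_def N_def)
    then have "circle_mean (\<lambda>z. g z * q z) = 0" by (simp add: fourier_coeff_def)
    then have "circle_mean (\<lambda>z. g z * cnj (g z)) = circle_mean (\<lambda>z. g z * cnj (g z) - g z * q z)"
      by (subst circle_mean_diff) (auto intro!: continuous_intros cont cq)
    also have "norm \<dots> \<le> e * (1 - 0)"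
      unfolding circle_mean_def
    proof (rule integral_bound)
      show "continuous_on {0..1} (\<lambda>x. g (cis (2 * pi * x)) * cnj (g (cis (2 * pi * x))) -
          g (cis (2 * pi * x)) * q (cis (2 * pi * x)))"
        by (intro continuous_intros continuous_on_cis_comp cont cq)
      fix x :: real assume "x \<in> {0..1}"
      have "norm (g (cis (2 * pi * x)) * (cnj (g (cis (2 * pi * x))) - q (cis (2 * pi * x)))) \<le> M * (e / M)"
        unfolding norm_mult using M q(2)[of "cis (2 * pi * x)"] \<open>e > 0\<close>
        by (intro mult_mono) (auto intro: less_imp_le)
      then show "norm (g (cis (2 * pi * x)) * cnj (g (cis (2 * pi * x))) -
          g (cis (2 * pi * x)) * q (cis (2 * pi * x))) \<le> e"
        using M(1) by (simp add: algebra_simps)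
    qed simp
    finally show ?thesis by simp
  qed
  have "norm (circle_mean (\<lambda>z. g z * cnj (g z))) \<le> 0"
    using small field_le_epsilon[of "norm (circle_mean (\<lambda>z. g z * cnj (g z)))" 0] by simp
  then have "circle_mean (\<lambda>z. g z * cnj (g z)) = 0" by simp
  then have z0: "integral {0..1} (\<lambda>x. complex_of_real ((norm (g (cis (2 * pi * x))))\<^sup>2)) = 0"
    by (simp only: circle_mean_def complex_norm_square)
  have cn: "continuous_on {0..1} (\<lambda>x. (norm (g (cis (2 * pi * x))))\<^sup>2)"
    by (intro continuous_intros continuous_on_cis_comp cont)
  have "((\<lambda>x. complex_of_real ((norm (g (cis (2 * pi * x))))\<^sup>2)) has_integral
      complex_of_real (integral {0..1} (\<lambda>x. (norm (g (cis (2 * pi * x))))\<^sup>2))) {0..1}"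
    by (intro has_integral_of_real integrable_integral integrable_continuous_interval cn)
  from integral_unique[OF this] have i0: "integral {0..1} (\<lambda>x. (norm (g (cis (2 * pi * x))))\<^sup>2) = 0"
    unfolding z0 by simp
  have "\<forall>x\<in>{0..1}. (norm (g (cis (2 * pi * x))))\<^sup>2 = 0"
    using integral_eq_0_iff[OF cn] i0 by simp
  moreover have "Arg2pi z / (2 * pi) \<in> {0..1}" using Arg2pi[of z] by auto
  moreover have "cis (2 * pi * (Arg2pi z / (2 * pi))) = z"
    using Arg2pi[of z] z by (simp add: is_Arg_def cis_conv_exp)
  ultimately show ?thesis by fastforce
qed

subsection \<open>Finite-dimensional spaces of functions\<close>

lemma sum_fun_apply: "(\<Sum>i\<in>A. f i) x = (\<Sum>i\<in>A. f i x :: complex)"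
  by (induction A rule: infinite_finite_induct) auto

lemma cscale_apply: "cscale c f x = c * f x"
  by (simp add: cscale_def)

text \<open>Finitely many evaluations determine the members of a finite-dimensional space, and do so
  linearly. Pointwise constructions such as Fourier integrals along an orbit thereby become finite
  sums with scalar coefficients, which stay in the space.\<close>

lemma span_reproducing:
  assumes "finite B"
  shows "\<exists>P b. finite P \<and> (\<forall>p\<in>P. b p \<in> cfun.span B) \<and>
    (\<forall>f\<in>cfun.span B. \<forall>s. f s = (\<Sum>p\<in>P. f p * b p s))"
  using assms
proof (induction B)
  case empty
  have "f = 0" if "f \<in> cfun.span {}" for f
    using that by (simp only: cfun.span_empty singleton_iff)
  then show ?case by (intro exI[of _ "{}"]) auto
next
  case (insert c B)
  then obtain P b where P: "finite P" "\<forall>p\<in>P. b p \<in> cfun.span B"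
    and rep: "\<forall>f\<in>cfun.span B. \<forall>s. f s = (\<Sum>p\<in>P. f p * b p s)" by blast
  have sub: "cfun.span B \<subseteq> cfun.span (insert c B)" by (intro cfun.span_mono) auto
  \<comment> \<open>The error of the old interpolation formula at the new generator; by
    \<open>key\<close> every other error is a multiple of it.\<close>
  define h where "h = c - (\<Sum>p\<in>P. cscale (c p) (b p))"
  have h_apply: "h s = c s - (\<Sum>p\<in>P. c p * b p s)" for s
    by (simp add: h_def sum_fun_apply cscale_apply)
  have hin: "h \<in> cfun.span (insert c B)"
    unfolding h_def
  proof (intro cfun.span_diff cfun.span_sum cfun.span_scale)
    show "c \<in> cfun.span (insert c B)" by (intro cfun.span_base) simp
    show "b p \<in> cfun.span (insert c B)" if "p \<in> P" for p using that P sub by blast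
  qed
  have key: "\<exists>k. \<forall>s. f s - (\<Sum>p\<in>P. f p * b p s) = k * h s" if fin: "f \<in> cfun.span (insert c B)" for f
  proof -
    obtain k where "f - cscale k c \<in> cfun.span B" using fin cfun.span_breakdown_eq[of f c B] by blast
    then have "\<forall>s. (f - cscale k c) s = (\<Sum>p\<in>P. (f - cscale k c) p * b p s)" using rep by blast
    then have *: "f s - k * c s = (\<Sum>p\<in>P. f p * b p s) - k * (\<Sum>p\<in>P. c p * b p s)" for s
      by (simp add: cscale_apply left_diff_distrib sum_subtractf sum_distrib_left mult.assoc)
    have rearrange: "x - z = y - w" if "x - y = z - w" for x y z w :: complex
      using that by algebra
    have "f s - (\<Sum>p\<in>P. f p * b p s) = k * h s" for s
      unfolding h_apply right_diff_distrib by (rule rearrange[OF *])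
    then show ?thesis by blast
  qed
  show ?case
  proof (cases "h = 0")
    case True
    have "f s = (\<Sum>p\<in>P. f p * b p s)" if fin: "f \<in> cfun.span (insert c B)" for f s
    proof -
      obtain k where "f s - (\<Sum>p\<in>P. f p * b p s) = k * h s" using key[OF fin] by blast
      then show ?thesis using True by simp
    qed
    then show ?thesis using P sub by blast
  next
    case False
    then obtain q where q: "h q \<noteq> 0" by (auto simp: fun_eq_iff)
    \<comment> \<open>The value at \<open>q\<close> recovers the multiple of \<open>h\<close>. As
      \<open>b0\<close> vanishes off \<open>P\<close>, the formulas cover a point \<open>q\<close>
      inside or outside \<open>P\<close>.\<close>
    define b0 where "b0 p = (if p \<in> P then b p - cscale (b p q / h q) h else 0)" for p
    define b' where "b' p = b0 p + (if p = q then cscale (1 / h q) h else 0)" for p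
    have "f s = (\<Sum>p\<in>insert q P. f p * b' p s)" if f: "f \<in> cfun.span (insert c B)" for f s
    proof -
      obtain k where k: "\<And>s. f s - (\<Sum>p\<in>P. f p * b p s) = k * h s" using key[OF f] by blast
      have kq: "k = (f q - (\<Sum>p\<in>P. f p * b p q)) / h q" using k[of q] q by simp
      have "(\<Sum>p\<in>insert q P. f p * b' p s) =
          (\<Sum>p\<in>insert q P. f p * b0 p s) + (\<Sum>p\<in>insert q P. if p = q then f p * h s / h q else 0)"
        by (simp add: cscale_apply b'_def distrib_left sum.distrib[symmetric] if_distrib[of "\<lambda>g. g s"]
            if_distrib[of "\<lambda>g. _ * g"] cong: if_cong)
      also have "(\<Sum>p\<in>insert q P. if p = q then f p * h s / h q else 0) = f q * h s / h q"
        using P(1) by simp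
      also have "(\<Sum>p\<in>insert q P. f p * b0 p s) = (\<Sum>p\<in>P. f p * b0 p s)"
        using P(1) by (intro sum.mono_neutral_right) (auto simp: b0_def)
      also have "\<dots> = (\<Sum>p\<in>P. f p * b p s - f p * b p q * (h s / h q))"
        by (intro sum.cong) (auto simp: b0_def cscale_apply algebra_simps)
      also have "\<dots> = (\<Sum>p\<in>P. f p * b p s) - (\<Sum>p\<in>P. f p * b p q) * (h s / h q)"
        by (simp only: sum_subtractf sum_distrib_right)
      finally have "(\<Sum>p\<in>insert q P. f p * b' p s) = (\<Sum>p\<in>P. f p * b p s) + k * h s"
        unfolding kq by (simp add: diff_divide_distrib left_diff_distrib)
      then show ?thesis using k[of s] by (metis add.commute diff_eq_eq)
    qed
    moreover have "b' p \<in> cfun.span (insert c B)" for p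
      unfolding b'_def b0_def using P sub hin
      by (auto intro!: cfun.span_add cfun.span_diff cfun.span_scale cfun.span_zero)
    ultimately show ?thesis using P(1) by (intro exI[of _ "insert q P"] exI[of _ b']) auto
  qed
qed

subsection \<open>Weight decompositions\<close>

definition torus_elt :: "('m \<Rightarrow> complex) \<Rightarrow> bool" where
  "torus_elt t \<longleftrightarrow> (\<forall>i. norm (t i) = 1)"

lemma diag_mat_mult: "diag_mat (t :: 'm::finite \<Rightarrow> complex) ** diag_mat u = diag_mat (\<lambda>i. t i * u i)"
  by (auto simp: vec_eq_iff matrix_mult_nth diag_mat_nth if_distrib[of "\<lambda>c. c * _"] cong: if_cong)

lemma diag_mat_1: "diag_mat (\<lambda>i. 1) = mat 1"
  by (simp add: vec_eq_iff diag_mat_nth mat_nth)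

lemma adj_diag_mat: "adj (diag_mat t) = diag_mat (\<lambda>i. cnj (t i))"
  by (auto simp: vec_eq_iff diag_mat_nth)

lemma transpose_diag_mat: "transpose (diag_mat t) = diag_mat t"
  by (auto simp: vec_eq_iff diag_mat_nth transpose_nth)

lemma cnj_mult_norm_1: "norm z = 1 \<Longrightarrow> cnj z * z = 1" "norm z = 1 \<Longrightarrow> z * cnj z = 1"
  by (metis complex_norm_square mult.commute of_real_1 power_one)+

lemma diag_mat_unitary [simp]: "torus_elt t \<Longrightarrow> diag_mat t \<in> unitary_group"
  by (intro unitaryI) (simp add: adj_diag_mat diag_mat_mult torus_elt_def cnj_mult_norm_1 diag_mat_1)

lemma diag_mat_conj_nth:
  "(diag_mat (t :: 'm::finite \<Rightarrow> complex) ** s ** diag_mat u) $ i $ j = t i * s $ i $ j * u j"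
proof -
  have "(diag_mat t ** s) $ i $ k = t i * s $ i $ k" for k
    by (simp add: matrix_mult_nth diag_mat_nth if_distrib[of "\<lambda>c. c * _"] cong: if_cong)
  then show ?thesis
    unfolding matrix_mult_nth[of _ "diag_mat u"] diag_mat_nth
    by (simp add: if_distrib[of "\<lambda>c. _ * c"] cong: if_cong)
qed

lemma act_apply: "g \<in> unitary_group \<Longrightarrow> act g f s = f (adj g ** s ** cnj_mat g)"
  by (simp add: act_def matrix_inv_unitary transpose_adj)

lemma act_mult:
  assumes "g \<in> unitary_group" "h \<in> unitary_group"
  shows "act g (act h f) = act (g ** h) f"
  using assms by (simp add: fun_eq_iff act_apply adj_mult cnj_mat_mult matrix_mul_assoc)

lemma act_1 [simp]: "act (mat 1) f = f"
  by (simp add: fun_eq_iff act_apply)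

lemma act_linear: "act g (f + h) = act g f + act g h" "act g (f - h) = act g f - act g h"
  "act g (cscale c f) = cscale c (act g f)" "act g 0 = 0"
  by (simp_all add: act_def fun_eq_iff cscale_apply)

lemma act_sum: "act g (\<Sum>i\<in>A. f i) = (\<Sum>i\<in>A. act g (f i))"
  by (simp add: act_def fun_eq_iff sum_fun_apply)

lemma sym_unitary_act:
  assumes "g \<in> unitary_group"
  shows "adj g ** s ** cnj_mat g \<in> sym_unitary \<longleftrightarrow> s \<in> sym_unitary"
proof -
  have 1: "adj h ** s ** cnj_mat h \<in> sym_unitary" if "s \<in> sym_unitary" "h \<in> unitary_group"
    for s and h :: "complex^'m^'m"
    using sym_unitary_conj[of "adj h" s] that by (simp add: transpose_adj)
  have "transpose g ** cnj_mat g = mat 1"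
    using unitaryD(1)[OF unitary_cnj[OF assms]] by (simp add: transpose_adj)
  then have "cnj_mat g ** transpose g = mat 1" using matrix_left_right_inverse by blast
  moreover have "g ** (adj g ** s ** cnj_mat g) ** transpose g = (g ** adj g) ** s ** (cnj_mat g **
      transpose g)"
    by (simp only: matrix_mul_assoc)
  ultimately have "adj (adj g) ** (adj g ** s ** cnj_mat g) ** cnj_mat (adj g) = s"
    by (simp add: unitaryD[OF assms] transpose_adj)
  then show ?thesis using 1 assms by (metis unitary_adj)
qed

lemma cont_fun_subspace: "cfun.subspace (cont_fun :: (complex^'m^'m \<Rightarrow> complex) set)"
  unfolding cfun.subspace_def cont_fun_def by (auto simp: cscale_apply zero_fun_def plus_fun_def
      cscale_def intro!: continuous_intros)

lemma continuous_on_act: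
  assumes f: "f \<in> cont_fun" and u: "\<And>z. z \<in> Z \<Longrightarrow> u z \<in> unitary_group" and s: "s \<in> sym_unitary"
    and c: "\<And>i j. continuous_on Z (\<lambda>z. u z $ i $ j)"
  shows "continuous_on Z (\<lambda>z. act (u z) f s)"
proof -
  have "continuous_on Z (\<lambda>z. f (adj (u z) ** s ** cnj_mat (u z)))"
  proof (rule continuous_on_compose2[of sym_unitary f])
    show "continuous_on sym_unitary f" using f by (simp add: cont_fun_def)
    have "continuous_on Z (\<lambda>z. \<chi> i j. (adj (u z) ** s ** cnj_mat (u z)) $ i $ j)"
      unfolding matrix_mult_nth adj_nth cnj_mat_nth by (intro continuous_intros c)
    then show "continuous_on Z (\<lambda>z. adj (u z) ** s ** cnj_mat (u z))" by simp
    show "(\<lambda>z. adj (u z) ** s ** cnj_mat (u z)) ` Z \<subseteq> sym_unitary"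
      using s u by (auto simp: sym_unitary_act)
  qed
  then show ?thesis by (rule continuous_on_eq) (simp add: act_apply u)
qed

section \<open>Coordinate circles and projections to their weight spaces\<close>

definition circ :: "'m \<Rightarrow> complex \<Rightarrow> complex^'m^'m" where
  "circ j z = diag_mat (\<lambda>i. if i = j then z else 1)"

lemma circ_unitary [simp]: "norm z = 1 \<Longrightarrow> circ j z \<in> unitary_group"
  unfolding circ_def by (rule diag_mat_unitary) (simp add: torus_elt_def)

lemma circ_mult: "circ j z ** circ j w = circ j (z * w)"
  unfolding circ_def diag_mat_mult by (rule arg_cong[of _ _ diag_mat]) auto

lemma circ_1 [simp]: "circ j 1 = mat 1"
  by (simp add: circ_def diag_mat_1)

lemma continuous_on_circ: 
  assumes "f \<in> cont_fun" shows "continuous_on (sphere 0 1) (\<lambda>z. act (circ j z) f s)"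
proof (cases "s \<in> sym_unitary")
  case True
  show ?thesis
  proof (rule continuous_on_act[OF assms _ True])
    show "continuous_on (sphere 0 1) (\<lambda>z. circ j z $ a $ b)" for a b
      unfolding circ_def diag_mat_nth by (cases "a = b"; cases "a = j") (auto intro: continuous_intros)
  qed simp
next
  case False
  then have "act (circ j z) f s = 0" if "norm z = 1" for z
    using assms that by (simp add: act_apply sym_unitary_act cont_fun_def)
  then show ?thesis by (subst continuous_on_cong[OF refl, of _ _ "\<lambda>z. 0"]) auto
qed

text \<open>The projection to weight \<open>k\<close> of the circle at \<open>j\<close>, as an
  average over the orbit of \<open>f\<close>.\<close>

definition wproj :: "'m \<Rightarrow> int \<Rightarrow> (complex^'m^'m \<Rightarrow> complex) \<Rightarrow> complex^'m^'m \<Rightarrow> complex" where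
  "wproj j k f = (\<lambda>s. fourier_coeff (\<lambda>z. act (circ j z) f s) k)"

lemma wproj_add:
  assumes "f \<in> cont_fun" "g \<in> cont_fun"
  shows "wproj j k (f + g) = wproj j k f + wproj j k g"
  using assms by (simp add: wproj_def fun_eq_iff act_linear fourier_coeff_add continuous_on_circ)

lemma wproj_scale: "wproj j k (cscale c f) = cscale c (wproj j k f)"
  by (simp add: wproj_def fun_eq_iff act_linear cscale_apply fourier_coeff_mult)

lemma wproj_0 [simp]: "wproj j k 0 = 0"
  by (simp add: wproj_def fun_eq_iff act_linear)

lemma wproj_diff:
  assumes "f \<in> cont_fun" "g \<in> cont_fun"
  shows "wproj j k (f - g :: complex^'m^'m \<Rightarrow> complex) = wproj j k f - wproj j k g"
proof -
  have "cscale (-1) g \<in> cont_fun" using assms cont_fun_subspace cfun.subspace_scale by blast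
  moreover have diff: "f - g = f + cscale (-1) g" for f g :: "complex^'m^'m \<Rightarrow> complex"
    by (simp add: fun_eq_iff cscale_apply)
  ultimately show ?thesis
    unfolding diff using assms by (simp only: wproj_add wproj_scale)
qed

lemma wproj_sum:
  assumes "finite A" "\<And>i. i \<in> A \<Longrightarrow> f i \<in> cont_fun"
  shows "wproj j k (\<Sum>i\<in>A. f i) = (\<Sum>i\<in>A. wproj j k (f i))"
  using assms
proof (induction A)
  case (insert a A)
  then have "(\<Sum>i\<in>A. f i) \<in> cont_fun" by (intro cfun.subspace_sum[OF cont_fun_subspace]) auto
  then show ?case using insert by (simp add: wproj_add del: plus_fun_apply)
qed simp

lemma wproj_act:
  assumes g: "g \<in> unitary_group" and comm: "\<And>z. norm z = 1 \<Longrightarrow> g ** circ j z = circ j z ** g"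
  shows "act g (wproj j k f) = wproj j k (act g f)"
proof
  fix s
  have "act (circ j z) f (adj g ** s ** cnj_mat g) = act (circ j z) (act g f) s" if "norm z = 1" for z
  proof -
    have "act (circ j z) f (adj g ** s ** cnj_mat g) = act g (act (circ j z) f) s"
      using g by (simp add: act_apply[of g])
    then show ?thesis using that g comm by (simp add: act_mult)
  qed
  then show "act g (wproj j k f) s = wproj j k (act g f) s"
    using g by (simp add: act_apply[of g] wproj_def cong: fourier_coeff_cong)
qed

lemma wproj_weight:
  assumes "f \<in> cont_fun" "norm c = 1"
  shows "act (circ j c) (wproj j k f) = cscale (c powi k) (wproj j k f)"
proof -
  have "act (circ j c) (wproj j k f) = wproj j k (act (circ j c) f)"
    using assms by (intro wproj_act) (simp_all add: circ_mult mult.commute)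
  also have "\<dots> = cscale (c powi k) (wproj j k f)"
  proof
    fix s
    have "wproj j k (act (circ j c) f) s = fourier_coeff (\<lambda>z. act (circ j (c * z)) f s) k"
      unfolding wproj_def using assms
      by (intro fourier_coeff_cong) (simp add: act_mult circ_mult mult.commute)
    also have "\<dots> = c powi k * wproj j k f s"
      unfolding wproj_def
      using fourier_coeff_rotate[OF continuous_on_circ[OF assms(1), of j s] assms(2), of k] by simp
    finally show "wproj j k (act (circ j c) f) s = cscale (c powi k) (wproj j k f) s" by (simp add:
        cscale_apply)
  qed
  finally show ?thesis .
qed

lemma wproj_of_weight:
  assumes "\<And>c. norm c = 1 \<Longrightarrow> act (circ j c) f = cscale (c powi l) f"
  shows "wproj j k f = (if k = l then f else 0)"
proof
  fix s
  have "wproj j k f s = fourier_coeff (\<lambda>z. f s * z powi l) k"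
    unfolding wproj_def by (intro fourier_coeff_cong) (simp add: assms cscale_apply mult.commute)
  also have "\<dots> = f s * (if k = l then 1 else 0)"
    unfolding fourier_coeff_mult fourier_coeff_powi ..
  finally show "wproj j k f s = (if k = l then f else 0) s" by simp
qed

locale fin_dim_invariant =
  fixes V B :: "(complex^'m^'m \<Rightarrow> complex) set"
  assumes inv: "invariant_subspace V" and B: "finite B" "V = cfun.span B"
begin

lemma V_sub: "cfun.subspace V" and V_cont: "f \<in> V \<Longrightarrow> f \<in> cont_fun"
  and V_act: "g \<in> unitary_group \<Longrightarrow> f \<in> V \<Longrightarrow> act g f \<in> V"
  using inv by (auto simp: invariant_subspace_def)

text \<open>The reproducing points write every translate of \<open>f\<close> as a combination of the
  fixed functions \<open>b p\<close> in \<open>V\<close>, so the average over the circle only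
  changes the scalars.\<close>

lemma wproj_in:
  assumes "f \<in> V" shows "wproj j k f \<in> V"
proof -
  obtain P b where P: "finite P" "\<forall>p\<in>P. b p \<in> V"
    and rep: "\<forall>f\<in>V. \<forall>s. f s = (\<Sum>p\<in>P. f p * b p s)"
    using span_reproducing[OF B(1)] unfolding B(2) by blast
  have "wproj j k f = (\<Sum>p\<in>P. cscale (wproj j k f p) (b p))"
  proof
    fix s
    have "wproj j k f s = fourier_coeff (\<lambda>z. \<Sum>p\<in>P. b p s * act (circ j z) f p) k"
      unfolding wproj_def
    proof (rule fourier_coeff_cong)
      fix z :: complex assume "norm z = 1"
      then have "act (circ j z) f \<in> V" using assms by (simp add: V_act)
      then show "act (circ j z) f s = (\<Sum>p\<in>P. b p s * act (circ j z) f p)"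
        using rep by (metis (no_types, lifting) mult.commute sum.cong)
    qed
    also have "\<dots> = (\<Sum>p\<in>P. fourier_coeff (\<lambda>z. b p s * act (circ j z) f p) k)"
      using P assms by (intro fourier_coeff_sum continuous_intros continuous_on_circ V_cont) auto
    also have "\<dots> = (\<Sum>p\<in>P. cscale (wproj j k f p) (b p)) s"
      by (simp add: sum_fun_apply cscale_apply fourier_coeff_mult wproj_def mult.commute)
    finally show "wproj j k f s = (\<Sum>p\<in>P. cscale (wproj j k f p) (b p)) s" .
  qed
  also have "\<dots> \<in> V"
    using P by (intro cfun.subspace_sum[OF V_sub] cfun.subspace_scale[OF V_sub]) auto
  finally show ?thesis .
qed

text \<open>Each nonzero projection is fixed by its own projector and killed by the others, so they
  are independent, hence finite in number. The remainder \<open>h\<close> has an orbit with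
  vanishing Fourier coefficients; uniqueness at \<open>z = 1\<close> gives
  \<open>h = 0\<close>.\<close>

lemma wproj_decomp:
  assumes f: "f \<in> V"
  shows "finite {k. wproj j k f \<noteq> 0}" "f = (\<Sum>k | wproj j k f \<noteq> 0. wproj j k f)"
proof -
  define K where "K = {k. wproj j k f \<noteq> 0}"
  have idem: "wproj j k (wproj j l f) = (if k = l then wproj j l f else 0)" for k l
    by (rule wproj_of_weight) (rule wproj_weight[OF V_cont[OF f]])
  have inj: "inj_on (\<lambda>k. wproj j k f) K"
  proof (rule inj_onI)
    fix k l assume kl: "k \<in> K" "l \<in> K" "wproj j k f = wproj j l f"
    then have "wproj j k (wproj j l f) = wproj j k f" using idem[of k k] by simp
    then show "k = l" using idem[of k l] kl by (auto simp: K_def split: if_splits)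
  qed
  have "cfun.independent ((\<lambda>k. wproj j k f) ` K)"
    unfolding cfun.independent_explicit_finite_subsets
  proof (intro allI impI ballI)
    fix S u v assume S: "S \<subseteq> (\<lambda>k. wproj j k f) ` K" "finite S" "(\<Sum>v\<in>S. cscale (u v) v) = 0" and v: "v \<in> S"
    then obtain k where k: "k \<in> K" "v = wproj j k f" by blast
    have SV: "w \<in> cont_fun" if "w \<in> S" for w using S(1) that wproj_in[OF f] V_cont by blast
    have "wproj j k (\<Sum>v\<in>S. cscale (u v) v) = (\<Sum>w\<in>S. cscale (u w) (wproj j k w))"
      using S(2) SV by (subst wproj_sum) (auto simp: wproj_scale intro: cfun.subspace_scale[OF
          cont_fun_subspace])
    also have "\<dots> = (\<Sum>w\<in>S. if w = v then cscale (u v) v else 0)"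
    proof (rule sum.cong)
      fix w assume "w \<in> S"
      then obtain l where l: "l \<in> K" "w = wproj j l f" using S by blast
      then show "cscale (u w) (wproj j k w) = (if w = v then cscale (u v) v else 0)"
        using idem[of k l] k l inj by (auto simp: inj_on_def)
    qed simp
    also have "\<dots> = cscale (u v) v" using S(2) v by simp
    finally have "cscale (u v) v = 0" using S(3) by simp
    moreover have "v \<noteq> 0" using k by (simp add: K_def)
    ultimately show "u v = 0" by (metis cfun.scale_eq_0_iff)
  qed
  moreover have "(\<lambda>k. wproj j k f) ` K \<subseteq> cfun.span B"
    using wproj_in[OF f] B(2) by auto
  ultimately have "finite ((\<lambda>k. wproj j k f) ` K)"
    using cfun.independent_span_bound[OF B(1)] by blast
  then have fin: "finite K" using inj finite_imageD by blast
  then show "finite {k. wproj j k f \<noteq> 0}" by (simp add: K_def)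
  define h where "h = f - (\<Sum>k\<in>K. wproj j k f)"
  have sV: "(\<Sum>k\<in>K. wproj j k f) \<in> V" by (intro cfun.subspace_sum[OF V_sub] wproj_in f)
  have hV: "h \<in> V" unfolding h_def using f sV by (rule cfun.subspace_diff[OF V_sub])
  have "wproj j k h = 0" for k
  proof -
    have "wproj j k h = wproj j k f - (\<Sum>l\<in>K. wproj j k (wproj j l f))"
      unfolding h_def using f sV fin wproj_in by (simp add: wproj_diff V_cont wproj_sum)
    also have "(\<Sum>l\<in>K. wproj j k (wproj j l f)) = (if k \<in> K then wproj j k f else 0)"
      unfolding idem using fin by (simp add: sum.delta)
    finally show ?thesis by (auto simp: K_def)
  qed
  then have "fourier_coeff (\<lambda>z. act (circ j z) h s) k = 0" for s k
    by (metis wproj_def zero_fun_apply)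
  then have "act (circ j 1) h s = 0" for s
    by (intro fourier_coeff_unique[OF continuous_on_circ[OF V_cont[OF hV]]]) auto
  then have "h = 0" by (simp add: fun_eq_iff)
  then show "f = (\<Sum>k | wproj j k f \<noteq> 0. wproj j k f)" by (simp add: h_def K_def)
qed

text \<open>Restricting to the coordinates in \<open>A\<close> allows the torus to be diagonalized
  one circle at a time.\<close>

definition weight_on :: "'m set \<Rightarrow> ('m \<Rightarrow> int) \<Rightarrow> (complex^'m^'m \<Rightarrow> complex) \<Rightarrow> bool" where
  "weight_on A \<mu> f \<longleftrightarrow> (\<forall>t. torus_elt t \<and> (\<forall>i. i \<notin> A \<longrightarrow> t i = 1) \<longrightarrow>
     act (diag_mat t) f = cscale (\<Prod>i\<in>A. t i powi \<mu> i) f)"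

text \<open>The projection for the circle at \<open>j\<close> commutes with the other circles, so
  weights already attained on \<open>A\<close> persist.\<close>

lemma weight_on_decomp: "f \<in> V \<Longrightarrow> f \<in> cfun.span {h \<in> V. \<exists>\<mu>. weight_on A \<mu> h}"
proof (induction A arbitrary: f rule: infinite_finite_induct)
  case empty
  have "weight_on {} \<mu> f" for \<mu>
  proof -
    have "act (diag_mat t) f = f" if "\<forall>i. t i = 1" for t
    proof -
      have "diag_mat t = mat 1" using that diag_mat_1 by (metis (no_types, lifting) ext)
      then show ?thesis by simp
    qed
    then show ?thesis by (auto simp: weight_on_def fun_eq_iff cscale_apply)
  qed
  then show ?case using empty by (intro cfun.span_base) blast
next
  case (insert j A)
  let ?W = "{h \<in> V. \<exists>\<mu>. weight_on (insert j A) \<mu> h}"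
  have "h \<in> cfun.span ?W" if h: "h \<in> V" "weight_on A \<mu> h" for h \<mu>
  proof -
    have "wproj j k h \<in> ?W" for k
    proof -
      have "weight_on (insert j A) (\<mu>(j := k)) (wproj j k h)"
        unfolding weight_on_def
      proof (intro allI impI, elim conjE)
        fix t :: "'m \<Rightarrow> complex" assume t: "torus_elt t" "\<forall>i. i \<notin> insert j A \<longrightarrow> t i = 1"
        define t' where "t' = t(j := 1)"
        have t': "torus_elt t'" "\<forall>i. i \<notin> A \<longrightarrow> t' i = 1" using t by (auto simp: t'_def torus_elt_def)
        have nj: "norm (t j) = 1" using t by (simp add: torus_elt_def)
        have dt: "diag_mat t = diag_mat t' ** circ j (t j)"
          unfolding circ_def diag_mat_mult by (rule arg_cong[of _ _ diag_mat]) (auto simp: t'_def)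
        have "act (diag_mat t) (wproj j k h) = act (diag_mat t') (cscale (t j powi k) (wproj j k h))"
          unfolding dt using t' nj h
          by (simp add: act_mult[symmetric] wproj_weight V_cont)
        also have "\<dots> = cscale (t j powi k) (wproj j k (act (diag_mat t') h))"
          unfolding act_linear
          by (subst wproj_act) (use t' in \<open>auto simp: circ_def diag_mat_mult mult.commute\<close>)
        also have "act (diag_mat t') h = cscale (\<Prod>i\<in>A. t' i powi \<mu> i) h"
          using h t' by (auto simp: weight_on_def)
        also have "(\<Prod>i\<in>A. t' i powi \<mu> i) = (\<Prod>i\<in>A. t i powi (\<mu>(j := k)) i)"
          using insert.hyps by (intro prod.cong) (auto simp: t'_def)
        finally show "act (diag_mat t) (wproj j k h) =
            cscale (\<Prod>i\<in>insert j A. t i powi (\<mu>(j := k)) i) (wproj j k h)"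
          using insert.hyps by (simp add: wproj_scale)
      qed
      then show ?thesis using wproj_in[OF h(1)] by blast
    qed
    then have "(\<Sum>k | wproj j k h \<noteq> 0. wproj j k h) \<in> cfun.span ?W"
      by (intro cfun.span_sum cfun.span_base)
    then show ?thesis using wproj_decomp(2)[OF h(1), of j] by simp
  qed
  then have "cfun.span {h \<in> V. \<exists>\<mu>. weight_on A \<mu> h} \<subseteq> cfun.span ?W"
    by (intro cfun.span_minimal cfun.subspace_span) blast
  then show ?case using insert by blast
qed simp

end

definition weight_vec :: "('m \<Rightarrow> int) \<Rightarrow> (complex^'m^'m \<Rightarrow> complex) \<Rightarrow> bool" where
  "weight_vec \<mu> f \<longleftrightarrow> (\<forall>t. torus_elt t \<longrightarrow>
     act (diag_mat t) f = cscale (\<Prod>i\<in>UNIV. t i powi \<mu> i) f)"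

lemma is_weight_iff: "is_weight V \<mu> \<longleftrightarrow> (\<exists>f\<in>V. f \<noteq> 0 \<and> weight_vec \<mu> f)"
  by (simp add: is_weight_def weight_vec_def torus_elt_def)

lemma (in fin_dim_invariant) weight_decomp:
  assumes "f \<in> V" shows "f \<in> cfun.span {h \<in> V. \<exists>\<mu>. weight_vec \<mu> h}"
  using weight_on_decomp[OF assms, of UNIV] by (simp add: weight_on_def weight_vec_def)

subsection \<open>Homogeneous polynomials and extraction of coefficients\<close>

definition mon :: "('m \<Rightarrow> nat) \<Rightarrow> complex^'m \<Rightarrow> complex" where
  "mon k u = (\<Prod>i\<in>UNIV. (u $ i) ^ k i)"

definition expos :: "nat \<Rightarrow> ('m::finite \<Rightarrow> nat) set" where
  "expos d = {k. (\<Sum>i\<in>UNIV. k i) = d}"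

definition hpoly :: "nat \<Rightarrow> (complex^'m \<Rightarrow> complex) set" where
  "hpoly d = cfun.span (mon ` expos d)"

lemma expos_le: "k \<in> expos d \<Longrightarrow> k i \<le> d"
proof -
  assume "k \<in> expos d"
  moreover have "k i \<le> sum k UNIV" by (rule member_le_sum) auto
  ultimately show "k i \<le> d" by (simp add: expos_def)
qed

lemma finite_expos [simp]: "finite (expos d :: ('m::finite \<Rightarrow> nat) set)"
proof (rule finite_subset)
  show "expos d \<subseteq> PiE (UNIV :: 'm set) (\<lambda>_. {..d})" using expos_le by auto
qed (auto intro: finite_PiE)

lemma mon_add: "mon (\<lambda>i. k i + l i) u = mon k u * mon l u"
  by (simp add: mon_def power_add prod.distrib)

lemma mon_unit: "mon (\<lambda>i. if i = j then 1 else 0) u = u $ j"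
  by (simp add: mon_def if_distrib[of "\<lambda>n. _ ^ n"] cong: if_cong)

lemma unit_expos: "(\<lambda>i. if i = j then d else 0) \<in> expos d"
  by (simp add: expos_def)

lemma span_mult_closed:
  assumes f: "f \<in> cfun.span A" and g: "g \<in> cfun.span B"
    and AB: "\<And>a b. a \<in> A \<Longrightarrow> b \<in> B \<Longrightarrow> (\<lambda>x. a x * b x) \<in> cfun.span C"
  shows "(\<lambda>x. f x * g x) \<in> cfun.span C"
proof -
  have 1: "(\<lambda>x. a x * g x) \<in> cfun.span C" if a: "a \<in> A" for a
    using g
  proof (induction g rule: cfun.span_induct_alt)
    case base
    then show ?case using cfun.span_zero by (simp add: zero_fun_def)
  next
    case (step c b h)
    have "(\<lambda>x. a x * (cscale c b + h) x) = cscale c (\<lambda>x. a x * b x) + (\<lambda>x. a x * h x)"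
      by (simp add: fun_eq_iff cscale_apply algebra_simps)
    then show ?case using step AB[OF a] by (simp only: cfun.span_add cfun.span_scale)
  qed
  show ?thesis
    using f
  proof (induction f rule: cfun.span_induct_alt)
    case base
    then show ?case using cfun.span_zero by (simp add: zero_fun_def)
  next
    case (step c a h)
    have "(\<lambda>x. (cscale c a + h) x * g x) = cscale c (\<lambda>x. a x * g x) + (\<lambda>x. h x * g x)"
      by (simp add: fun_eq_iff cscale_apply algebra_simps)
    then show ?case using step 1 by (simp only: cfun.span_add cfun.span_scale)
  qed
qed

lemma mon_hpoly: "k \<in> expos d \<Longrightarrow> mon k \<in> hpoly d"
  unfolding hpoly_def by (intro cfun.span_base) simp

lemma hpoly_mult:
  assumes "f \<in> hpoly c" "g \<in> hpoly d"
  shows "(\<lambda>u. f u * g u) \<in> hpoly (c + d)"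
  using assms unfolding hpoly_def
proof (rule span_mult_closed)
  fix a b :: "complex^'a \<Rightarrow> complex" assume "a \<in> mon ` expos c" "b \<in> mon ` expos d"
  then obtain k l where kl: "k \<in> expos c" "l \<in> expos d" "a = mon k" "b = mon l" by blast
  then have "(\<lambda>i. k i + l i) \<in> expos (c + d)" by (simp add: expos_def sum.distrib)
  moreover have "(\<lambda>x. a x * b x) = mon (\<lambda>i. k i + l i)" by (simp add: fun_eq_iff kl mon_add)
  ultimately show "(\<lambda>x. a x * b x) \<in> cfun.span (mon ` expos (c + d))" by (intro cfun.span_base) simp
qed

lemma hpoly_1: "(\<lambda>u :: complex^'m. 1) \<in> hpoly 0"
proof -
  have "mon (\<lambda>i. 0) = (\<lambda>u :: complex^'m. 1)" by (simp add: mon_def fun_eq_iff)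
  then show ?thesis using mon_hpoly[of "\<lambda>i :: 'm. 0" 0] by (simp add: expos_def)
qed

lemma hpoly_power: "f \<in> hpoly d \<Longrightarrow> (\<lambda>u. f u ^ n) \<in> hpoly (n * d)"
proof (induction n)
  case 0
  then show ?case using hpoly_1 by simp
next
  case (Suc n)
  then show ?case using hpoly_mult[of f d "\<lambda>u. f u ^ n" "n * d"] by (simp add: add.commute)
qed

lemma hpoly_coord: "(\<lambda>u. u $ j) \<in> hpoly 1"
  using mon_hpoly[OF unit_expos[of j 1]] by (simp add: mon_unit[abs_def])

lemma hpoly_sum: "(\<And>i. i \<in> A \<Longrightarrow> f i \<in> hpoly d) \<Longrightarrow> (\<lambda>u. \<Sum>i\<in>A. f i u) \<in> hpoly d"
proof -
  assume *: "\<And>i. i \<in> A \<Longrightarrow> f i \<in> hpoly d"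
  have "(\<lambda>u. \<Sum>i\<in>A. f i u) = (\<Sum>i\<in>A. f i)" by (simp add: fun_eq_iff sum_fun_apply)
  then show ?thesis using * unfolding hpoly_def by (simp only: cfun.span_sum)
qed

lemma hpoly_scale: "f \<in> hpoly d \<Longrightarrow> (\<lambda>u. c * f u) \<in> hpoly d"
  unfolding hpoly_def using cfun.span_scale[of f _ c] by (simp add: cscale_def)

lemma quad_form_sum: "quad_form s u = (\<Sum>i\<in>UNIV. \<Sum>j\<in>UNIV. s $ i $ j * (u $ i * u $ j))"
  by (simp add: quad_form_def matrix_vec_nth sum_distrib_left mult_ac)

lemma quad_form_hpoly: "quad_form s \<in> hpoly 2"
proof -
  have "(\<lambda>u. \<Sum>i\<in>UNIV. \<Sum>j\<in>UNIV. s $ i $ j * (u $ i * u $ j)) \<in> hpoly 2"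
    using hpoly_mult[OF hpoly_coord hpoly_coord] by (intro hpoly_sum hpoly_scale) (simp add: numeral_2_eq_2)
  then show ?thesis by (simp add: quad_form_sum[abs_def])
qed

lemma span_image_sum:
  assumes "finite K" "f \<in> cfun.span (b ` K)"
  shows "\<exists>a. f = (\<Sum>k\<in>K. cscale (a k) (b k))"
  using assms
proof (induction K arbitrary: f)
  case empty
  then have "f = 0" by (simp only: image_empty cfun.span_empty singleton_iff)
  then show ?case by simp
next
  case (insert x K)
  then obtain c where "f - cscale c (b x) \<in> cfun.span (b ` K)"
    unfolding image_insert cfun.span_breakdown_eq by blast
  then obtain a where a: "f - cscale c (b x) = (\<Sum>k\<in>K. cscale (a k) (b k))" using insert by blast
  have "f = cscale c (b x) + (\<Sum>k\<in>K. cscale (a k) (b k))" unfolding a[symmetric] by (simp add: fun_eq_iff)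
  also have "\<dots> = (\<Sum>k\<in>insert x K. cscale ((a(x := c)) k) (b k))"
    using insert.hyps by (auto simp: fun_upd_def simp del: plus_fun_apply intro!: sum.cong arg_cong2[of
        _ _ _ _ "(+)"])
  finally show ?case by blast
qed

lemma hpoly_expand:
  assumes "f \<in> hpoly d" obtains a where "\<And>u. f u = (\<Sum>k\<in>expos d. a k * mon k u)"
proof -
  obtain a where "f = (\<Sum>k\<in>expos d. cscale (a k) (mon k))"
    using span_image_sum[OF finite_expos] assms unfolding hpoly_def by blast
  then have "f u = (\<Sum>k\<in>expos d. a k * mon k u)" for u by (simp add: sum_fun_apply cscale_apply)
  then show thesis by (rule that)
qed

section \<open>Extracting coefficients by averaging over roots of unity\<close>

definition root1 :: "nat \<Rightarrow> complex" where
  "root1 d = cis (2 * pi / (real d + 1))"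

definition grid :: "nat \<Rightarrow> ('m::finite \<Rightarrow> nat) set" where
  "grid d = PiE UNIV (\<lambda>_. {..d})"

definition grid_pt :: "nat \<Rightarrow> ('m::finite \<Rightarrow> nat) \<Rightarrow> complex^'m" where
  "grid_pt d r = (\<chi> i. root1 d ^ r i)"

text \<open>Kernel of the Fourier transform on tuples of roots of unity of order
  \<open>d + 1\<close>; this order tells the exponents \<open>0\<close> to \<open>d\<close>
  apart.\<close>

definition grid_char :: "nat \<Rightarrow> ('m::finite \<Rightarrow> nat) \<Rightarrow> ('m \<Rightarrow> nat) \<Rightarrow> complex" where
  "grid_char d k r = (\<Prod>i\<in>UNIV. cnj (root1 d) ^ (r i * k i)) / (real d + 1) ^ CARD('m)"

lemma norm_root1 [simp]: "norm (root1 d) = 1"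
  by (simp add: root1_def)

lemma norm_grid_pt: "norm (grid_pt d r $ i) = 1"
  by (simp add: grid_pt_def norm_power)

lemma root1_sum:
  assumes "a \<le> d" "b \<le> d"
  shows "(\<Sum>r\<le>d. cnj (root1 d) ^ (r * b) * root1 d ^ (r * a)) = (if a = b then real d + 1 else 0)"
proof -
  define z where "z = cis (2 * pi * (real a - real b) / (real d + 1))"
  have c: "cnj (root1 d) ^ (r * b) * root1 d ^ (r * a) = z ^ r" for r
  proof -
    have "cnj (root1 d) ^ b * root1 d ^ a = z"
    proof -
      have "cnj (root1 d) ^ b * root1 d ^ a =
          cis (real b * - (2 * pi / (real d + 1)) + real a * (2 * pi / (real d + 1)))"
        by (simp only: root1_def cis_cnj Complex.DeMoivre cis_mult)
      also have "\<dots> = z"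
        unfolding z_def by (rule arg_cong[of _ _ cis]) (simp add: divide_inverse algebra_simps)
      finally show ?thesis .
    qed
    then show ?thesis by (simp add: power_mult mult.commute[of r] power_mult_distrib[symmetric])
  qed
  show ?thesis
  proof (cases "a = b")
    case True
    then show ?thesis unfolding c by (simp add: z_def)
  next
    case False
    have "z \<noteq> 1"
    proof
      assume "z = 1"
      then have "cos (2 * pi * (real a - real b) / (real d + 1)) = 1"
        by (simp add: z_def complex_eq_iff)
      then obtain n :: int where "2 * pi * (real a - real b) / (real d + 1) = n * (2 * pi)"
        by (auto simp: cos_one_2pi_int)
      then have "(2 * pi) * ((real a - real b) / (real d + 1)) = (2 * pi) * n"
        by (metis mult.commute times_divide_eq_right)
      then have "(real a - real b) / (real d + 1) = n" by (simp only: mult_cancel_left) simp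
      then have "real a - real b = n * (real d + 1)" by (simp add: divide_eq_eq)
      then have "real_of_int (int a - int b) = real_of_int (n * (int d + 1))" by simp
      then have *: "int a - int b = n * (int d + 1)" by (simp only: of_int_eq_iff)
      have "\<bar>int a - int b\<bar> < int d + 1" using assms by linarith
      then have "\<bar>n\<bar> * (int d + 1) < 1 * (int d + 1)" unfolding * abs_mult by simp
      then have "n = 0" by (simp only: mult_less_cancel_right) linarith
      then show False using * False by simp
    qed
    moreover have "z ^ Suc d = 1"
    proof -
      have "real (Suc d) * (2 * pi * (real a - real b) / (real d + 1)) = 2 * pi * (real_of_int (int a -
          int b))"
        by (simp add: field_simps)
      then show ?thesis
        unfolding z_def Complex.DeMoivre by (simp only: cis_multiple_2pi Ints_of_int)
    qed
    moreover have "(\<Sum>r\<le>d. z ^ r) = (z ^ Suc d - 1) / (z - 1)"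
      unfolding lessThan_Suc_atMost[symmetric] by (rule geometric_sum) fact
    ultimately show ?thesis
      unfolding c using False by (simp del: power_Suc)
  qed
qed

lemma grid_filter:
  fixes k l :: "'m::finite \<Rightarrow> nat"
  assumes "k \<in> expos d" "l \<in> expos d"
  shows "(\<Sum>r\<in>grid d. grid_char d k r * mon l (grid_pt d r)) = (if k = l then 1 else 0)"
proof -
  have "(\<Sum>r\<in>grid d. grid_char d k r * mon l (grid_pt d r)) =
      (\<Sum>r\<in>grid d. \<Prod>i\<in>UNIV. cnj (root1 d) ^ (r i * k i) * root1 d ^ (r i * l i)) / (real d + 1) ^ CARD('m)"
    by (simp add: grid_char_def mon_def grid_pt_def prod.distrib power_mult sum_divide_distrib)
  also have "(\<Sum>r\<in>grid d. \<Prod>i\<in>UNIV. cnj (root1 d) ^ (r i * k i) * root1 d ^ (r i * l i)) =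
      (\<Prod>i\<in>UNIV. \<Sum>r\<le>d. cnj (root1 d) ^ (r * k i) * root1 d ^ (r * l i))"
    unfolding grid_def by (subst prod_sum_PiE) auto
  also have "\<dots> = (\<Prod>i\<in>(UNIV::'m set). if k i = l i then complex_of_real (real d + 1) else 0)"
    by (intro prod.cong refl, subst root1_sum[OF expos_le[OF assms(2)] expos_le[OF assms(1)]]) auto
  also have "\<dots> = (if k = l then complex_of_real (real d + 1) ^ CARD('m) else 0)"
    by (auto simp: fun_eq_iff intro!: prod_zero)
  finally have "(\<Sum>r\<in>grid d. grid_char d k r * mon l (grid_pt d r)) =
     (if k = l then complex_of_real (real d + 1) ^ CARD('m) else 0) / (real d + 1) ^ CARD('m)" .
  moreover have "complex_of_real (real d + 1) \<noteq> 0"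
    by (metis of_nat_Suc of_nat_neq_0 of_real_of_nat_eq add.commute)
  ultimately show ?thesis by simp
qed

text \<open>The multinomial theorem, with only the sign of the coefficients recorded. This sign
  keeps the extreme component nonzero in \<open>qspace_irreducible\<close>.\<close>

lemma sum_powers_positive:
  "\<exists>m :: ('m::finite \<Rightarrow> nat) \<Rightarrow> real. (\<forall>k\<in>expos d. 0 < m k) \<and>
    (\<forall>u :: complex^'m. (\<Sum>i\<in>UNIV. u $ i) ^ d = (\<Sum>k\<in>expos d. complex_of_real (m k) * mon k u))"
proof (induction d)
  case 0
  have "expos 0 = {\<lambda>i::'m. 0}" by (auto simp: expos_def)
  then show ?case by (intro exI[of _ "\<lambda>k. 1"]) (simp add: mon_def)
next
  case (Suc d)
  then obtain m :: "('m \<Rightarrow> nat) \<Rightarrow> real" where m: "\<And>k. k \<in> expos d \<Longrightarrow> 0 < m k"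
    "\<And>u :: complex^'m. (\<Sum>i\<in>UNIV. u $ i) ^ d = (\<Sum>k\<in>expos d. complex_of_real (m k) * mon k u)" by blast
  let ?g = "\<lambda>(j, k). (\<lambda>i::'m. k i + (if i = j then 1 else 0))"
  let ?S = "(UNIV :: 'm set) \<times> expos d"
  define m' where "m' l = (\<Sum>x\<in>{x \<in> ?S. ?g x = l}. m (snd x))" for l
  have sub: "?g ` ?S \<subseteq> expos (Suc d)" by (auto simp: expos_def sum.distrib)
  have "(\<Sum>i\<in>UNIV. u $ i) ^ Suc d = (\<Sum>k\<in>expos (Suc d). complex_of_real (m' k) * mon k u)" for u :: "complex^'m"
  proof -
    have "(\<Sum>i\<in>UNIV. u $ i) ^ Suc d = (\<Sum>x\<in>?S. u $ fst x * (complex_of_real (m (snd x)) * mon (snd x) u))"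
      by (simp add: m(2) sum_product sum.cartesian_product case_prod_beta)
    also have "\<dots> = (\<Sum>x\<in>?S. complex_of_real (m (snd x)) * mon (?g x) u)"
      by (intro sum.cong) (auto simp: mon_add mon_unit mult_ac)
    also have "\<dots> = (\<Sum>l\<in>expos (Suc d). \<Sum>x\<in>{x \<in> ?S. ?g x = l}. complex_of_real (m (snd x)) * mon (?g x) u)"
      using sub by (intro sum.group[symmetric]) auto
    also have "\<dots> = (\<Sum>l\<in>expos (Suc d). \<Sum>x\<in>{x \<in> ?S. ?g x = l}. complex_of_real (m (snd x)) * mon l u)"
      by (intro sum.cong) auto
    also have "\<dots> = (\<Sum>k\<in>expos (Suc d). complex_of_real (m' k) * mon k u)"
      by (simp add: m'_def sum_distrib_right)
    finally show ?thesis .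
  qed
  moreover have "0 < m' l" if l: "l \<in> expos (Suc d)" for l
  proof -
    obtain j where j: "0 < l j"
      using l by (metis (mono_tags, lifting) expos_def mem_Collect_eq nat.distinct(1) neq0_conv sum.neutral)
    define k where "k = l(j := l j - 1)"
    have g: "?g (j, k) = l" using j by (auto simp: k_def fun_eq_iff)
    have "(\<Sum>i\<in>UNIV. k i + (if i = j then 1 else 0)) = Suc d"
      using g l by (simp add: expos_def fun_eq_iff)
    then have "k \<in> expos d" by (simp add: expos_def sum.distrib)
    then have "(j, k) \<in> {x \<in> ?S. ?g x = l}" using g by simp
    then show ?thesis unfolding m'_def
      by (intro sum_pos) (auto intro: m(1) finite_subset[of _ ?S])
  qed
  ultimately show ?case by (intro exI[of _ m']) simp
qed

subsection \<open>The spaces spanned by powers of the quadratic forms\<close>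

definition qpow :: "nat \<Rightarrow> complex^'m \<Rightarrow> complex^'m^'m \<Rightarrow> complex" where
  "qpow i u = (\<lambda>s. if s \<in> sym_unitary then quad_form s u ^ i else 0)"

definition qspace :: "nat \<Rightarrow> (complex^'m^'m \<Rightarrow> complex) set" where
  "qspace i = cfun.span (range (qpow i))"

text \<open>The coefficient of \<open>mon k u\<close> in \<open>quad_form s u ^ i\<close>. As a
  combination of functions \<open>qpow\<close> it lies in \<open>qspace i\<close> and vanishes
  outside \<open>sym_unitary\<close> by construction.\<close>

definition qcoeff :: "nat \<Rightarrow> ('m::finite \<Rightarrow> nat) \<Rightarrow> complex^'m^'m \<Rightarrow> complex" where
  "qcoeff i k = (\<Sum>r\<in>grid (2 * i). cscale (grid_char (2 * i) k r) (qpow i (grid_pt (2 * i) r)))"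

lemma quad_form_conj: "quad_form (A ** s ** transpose A) u = quad_form s (transpose A *v u)"
proof -
  have bil: "(\<Sum>i\<in>UNIV. v $ i * (A *v w) $ i) = (\<Sum>i\<in>UNIV. (transpose A *v v) $ i * w $ i)" for v w
  proof -
    have "(\<Sum>i\<in>UNIV. v $ i * (A *v w) $ i) = (\<Sum>i\<in>UNIV. \<Sum>k\<in>UNIV. v $ i * A $ i $ k * w $ k)"
      by (simp only: matrix_vec_nth sum_distrib_left mult.assoc)
    also have "\<dots> = (\<Sum>k\<in>UNIV. \<Sum>i\<in>UNIV. v $ i * A $ i $ k * w $ k)" by (rule sum.swap)
    also have "\<dots> = (\<Sum>i\<in>UNIV. (transpose A *v v) $ i * w $ i)"
      by (simp only: matrix_vec_nth transpose_nth sum_distrib_right) (simp only: mult_ac)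
    finally show ?thesis .
  qed
  have "quad_form (A ** s ** transpose A) u = (\<Sum>i\<in>UNIV. u $ i * (A *v (s *v (transpose A *v u))) $ i)"
    unfolding quad_form_def by (simp only: matrix_vector_mul_assoc matrix_mul_assoc)
  then show ?thesis unfolding bil quad_form_def .
qed

lemma act_qpow:
  assumes "g \<in> unitary_group" shows "act g (qpow i u) = qpow i (cnj_mat g *v u)"
proof
  fix s
  have "quad_form (adj g ** s ** cnj_mat g) u = quad_form s (cnj_mat g *v u)"
    using quad_form_conj[of "adj g" s u] by (simp only: transpose_adj)
  then show "act g (qpow i u) s = qpow i (cnj_mat g *v u) s"
    using assms by (simp add: act_apply qpow_def sym_unitary_act)
qed

lemma qpow_expand: "qpow i u = (\<Sum>k\<in>expos (2 * i). cscale (mon k u) (qcoeff i k))"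
proof
  fix s :: "complex^'a^'a"
  show "qpow i u s = (\<Sum>k\<in>expos (2 * i). cscale (mon k u) (qcoeff i k)) s"
  proof (cases "s \<in> sym_unitary")
    case True
    have "(\<lambda>u. quad_form s u ^ i) \<in> hpoly (2 * i)"
      using hpoly_power[OF quad_form_hpoly, of s i] by (simp add: mult.commute)
    then obtain a where a: "\<And>u. quad_form s u ^ i = (\<Sum>k\<in>expos (2 * i). a k * mon k u)"
      using hpoly_expand by blast
    have "qcoeff i k s = a k" if k: "k \<in> expos (2 * i)" for k
    proof -
      have "qcoeff i k s = (\<Sum>r\<in>grid (2 * i). \<Sum>l\<in>expos (2 * i).
          a l * (grid_char (2 * i) k r * mon l (grid_pt (2 * i) r)))"
        using True by (simp add: qcoeff_def sum_fun_apply cscale_apply qpow_def a sum_distrib_left mult_ac)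
      also have "\<dots> = (\<Sum>l\<in>expos (2 * i). a l * (\<Sum>r\<in>grid (2 * i). grid_char (2 * i) k r * mon l (grid_pt
          (2 * i) r)))"
        by (subst sum.swap) (simp add: sum_distrib_left)
      also have "\<dots> = (\<Sum>l\<in>expos (2 * i). if k = l then a l else 0)"
        using k by (intro sum.cong) (auto simp: grid_filter)
      finally show ?thesis using k by simp
    qed
    then show ?thesis using True
      by (simp add: qpow_def a sum_fun_apply cscale_apply mult.commute)
  next
    case False
    then have "qcoeff i k s = 0" for k by (simp add: qcoeff_def sum_fun_apply cscale_apply qpow_def)
    then show ?thesis using False by (simp add: qpow_def sum_fun_apply cscale_apply)
  qed
qed

text \<open>Two generating sets with different virtues: the group acts on the functions
  \<open>qpow i u\<close> by moving \<open>u\<close>, while the finitely many coefficients are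
  weight vectors.\<close>

lemma qspace_alt:
  "(qspace i :: (complex^'m^'m \<Rightarrow> complex) set) = cfun.span (qcoeff i ` expos (2 * i))"
proof
  show "(qspace i :: (complex^'m^'m \<Rightarrow> complex) set) \<subseteq> cfun.span (qcoeff i ` expos (2 * i))"
    unfolding qspace_def
  proof (intro cfun.span_minimal cfun.subspace_span subsetI)
    fix f assume "f \<in> range (qpow i :: complex^'m \<Rightarrow> _)"
    then obtain u :: "complex^'m" where "f = qpow i u" by blast
    then show "f \<in> cfun.span (qcoeff i ` expos (2 * i))"
      by (simp only: qpow_expand) (intro cfun.span_sum cfun.span_scale cfun.span_base imageI)
  qed
  show "cfun.span (qcoeff i ` expos (2 * i)) \<subseteq> (qspace i :: (complex^'m^'m \<Rightarrow> complex) set)"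
    unfolding qspace_def
  proof (intro cfun.span_minimal cfun.subspace_span subsetI)
    fix f assume "f \<in> qcoeff i ` expos (2 * i)"
    then obtain k where "f = qcoeff i k" by blast
    then show "f \<in> cfun.span (range (qpow i))"
      by (simp only: qcoeff_def) (intro cfun.span_sum cfun.span_scale cfun.span_base rangeI)
  qed
qed

lemma mon_mult_vec: "mon k (\<chi> i. a $ i * b $ i) = mon k a * mon k b"
  by (simp add: mon_def power_mult_distrib prod.distrib)

lemma act_qcoeff:
  fixes t :: "'m::finite \<Rightarrow> complex"
  assumes t: "torus_elt t" and k: "k \<in> expos (2 * i)"
  shows "act (diag_mat t) (qcoeff i k) = cscale (mon k (\<chi> j. cnj (t j))) (qcoeff i k)"
proof -
  have cd: "cnj_mat (diag_mat t) *v v = (\<chi> j. (\<chi> j. cnj (t j)) $ j * v $ j)" for v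
    by (auto simp: vec_eq_iff matrix_vec_nth diag_mat_nth if_distrib[of cnj] if_distrib[of "\<lambda>c. c * _"]
        cong: if_cong)
  have "act (diag_mat t) (qcoeff i k) = (\<Sum>r\<in>grid (2 * i). cscale (grid_char (2 * i) k r)
      (\<Sum>l\<in>expos (2 * i). cscale (mon l (\<chi> j. cnj (t j)) * mon l (grid_pt (2 * i) r)) (qcoeff i l)))"
    unfolding qcoeff_def[of i k] act_sum act_linear
    unfolding act_qpow[OF diag_mat_unitary[OF t]] cd
    by (subst qpow_expand) (simp only: mon_mult_vec vec_lambda_eta)
  also have "\<dots> = (\<Sum>l\<in>expos (2 * i). cscale (mon l (\<chi> j. cnj (t j)))
      (cscale (\<Sum>r\<in>grid (2 * i). grid_char (2 * i) k r * mon l (grid_pt (2 * i) r)) (qcoeff i l)))"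
    unfolding cfun.scale_sum_right cfun.scale_sum_left
    by (subst sum.swap) (simp add: cfun.scale_scale mult_ac)
  also have "\<dots> = (\<Sum>l\<in>expos (2 * i). if k = l then cscale (mon l (\<chi> j. cnj (t j))) (qcoeff i l) else 0)"
    using k by (intro sum.cong) (auto simp: grid_filter)
  finally show ?thesis using k by simp
qed

text \<open>At \<open>u = axis a 1\<close> every other monomial of degree \<open>2 * i\<close>
  vanishes.\<close>

lemma qcoeff_axis: "qcoeff i (\<lambda>j. if j = a then 2 * i else 0) = qpow i (axis a 1)"
proof -
  have "mon k (axis a 1) = (if k = (\<lambda>j. if j = a then 2 * i else 0) then 1 else 0)"
    if k: "k \<in> expos (2 * i)" for k
  proof (cases "\<exists>j. j \<noteq> a \<and> k j > 0")
    case True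
    then obtain j where "j \<noteq> a" "k j > 0" by blast
    then have "mon k (axis a 1) = 0" by (auto simp: mon_def axis_def intro!: prod_zero bexI[of _ j])
    moreover have "k \<noteq> (\<lambda>j. if j = a then 2 * i else 0)"
    proof
      assume "k = (\<lambda>j. if j = a then 2 * i else 0)"
      then have "k j = (if j = a then 2 * i else 0)" by (rule fun_cong)
      then show False using \<open>j \<noteq> a\<close> \<open>k j > 0\<close> by simp
    qed
    ultimately show ?thesis by simp
  next
    case False
    then have z: "k j = 0" if "j \<noteq> a" for j using that by auto
    have "(\<Sum>j\<in>UNIV. k j) = (\<Sum>j\<in>UNIV. if j = a then k a else 0)" using z by (intro sum.cong) auto
    then have "k a = 2 * i" using k by (simp add: expos_def)
    then have "k = (\<lambda>j. if j = a then 2 * i else 0)" using z by auto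
    moreover have "mon k (axis a 1) = 1"
      unfolding mon_def using z by (intro prod.neutral) (auto simp: axis_def)
    ultimately show ?thesis by simp
  qed
  then have "qpow i (axis a 1) = (\<Sum>k\<in>expos (2 * i). if k = (\<lambda>j. if j = a then 2 * i else 0) then qcoeff
      i k else 0)"
    unfolding qpow_expand by (intro sum.cong) auto
  then show ?thesis using unit_expos[of a "2 * i"] by simp
qed

lemma continuous_on_quad_form: "continuous_on S (\<lambda>s. quad_form s u)"
  unfolding quad_form_sum by (intro continuous_intros)

lemma qpow_cont: "qpow i u \<in> cont_fun"
proof -
  have "continuous_on sym_unitary (\<lambda>s. quad_form s u ^ i)"
    by (intro continuous_intros continuous_on_quad_form)
  then show ?thesis by (simp add: cont_fun_def qpow_def cong: continuous_on_cong)
qed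

lemma qspace_invariant: "invariant_subspace (qspace i :: (complex^'m^'m \<Rightarrow> complex) set)"
  unfolding invariant_subspace_def
proof (intro conjI ballI)
  show "cfun.subspace (qspace i :: (complex^'m^'m \<Rightarrow> complex) set)"
    unfolding qspace_def by (rule cfun.subspace_span)
  show "(qspace i :: (complex^'m^'m \<Rightarrow> complex) set) \<subseteq> cont_fun"
    unfolding qspace_def using qpow_cont by (intro cfun.span_minimal cont_fun_subspace) auto
  fix g :: "complex^'m^'m" and f :: "complex^'m^'m \<Rightarrow> complex"
  assume g: "g \<in> unitary_group" and f: "f \<in> qspace i"
  show "act g f \<in> qspace i"
    using f unfolding qspace_def
  proof (induction f rule: cfun.span_induct_alt)
    case base
    then show ?case by (simp only: act_linear cfun.span_zero)
  next
    case (step c b h)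
    then obtain u where "b = qpow i u" by blast
    then have "act g b \<in> range (qpow i)" using g act_qpow by blast
    then show ?case
      unfolding act_linear using step
      by (intro cfun.span_add cfun.span_scale[OF cfun.span_base]) simp_all
  qed
qed

lemma quad_form_scale: "quad_form s (c *s u) = c\<^sup>2 * quad_form s u"
  by (simp add: quad_form_sum sum_distrib_left power2_eq_square mult_ac)

text \<open>Unit vectors form one orbit of the unitary group, and homogeneity in \<open>u\<close>
  gives the rest.\<close>

lemma qspace_least:
  assumes U: "invariant_subspace U" and a: "qpow i (axis a 1) \<in> U"
  shows "qspace i \<subseteq> U"
  unfolding qspace_def
proof (rule cfun.span_minimal)
  show sub: "cfun.subspace U" using U by (simp add: invariant_subspace_def)
  show "range (qpow i) \<subseteq> U"
  proof
    fix f assume "f \<in> range (qpow i :: complex^'a \<Rightarrow> _)"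
    then obtain u :: "complex^'a" where f: "f = qpow i u" by blast
    \<comment> \<open>For \<open>u = 0\<close> the vector is written as \<open>0 *s v\<close>;
      homogeneity then also covers \<open>i = 0\<close>, since \<open>0 ^ 0 = 1\<close>.\<close>
    define v where "v = (if u = 0 then axis a 1 else complex_of_real (1 / norm u) *s u)"
    have v: "herm v v = 1"
    proof (cases "u = 0")
      case True then show ?thesis by (simp add: v_def herm_axis)
    next
      case False then show ?thesis
        by (simp add: v_def herm_simps(5,6) herm_self[of u] power2_eq_square)
    qed
    have u: "\<exists>c. u = c *s v"
    proof (cases "u = 0")
      case True then show ?thesis by (intro exI[of _ 0]) simp
    next
      case False then show ?thesis by (intro exI[of _ "complex_of_real (norm u)"]) (simp add: v_def
          vec_eq_iff)
    qed
    obtain k where k: "k \<in> unitary_group" "k *v axis a 1 = v"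
      using unitary_extend[OF v, of "{}" a] by blast
    have "act (cnj_mat k) (qpow i (axis a 1)) \<in> U" using U a k by (simp add: invariant_subspace_def)
    then have vU: "qpow i v \<in> U" using k by (simp add: act_qpow)
    obtain c where c: "u = c *s v" using u by blast
    have "qpow i u = cscale ((c\<^sup>2) ^ i) (qpow i v)"
      unfolding c by (simp add: fun_eq_iff qpow_def cscale_apply quad_form_scale power_mult_distrib)
    then show "f \<in> U" unfolding f using vU cfun.subspace_scale[OF sub] by simp
  qed
qed

text \<open>Averaging translates over a finite subgroup of the torus against
  \<open>grid_char\<close> isolates one component, so invariant subspaces contain the components of
  their members. Conjugating the grid points undoes the conjugation in
  \<open>act_qcoeff\<close>.\<close>

lemma qspace_component:
  fixes f :: "complex^'m^'m \<Rightarrow> complex"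
  assumes f: "f = (\<Sum>k\<in>expos (2 * i). cscale (b k) (qcoeff i k))" and k: "k \<in> expos (2 * i)"
  shows "cscale (b k) (qcoeff i k) = (\<Sum>r\<in>grid (2 * i). cscale (grid_char (2 * i) k r)
     (act (diag_mat (\<lambda>j. cnj (grid_pt (2 * i) r $ j))) f))"
proof -
  have te: "torus_elt (\<lambda>j. cnj (grid_pt (2 * i) r $ j))" for r :: "'m \<Rightarrow> nat"
    by (simp add: torus_elt_def norm_grid_pt)
  have "act (diag_mat (\<lambda>j. cnj (grid_pt (2 * i) r $ j))) f =
      (\<Sum>l\<in>expos (2 * i). cscale (b l * mon l (grid_pt (2 * i) r)) (qcoeff i l))" for r
    unfolding f act_sum act_linear by (intro sum.cong refl) (simp add: act_qcoeff te cfun.scale_scale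
        vec_lambda_eta)
  then have "(\<Sum>r\<in>grid (2 * i). cscale (grid_char (2 * i) k r)
      (act (diag_mat (\<lambda>j. cnj (grid_pt (2 * i) r $ j))) f)) =
      (\<Sum>r\<in>grid (2 * i). \<Sum>l\<in>expos (2 * i). cscale (b l * (grid_char (2 * i) k r * mon l (grid_pt (2 * i)
          r))) (qcoeff i l))"
    by (simp add: cfun.scale_sum_right cfun.scale_scale mult_ac)
  also have "\<dots> = (\<Sum>l\<in>expos (2 * i). cscale (b l * (\<Sum>r\<in>grid (2 * i). grid_char (2 * i) k r * mon l
      (grid_pt (2 * i) r))) (qcoeff i l))"
    by (subst sum.swap) (simp only: cfun.scale_sum_left sum_distrib_left)
  also have "\<dots> = (\<Sum>l\<in>expos (2 * i). if k = l then cscale (b l) (qcoeff i l) else 0)"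
    using k by (intro sum.cong) (auto simp: grid_filter)
  finally show ?thesis using k by simp
qed

lemma invariant_component:
  assumes U: "invariant_subspace U" and f: "f \<in> U" "f = (\<Sum>k\<in>expos (2 * i). cscale (b k) (qcoeff i k))"
    and k: "k \<in> expos (2 * i)"
  shows "cscale (b k) (qcoeff i k) \<in> U"
proof -
  have sub: "cfun.subspace U" using U by (simp add: invariant_subspace_def)
  show ?thesis
    unfolding qspace_component[OF f(2) k]
    by (intro cfun.subspace_sum[OF sub] cfun.subspace_scale[OF sub])
      (use U f in \<open>auto simp: invariant_subspace_def torus_elt_def norm_grid_pt\<close>)
qed

text \<open>A nonzero invariant \<open>U\<close> contains some \<open>qcoeff i k\<close>. Take a
  unitary \<open>g\<close> such that coordinate \<open>a\<close> of \<open>cnj_mat g *v v\<close> is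
  \<open>c\<close> times the sum of all coordinates of \<open>v\<close>. The component of
  \<open>act g (qcoeff i k)\<close> along \<open>qpow i (axis a 1)\<close> is then
  \<open>c ^ (2 * i)\<close> times a multinomial coefficient, hence nonzero, and so \<open>U\<close>
  contains a generator of \<open>qspace i\<close>.\<close>

lemma qspace_irreducible: "irreducible_subspace (qspace i :: (complex^'m^'m \<Rightarrow> complex) set)"
  unfolding irreducible_subspace_def
proof (intro conjI allI impI)
  show "invariant_subspace (qspace i)" by (rule qspace_invariant)
  show "\<exists>B. finite B \<and> qspace i = cfun.span B" unfolding qspace_alt by (intro exI[of _ "qcoeff i ` expos
      (2 * i)"]) simp
  obtain a :: 'm where True by blast
  have "qpow i (axis a 1) (mat 1) = 1"
    by (simp add: qpow_def quad_form_def axis_def if_distrib[of "\<lambda>c. c * _"] cong: if_cong)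
  then have "qpow i (axis a 1) \<noteq> 0" by (metis zero_fun_apply zero_neq_one)
  moreover have "qpow i (axis a 1) \<in> qspace i" unfolding qspace_def by (intro cfun.span_base) simp
  ultimately show "qspace i \<noteq> ({0} :: (complex^'m^'m \<Rightarrow> complex) set)" by blast
  fix U :: "(complex^'m^'m \<Rightarrow> complex) set" assume U: "invariant_subspace U \<and> U \<subseteq> qspace i"
  then have sub: "cfun.subspace U" by (simp add: invariant_subspace_def)
  show "U = {0} \<or> U = qspace i"
  proof (cases "U = {0}")
    case False
    then obtain p where p: "p \<in> U" "p \<noteq> 0" using cfun.subspace_0[OF sub] by blast
    then have "p \<in> cfun.span (qcoeff i ` expos (2 * i))" using U by (auto simp: qspace_alt)
    then obtain b where b: "p = (\<Sum>k\<in>expos (2 * i). cscale (b k) (qcoeff i k))"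
      using span_image_sum[OF finite_expos] by blast
    obtain k where k: "k \<in> expos (2 * i)" "cscale (b k) (qcoeff i k) \<noteq> 0"
    using p(2) sum.neutral[of "expos (2 * i)" "\<lambda>k. cscale (b k) (qcoeff i k)"] unfolding b by blast
    have "cscale (b k) (qcoeff i k) \<in> U" using invariant_component U p(1) b k(1) by blast
    then have "cscale (1 / b k) (cscale (b k) (qcoeff i k)) \<in> U" by (rule cfun.subspace_scale[OF sub])
    moreover have "b k \<noteq> 0" using k(2) by (metis cfun.scale_zero_left)
    ultimately have kU: "qcoeff i k \<in> U" by (simp add: cfun.scale_scale) 
    \<comment> \<open>Makes the constant vector \<open>w\<close> a unit vector, so that it can be a
      column of the unitary matrix \<open>h\<close>.\<close>
    define c where "c = complex_of_real (1 / sqrt (real CARD('m)))"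
    have c: "c \<noteq> 0" by (simp add: c_def)
    define w :: "complex^'m" where "w = (\<chi> j. c)"
    have "c * cnj c = complex_of_real (1 / real CARD('m))"
      unfolding c_def by (simp only: complex_cnj_complex_of_real of_real_mult[symmetric]) simp
    then have "herm w w = 1" by (simp add: herm_def w_def)
    then obtain h where h: "h \<in> unitary_group" "h *v axis a 1 = w"
      using unitary_extend[of w "{}" a] by blast
    have hn: "h $ j $ a = c" for j using h(2) by (metis matrix_vec_axis vec_lambda_beta w_def)
    define g where "g = adj h"
    have g: "g \<in> unitary_group" by (simp add: g_def h)
    have ga: "(cnj_mat g *v v) $ a = c * (\<Sum>j\<in>UNIV. v $ j)" for v
      unfolding matrix_vec_nth by (simp add: g_def hn sum_distrib_left)
    define d where "d l = (\<Sum>r\<in>grid (2 * i). grid_char (2 * i) k r * mon l (cnj_mat g *v grid_pt (2 * i)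
        r))" for l
    have "act g (qcoeff i k) = (\<Sum>r\<in>grid (2 * i). \<Sum>l\<in>expos (2 * i).
        cscale (grid_char (2 * i) k r * mon l (cnj_mat g *v grid_pt (2 * i) r)) (qcoeff i l))"
      unfolding qcoeff_def[of i k] act_sum act_linear act_qpow[OF g]
      by (subst qpow_expand) (simp only: cfun.scale_sum_right cfun.scale_scale)
    also have "\<dots> = (\<Sum>l\<in>expos (2 * i). cscale (d l) (qcoeff i l))"
      unfolding d_def by (subst sum.swap) (simp only: cfun.scale_sum_left)
    finally have eq: "act g (qcoeff i k) = (\<Sum>l\<in>expos (2 * i). cscale (d l) (qcoeff i l))" .
    let ?l = "\<lambda>j. if j = a then 2 * i else 0"
    have "act g (qcoeff i k) \<in> U" using U g kU by (auto simp: invariant_subspace_def)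
    then have lU: "cscale (d ?l) (qcoeff i ?l) \<in> U"
      using invariant_component[OF _ _ eq unit_expos[of a "2 * i"]] U by blast
    obtain m :: "('m \<Rightarrow> nat) \<Rightarrow> real" where m: "\<And>k. k \<in> expos (2 * i) \<Longrightarrow> 0 < m k"
      "\<And>u :: complex^'m. (\<Sum>i\<in>UNIV. u $ i) ^ (2 * i) = (\<Sum>k\<in>expos (2 * i). complex_of_real (m k) * mon k u)"
      using sum_powers_positive[of "2 * i"] by blast
    have ml: "mon ?l v = (v $ a) ^ (2 * i)" for v :: "complex^'m"
      by (simp add: mon_def if_distrib[of "\<lambda>n. _ ^ n"] cong: if_cong)
    have "d ?l = (\<Sum>r\<in>grid (2 * i). grid_char (2 * i) k r *
        (c ^ (2 * i) * (\<Sum>l\<in>expos (2 * i). complex_of_real (m l) * mon l (grid_pt (2 * i) r))))"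
      by (simp only: d_def ml ga power_mult_distrib m(2))
    also have "\<dots> = (\<Sum>r\<in>grid (2 * i). \<Sum>l\<in>expos (2 * i). c ^ (2 * i) * complex_of_real (m l) *
        (grid_char (2 * i) k r * mon l (grid_pt (2 * i) r)))"
      by (simp only: sum_distrib_left) (simp add: mult_ac)
    also have "\<dots> = (\<Sum>l\<in>expos (2 * i). c ^ (2 * i) * complex_of_real (m l) *
        (\<Sum>r\<in>grid (2 * i). grid_char (2 * i) k r * mon l (grid_pt (2 * i) r)))"
      by (subst sum.swap) (simp only: sum_distrib_left)
    also have "\<dots> = (\<Sum>l\<in>expos (2 * i). if k = l then c ^ (2 * i) * complex_of_real (m l) else 0)"
      using k by (intro sum.cong) (auto simp: grid_filter)
    also have "\<dots> = c ^ (2 * i) * complex_of_real (m k)" using k by simp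
    finally have "d ?l \<noteq> 0" using c m(1)[OF k(1)] by simp
    moreover have "cscale (1 / d ?l) (cscale (d ?l) (qcoeff i ?l)) \<in> U"
      using lU by (rule cfun.subspace_scale[OF sub])
    ultimately have "qpow i (axis a 1) \<in> U" by (simp add: cfun.scale_scale qcoeff_axis)
    then have "qspace i \<subseteq> U" using qspace_least U by blast
    then show ?thesis using U by blast
  qed simp
qed

section \<open>Weights of the spaces \<open>qspace i\<close>\<close>

lemma powi_eq_imp_eq:
  assumes "\<And>z :: complex. norm z = 1 \<Longrightarrow> z powi a = z powi b" shows "a = b"
proof (rule ccontr)
  assume "a \<noteq> b"
  have "fourier_coeff (\<lambda>z. z powi a) a = fourier_coeff (\<lambda>z. z powi b) a"
    by (rule fourier_coeff_cong) (rule assms)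
  then show False using \<open>a \<noteq> b\<close> by (simp add: fourier_coeff_powi)
qed

lemma weight_vec_unique:
  fixes f :: "complex^'m^'m \<Rightarrow> complex"
  assumes "weight_vec \<mu> f" "weight_vec \<nu> f" "f \<noteq> 0" shows "\<mu> = \<nu>"
proof
  fix j
  have *: "act (circ j z) f = cscale (z powi \<mu> j) f" if "norm z = 1" "weight_vec \<mu> f" for z \<mu>
  proof -
    let ?t = "\<lambda>i. if i = j then z else 1"
    have "torus_elt ?t" using that by (simp add: torus_elt_def)
    then have "act (diag_mat ?t) f = cscale (\<Prod>i\<in>UNIV. ?t i powi \<mu> i) f"
      using that by (simp only: weight_vec_def)
    also have "(\<Prod>i\<in>UNIV. ?t i powi \<mu> i) = (\<Prod>i\<in>UNIV. if i = j then z powi \<mu> j else 1)"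
      by (intro prod.cong) auto
    finally show ?thesis by (simp add: circ_def)
  qed
  show "\<mu> j = \<nu> j"
  proof (rule powi_eq_imp_eq)
    fix z :: complex assume "norm z = 1"
    then have "cscale (z powi \<mu> j) f = cscale (z powi \<nu> j) f" using * assms by metis
    then show "z powi \<mu> j = z powi \<nu> j" using assms(3) by (metis cfun.scale_right_imp_eq)
  qed
qed

lemma qcoeff_weight:
  assumes "k \<in> expos (2 * i)" shows "weight_vec (\<lambda>j. - int (k j)) (qcoeff i k)"
  unfolding weight_vec_def
proof (intro allI impI)
  fix t :: "'a \<Rightarrow> complex" assume t: "torus_elt t"
  have "cnj (t j) ^ k j = t j powi (- int (k j))" for j
  proof -
    have "norm (t j) = 1" using t by (simp add: torus_elt_def)
    then have "cnj (t j) = inverse (t j)"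
      using cnj_mult_norm_1 by (metis inverse_unique mult.commute)
    then show ?thesis by (simp add: power_int_minus power_inverse)
  qed
  then have "mon k (\<chi> j. cnj (t j)) = (\<Prod>j\<in>UNIV. t j powi (- int (k j)))" by (simp add: mon_def)
  then show "act (diag_mat t) (qcoeff i k) = cscale (\<Prod>j\<in>UNIV. t j powi (- int (k j))) (qcoeff i k)"
    using act_qcoeff[OF t assms] by simp
qed

text \<open>The averaging that isolates a component multiplies the weight vector \<open>f\<close> by
  a scalar, so a nonzero component is proportional to \<open>f\<close> and shares its
  weight.\<close>

lemma qspace_weights:
  assumes "is_weight (qspace i) \<mu>"
  obtains k where "k \<in> expos (2 * i)" "\<mu> = (\<lambda>j. - int (k j))"
proof -
  obtain f where f: "f \<in> qspace i" "f \<noteq> 0" "weight_vec \<mu> f" using assms by (auto simp: is_weight_iff)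
  then obtain b where b: "f = (\<Sum>k\<in>expos (2 * i). cscale (b k) (qcoeff i k))"
    using span_image_sum[OF finite_expos] unfolding qspace_alt by blast
  obtain k where k: "k \<in> expos (2 * i)" "cscale (b k) (qcoeff i k) \<noteq> 0"
    using f(2) sum.neutral[of "expos (2 * i)" "\<lambda>k. cscale (b k) (qcoeff i k)"] unfolding b by blast
  have "cscale (b k) (qcoeff i k) = (\<Sum>r\<in>grid (2 * i). cscale (grid_char (2 * i) k r)
     (cscale (\<Prod>j\<in>UNIV. cnj (grid_pt (2 * i) r $ j) powi \<mu> j) f))"
    unfolding qspace_component[OF b k(1)]
    using f(3) by (intro sum.cong) (auto simp: weight_vec_def torus_elt_def norm_grid_pt)
  also have "\<dots> = cscale (\<Sum>r\<in>grid (2 * i). grid_char (2 * i) k r *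
      (\<Prod>j\<in>UNIV. cnj (grid_pt (2 * i) r $ j) powi \<mu> j)) f"
    by (simp only: cfun.scale_scale cfun.scale_sum_left)
  finally obtain c where c: "cscale (b k) (qcoeff i k) = cscale c f" by blast
  have scal: "weight_vec \<nu> (cscale c f)" if "weight_vec \<nu> f" for \<nu> c and f :: "complex^'a^'a \<Rightarrow> complex"
    using that by (simp add: weight_vec_def act_linear cfun.scale_scale mult.commute)
  have "weight_vec \<mu> (cscale (b k) (qcoeff i k))" unfolding c by (rule scal[OF f(3)])
  moreover have "weight_vec (\<lambda>j. - int (k j)) (cscale (b k) (qcoeff i k))"
    by (rule scal[OF qcoeff_weight[OF k(1)]])
  ultimately show thesis using that k weight_vec_unique by blast
qed

lemma qspace_highest_weight:
  "has_highest_weight (qspace i :: (complex^('m::{finite,linorder})^('m::{finite,linorder}) \<Rightarrow> complex)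
      set) (last_weight (- 2 * int i))"
  unfolding has_highest_weight_def
proof (intro conjI allI impI)
  let ?N = "Max (UNIV :: 'm set)"
  have "qpow i (axis ?N 1) (mat 1) = 1"
    by (simp add: qpow_def quad_form_def axis_def if_distrib[of "\<lambda>c. c * _"] cong: if_cong)
  then have "qpow i (axis ?N 1) \<noteq> 0" by (metis zero_fun_apply zero_neq_one)
  moreover have "qpow i (axis ?N 1) \<in> qspace i" unfolding qspace_def by (intro cfun.span_base) simp
  moreover have "weight_vec (last_weight (- 2 * int i)) (qpow i (axis ?N 1))"
  proof -
    have "(\<lambda>j. - int (if j = ?N then 2 * i else 0)) = last_weight (- 2 * int i)"
      by (auto simp: last_weight_def)
    then show ?thesis using qcoeff_weight[OF unit_expos[of ?N "2 * i"]] by (simp add: qcoeff_axis)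
  qed
  ultimately show "is_weight (qspace i) (last_weight (- 2 * int i) :: 'm \<Rightarrow> int)"
    unfolding is_weight_iff by blast
  fix \<mu> :: "'m \<Rightarrow> int" assume "is_weight (qspace i) \<mu>"
  then obtain k where k: "k \<in> expos (2 * i)" "\<mu> = (\<lambda>j. - int (k j))" using qspace_weights by blast
  \<comment> \<open>As the \<open>k a\<close> add up to \<open>2 * i\<close>, the highest weight
    minus \<open>\<mu>\<close> is the sum of \<open>k a\<close> times \<open>e_a - e_N\<close> over
    \<open>a < N\<close>.\<close>
  define c :: "'m \<Rightarrow> 'm \<Rightarrow> nat" where "c a b = (if b = ?N then k a else 0)" for a b
  have leN: "a \<le> ?N" for a :: 'm by simp
  have "last_weight (- 2 * int i) a - \<mu> a = (\<Sum>j | a < j. int (c a j)) - (\<Sum>j | j < a. int (c j a))" for a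
  proof (cases "a = ?N")
    case True
    have "{j. a < j} = {}" using leN True by (auto simp: not_less)
    then have e1: "(\<Sum>j | a < j. int (c a j)) = 0" by (simp only: sum.empty)
    have e2: "(\<Sum>j | j < a. int (c j a)) = (\<Sum>j\<in>UNIV - {?N}. int (k j))"
      using True leN by (intro sum.cong) (auto simp: c_def less_le)
    moreover have "int (2 * i) = int (k ?N) + (\<Sum>j\<in>UNIV - {?N}. int (k j))"
      using k(1) sum.remove[of UNIV ?N "\<lambda>j. int (k j)"] by (simp add: expos_def of_nat_sum[symmetric]
          del: of_nat_sum)
    ultimately show ?thesis unfolding e1 e2 using True k(2) by (simp add: last_weight_def)
  next
    case False
    then have "a < ?N" using leN by (simp add: less_le)
    then have "(\<Sum>j | a < j. int (c a j)) = (\<Sum>j\<in>{?N}. int (c a j))"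
      by (intro sum.mono_neutral_right) (auto simp: c_def)
    moreover have "(\<Sum>j | j < a. int (c j a)) = 0" using False by (simp add: c_def)
    ultimately show ?thesis using False k(2) by (simp add: last_weight_def c_def)
  qed
  then show "\<exists>c :: 'm \<Rightarrow> 'm \<Rightarrow> nat. \<forall>a. last_weight (- 2 * int i) a - \<mu> a =
      (\<Sum>j | a < j. int (c a j)) - (\<Sum>j | j < a. int (c j a))" by blast
qed

subsection \<open>Uniqueness of the irreducible subspace with a given extreme weight\<close>

lemma circ_eq_refl: "circ j z = refl_mat (axis j 1) z"
  using refl_mat_conj_diag[of "mat 1" j "axis j 1" z] by (simp add: circ_def)

lemma circ_commute:
  assumes k: "k \<in> unitary_group" "k *v axis j 1 = axis j 1"
  shows "k ** circ j z = circ j z ** k"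
proof -
  have "circ j z = k ** circ j z ** adj k"
    using refl_mat_conj_diag[OF k, of z] by (simp add: circ_eq_refl[symmetric]) (simp add: circ_def)
  then have "circ j z ** k = k ** circ j z ** (adj k ** k)" by (metis matrix_mul_assoc)
  then show ?thesis using k by (simp add: unitaryD)
qed

lemma circ_conj_nth: "(circ j z ** s ** circ j z) $ j $ j = z\<^sup>2 * s $ j $ j"
  unfolding circ_def diag_mat_conj_nth by (simp add: power2_eq_square)

lemma transpose_circ: "transpose (circ j z) = circ j z"
  by (simp add: circ_def transpose_diag_mat)

lemma adj_circ: "adj (circ j z) = circ j (cnj z)" "cnj_mat (circ j z) = circ j (cnj z)"
  unfolding circ_def by (auto simp: adj_diag_mat vec_eq_iff diag_mat_nth intro!: arg_cong[of _ _ diag_mat])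

lemma act_circ: "norm z = 1 \<Longrightarrow> act (circ j z) f s = f (circ j (cnj z) ** s ** circ j (cnj z))"
  by (simp add: act_apply adj_circ)

lemma weight_vec_circ:
  fixes f :: "complex^'m^'m \<Rightarrow> complex"
  assumes "weight_vec \<mu> f" "norm z = 1"
  shows "act (circ j z) f = cscale (z powi \<mu> j) f"
proof -
  let ?t = "\<lambda>i. if i = j then z else 1"
  have "torus_elt ?t" using assms by (simp add: torus_elt_def)
  then have "act (diag_mat ?t) f = cscale (\<Prod>i\<in>UNIV. ?t i powi \<mu> i) f"
    using assms by (simp only: weight_vec_def)
  also have "(\<Prod>i\<in>UNIV. ?t i powi \<mu> i) = (\<Prod>i\<in>UNIV. if i = j then z powi \<mu> j else 1)"
    by (intro prod.cong) auto
  finally show ?thesis by (simp add: circ_def)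
qed

definition swap_mat :: "('m \<Rightarrow> 'm) \<Rightarrow> complex^'m^'m" where
  "swap_mat p = (\<chi> i j. if j = p i then 1 else 0)"

text \<open>The action of the Weyl group on weights. The map \<open>p\<close> is an involution, as a
  transposition is enough to bring a given index to the first place.\<close>

lemma weight_vec_permute:
  fixes f :: "complex^'m^'m \<Rightarrow> complex"
  assumes p: "\<And>i. p (p i) = i" and f: "weight_vec \<mu> f"
  shows "swap_mat p \<in> unitary_group" "weight_vec (\<lambda>i. \<mu> (p i)) (act (swap_mat p) f)"
proof -
  have bij: "bij p" using p by (metis bij_betw_byWitness UNIV_I subsetI)
  have eq: "j = p i \<longleftrightarrow> i = p j" for i j using p by metis
  show u: "swap_mat p \<in> unitary_group"
  proof (rule unitaryI)
    have "(adj (swap_mat p) ** swap_mat p) $ i $ j = (\<Sum>k\<in>UNIV. if k = p i then (if j = i then 1 else 0)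
        else 0)" for i j
      unfolding matrix_mult_nth by (intro sum.cong) (auto simp: swap_mat_def p)
    then show "adj (swap_mat p) ** swap_mat p = mat 1" by (auto simp: vec_eq_iff mat_nth)
  qed
  show "weight_vec (\<lambda>i. \<mu> (p i)) (act (swap_mat p) f)"
    unfolding weight_vec_def
  proof (intro allI impI)
    fix t :: "'m \<Rightarrow> complex" assume t: "torus_elt t"
    then have t': "torus_elt (\<lambda>i. t (p i))" by (simp add: torus_elt_def)
    have "diag_mat t ** swap_mat p = swap_mat p ** diag_mat (\<lambda>i. t (p i))"
    proof -
      have "(diag_mat t ** swap_mat p) $ i $ j = (if j = p i then t i else 0)" for i j
        by (simp add: matrix_mult_nth diag_mat_nth swap_mat_def if_distrib[of "\<lambda>c. c * _"] cong: if_cong)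
      moreover have "(swap_mat p ** diag_mat (\<lambda>i. t (p i))) $ i $ j = (if j = p i then t i else 0)" for i j
      proof -
        have "(swap_mat p ** diag_mat (\<lambda>i. t (p i))) $ i $ j = (\<Sum>k\<in>UNIV. if k = p i then (if j = p i
            then t i else 0) else 0)"
          unfolding matrix_mult_nth by (intro sum.cong) (auto simp: swap_mat_def diag_mat_nth p)
        then show ?thesis by simp
      qed
      ultimately show ?thesis by (simp add: vec_eq_iff)
    qed
    then have "act (diag_mat t) (act (swap_mat p) f) = act (swap_mat p) (act (diag_mat (\<lambda>i. t (p i))) f)"
      using t t' u by (simp add: act_mult)
    also have "act (diag_mat (\<lambda>i. t (p i))) f = cscale (\<Prod>i\<in>UNIV. t (p i) powi \<mu> i) f"
      using f t' by (simp only: weight_vec_def)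
    also have "(\<Prod>i\<in>UNIV. t (p i) powi \<mu> i) = (\<Prod>i\<in>UNIV. t i powi \<mu> (p i))"
      by (rule prod.reindex_bij_witness[of _ p p]) (auto simp: p)
    finally show "act (diag_mat t) (act (swap_mat p) f) =
        cscale (\<Prod>i\<in>UNIV. t i powi \<mu> (p i)) (act (swap_mat p) f)"
      by (simp only: act_linear)
  qed
qed

text \<open>Writing \<open>s = g g^t\<close>, the entry \<open>s_aa\<close> is the sum of the
  squares of row \<open>a\<close> of \<open>g\<close>. Unit rows with equal sums of squares are
  joined by a real orthogonal \<open>o1\<close>. Then \<open>h = g' o1 g^-1\<close> carries
  \<open>s\<close> to \<open>s'\<close>, because \<open>o1 o1^t = 1\<close>, and the transpose of
  \<open>h\<close> fixes the axis \<open>a\<close>.\<close>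

lemma sym_unitary_orbit:
  assumes s: "s \<in> sym_unitary" "s' \<in> sym_unitary" and eq: "s $ a $ a = s' $ a $ a"
  obtains u where "u \<in> unitary_group" "u *v axis a 1 = axis a 1" "s' = adj u ** s ** cnj_mat u"
proof -
  obtain g where g: "g \<in> unitary_group" "s = g ** transpose g" using sym_unitary_transitive[OF s(1)] .
  obtain g' where g': "g' \<in> unitary_group" "s' = g' ** transpose g'" using sym_unitary_transitive[OF s(2)] .
  define r where "r = transpose g *v axis a 1"
  define r' where "r' = transpose g' *v axis a 1"
  have rn: "r $ i = g $ a $ i" "r' $ i = g' $ a $ i" for i
    unfolding r_def r'_def matrix_vec_axis by (simp_all add: transpose_nth)
  have "herm r r = herm r' r'"
    unfolding r_def r'_def herm_unitary[OF unitary_transpose[OF g(1)]] herm_unitary[OF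
        unitary_transpose[OF g'(1)]] ..
  moreover have "(\<Sum>i\<in>UNIV. r $ i * r $ i) = (\<Sum>i\<in>UNIV. r' $ i * r' $ i)"
    using eq unfolding g(2) g'(2) matrix_mult_nth transpose_nth rn .
  ultimately obtain o1 where o: "o1 \<in> unitary_group" "\<forall>i j. Im (o1 $ i $ j) = 0" "o1 *v r = r'"
    using real_unitary_transitive[of r r'] by blast
  have oc: "cnj_mat o1 = o1" using o(2) by (simp add: vec_eq_iff complex_eq_iff)
  then have ot: "transpose o1 = adj o1" by (simp add: adj_def)
  define h where "h = g' ** o1 ** adj g"
  have h: "h \<in> unitary_group" by (simp add: h_def g g' o)
  have gg: "transpose g ** cnj_mat g = mat 1" "cnj_mat g ** transpose g = mat 1"
    using unitaryD[OF unitary_cnj[OF g(1)]] by (simp_all add: transpose_adj)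
  have ht: "transpose h = cnj_mat g ** adj o1 ** transpose g'"
    by (simp add: h_def matrix_transpose_mul transpose_adj ot matrix_mul_assoc)
  have "h ** s ** transpose h = g' ** o1 ** (adj g ** g) ** (transpose g ** cnj_mat g) ** adj o1 **
      transpose g'"
    unfolding ht unfolding g(2) h_def by (simp only: matrix_mul_assoc)
  also have "\<dots> = g' ** (o1 ** adj o1) ** transpose g'"
    by (simp only: gg unitaryD[OF g(1)] matrix_mul_rid matrix_mul_assoc)
  also have "\<dots> = s'" by (simp add: unitaryD[OF o(1)] g'(2))
  finally have hs: "h ** s ** transpose h = s'" .
  have "transpose h *v axis a 1 = cnj_mat g *v (adj o1 *v r')"
    unfolding ht r'_def by (simp only: matrix_vector_mul_assoc matrix_mul_assoc)
  also have "adj o1 *v r' = r"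
    unfolding o(3)[symmetric] by (simp add: matrix_vector_mul_assoc unitaryD[OF o(1)])
  also have "cnj_mat g *v r = axis a 1"
    unfolding r_def by (simp only: matrix_vector_mul_assoc gg matrix_vector_mul_lid)
  finally have "(transpose h *v axis a 1) $ i = axis a 1 $ i" for i by simp
  then have "(adj h *v axis a 1) $ i = axis a 1 $ i" for i
    unfolding matrix_vec_axis by (auto simp: transpose_nth axis_def complex_eq_iff split: if_splits)
  then have "adj h *v axis a 1 = axis a 1" by (simp add: vec_eq_iff)
  then show thesis using that[of "adj h"] h hs by (simp add: transpose_adj)
qed

lemma poly_eq_on_circle:
  fixes p q :: "complex poly"
  assumes "\<And>z. norm z = 1 \<Longrightarrow> poly p z = poly q z" shows "p = q"
proof (rule ccontr)
  assume "p \<noteq> q"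
  then have "finite {z. poly (p - q) z = 0}" by (intro poly_roots_finite) simp
  then have "finite (cis ` {0<..<pi})" by (rule rev_finite_subset) (use assms in auto)
  moreover have "inj_on cis {0<..<pi}"
  proof (rule inj_onI)
    fix x y assume "x \<in> {0<..<pi}" "y \<in> {0<..<pi}" "cis x = cis y"
    then show "x = y" using cos_inj_pi[of x y] by (simp add: complex_eq_iff)
  qed
  ultimately have "finite {0<..<pi}" using finite_imageD by blast
  then show False using infinite_Ioo[of 0 pi] by simp
qed

text \<open>
  A vector of weight \<open>(0,\<dots>,0,-2i)\<close> is invariant under the stabilizer of the last basis vector, hence
  a function of the last diagonal entry \<open>c\<close> of \<open>s\<close>. Its values at \<open>c = a z\<^sup>2 + 1 - a\<close>, \<open>|z| = 1\<close>, come from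
  conjugates of a one-dimensional torus and form a polynomial in \<open>z\<close> of degree at most \<open>2i\<close>;
  comparing \<open>c\<close> with its conjugate then forces divisibility by \<open>(a z\<^sup>2 + 1 - a)\<^sup>i\<close>.
\<close>

locale extreme_irreducible = fin_dim_invariant V B
  for V B :: "(complex^('m::{finite,linorder})^('m::{finite,linorder}) \<Rightarrow> complex) set" +
  fixes i :: nat and N :: 'm
  assumes hw: "has_highest_weight V (last_weight (- 2 * int i))"
    and irr: "irreducible_subspace V"
    and card: "2 \<le> CARD('m)"
  defines "N \<equiv> Max UNIV"
begin

definition M where "M = Min (UNIV :: 'm set)"

lemma M_N: "M \<noteq> N"
proof
  assume "M = N"
  have "x \<le> N" "M \<le> x" for x by (simp_all add: M_def N_def)
  then have "x = N" for x using \<open>M = N\<close> by (metis antisym)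
  then have "(UNIV :: 'm set) = {N}" by auto
  then have "CARD('m) = card {N}" by (rule arg_cong)
  then show False using card by simp
qed

text \<open>Positive roots have coordinate sum \<open>0\<close>, so every weight has the sum of the
  highest one.\<close>

lemma weight_sum:
  assumes "is_weight V \<mu>" shows "(\<Sum>k\<in>UNIV. \<mu> k) = - 2 * int i"
proof -
  obtain c :: "'m \<Rightarrow> 'm \<Rightarrow> nat" where c: "\<And>k. last_weight (- 2 * int i) k - \<mu> k =
      (\<Sum>j | k < j. int (c k j)) - (\<Sum>j | j < k. int (c j k))"
    using hw assms unfolding has_highest_weight_def by metis
  have "(\<Sum>k\<in>UNIV. \<Sum>j | k < j. int (c k j)) = (\<Sum>j\<in>UNIV. \<Sum>k | k < j. int (c k j))"
    using sum.swap_restrict[of UNIV UNIV "\<lambda>k j. int (c k j)" "(<)"] by simp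
  then have "(\<Sum>k\<in>UNIV. last_weight (- 2 * int i) k - \<mu> k) = 0"
    unfolding c sum_subtractf by simp
  then show ?thesis by (simp add: sum_subtractf last_weight_def)
qed

text \<open>No index precedes \<open>M\<close>, so positive roots contribute nonnegatively there,
  while the highest weight is \<open>0\<close> at \<open>M\<close>.\<close>

lemma weight_first_nonpos:
  assumes "is_weight V \<mu>" shows "\<mu> M \<le> 0"
proof -
  obtain c :: "'m \<Rightarrow> 'm \<Rightarrow> nat" where c: "\<And>k. last_weight (- 2 * int i) k - \<mu> k =
      (\<Sum>j | k < j. int (c k j)) - (\<Sum>j | j < k. int (c j k))"
    using hw assms unfolding has_highest_weight_def by metis
  have "{j. j < M} = {}" by (auto simp: M_def not_less)
  then have "(\<Sum>j | j < M. int (c j M)) = 0" by (simp only: sum.empty)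
  moreover have "0 \<le> (\<Sum>j | M < j. int (c M j))" by (intro sum_nonneg) simp
  ultimately show ?thesis using c[of M] M_N by (simp add: last_weight_def N_def)
qed

text \<open>The transposition of \<open>j\<close> and \<open>M\<close> brings the coordinate at
  \<open>j\<close> to the first place.\<close>

lemma weight_nonpos:
  assumes "is_weight V \<mu>" shows "\<mu> j \<le> 0"
proof -
  obtain f where f: "f \<in> V" "f \<noteq> 0" "weight_vec \<mu> f" using assms by (auto simp: is_weight_iff)
  define p where "p x = (if x = M then j else if x = j then M else x)" for x
  have p: "p (p x) = x" for x by (simp add: p_def)
  note w = weight_vec_permute[OF p f(3)]
  have "act (swap_mat p) f \<noteq> 0"
  proof
    assume "act (swap_mat p) f = 0"
    then have "act (adj (swap_mat p) ** swap_mat p) f = 0"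
      using w(1) by (simp add: act_mult[symmetric] act_linear)
    then show False using f(2) w(1) by (simp add: unitaryD)
  qed
  then have "is_weight V (\<lambda>i. \<mu> (p i))"
    unfolding is_weight_iff using V_act[OF w(1) f(1)] w(2) by blast
  from weight_first_nonpos[OF this] show ?thesis by (simp add: p_def)
qed

lemma weight_extreme:
  assumes "is_weight V \<mu>" "\<mu> N = - 2 * int i" shows "\<mu> = last_weight (- 2 * int i)"
proof
  fix k
  have "(\<Sum>k\<in>UNIV - {N}. - \<mu> k) = 0"
    using weight_sum[OF assms(1)] assms(2) sum.remove[of UNIV N \<mu>] by (simp add: sum_negf)
  then have "\<forall>k\<in>UNIV - {N}. - \<mu> k = 0"
    using weight_nonpos[OF assms(1)] by (subst (asm) sum_nonneg_eq_0_iff) auto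
  then show "\<mu> k = last_weight (- 2 * int i) k" using assms(2) by (auto simp: last_weight_def N_def)
qed

lemma weight_lower: "is_weight V \<mu> \<Longrightarrow> - 2 * int i \<le> \<mu> k"
proof -
  assume w: "is_weight V \<mu>"
  have "(\<Sum>j\<in>UNIV - {k}. \<mu> j) \<le> 0" using weight_nonpos[OF w] by (intro sum_nonpos) auto
  then show ?thesis using weight_sum[OF w] sum.remove[of UNIV k \<mu>] by simp
qed

text \<open>Among the weights of \<open>V\<close>, the value \<open>-2i\<close> at \<open>N\<close>
  occurs only for the extreme weight, so the circle at \<open>N\<close> alone detects it.\<close>

lemma extreme_weight_vec:
  assumes h: "h \<in> V" and w: "\<And>z. norm z = 1 \<Longrightarrow> act (circ N z) h = cscale (z powi (- 2 * int i)) h"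
  shows "weight_vec (last_weight (- 2 * int i)) h"
proof -
  let ?\<nu> = "last_weight (- 2 * int i) :: 'm \<Rightarrow> int"
  \<comment> \<open>The claim for the projection of an arbitrary member of \<open>V\<close>: a
    linear condition, which can be tested on weight vectors. The given \<open>h\<close> is its own
    projection.\<close>
  define W where "W = {x \<in> V. weight_vec ?\<nu> (wproj N (- 2 * int i) x)}"
  have wv0: "weight_vec \<mu> 0" for \<mu> :: "'m \<Rightarrow> int" by (simp only: weight_vec_def act_linear
      cfun.scale_zero_right) simp
  have "cfun.subspace W"
    unfolding cfun.subspace_def
  proof (intro conjI ballI allI)
    show "0 \<in> W" using cfun.subspace_0[OF V_sub] wv0 by (simp add: W_def)
  next
    fix x y assume "x \<in> W" "y \<in> W"
    then show "x + y \<in> W"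
      using cfun.subspace_add[OF V_sub]
      by (auto simp: W_def wproj_add V_cont weight_vec_def act_linear cfun.scale_right_distrib simp del:
          plus_fun_apply)
  next
    fix c x assume "x \<in> W"
    then show "cscale c x \<in> W"
      using cfun.subspace_scale[OF V_sub]
      by (auto simp: W_def wproj_scale weight_vec_def act_linear cfun.scale_scale mult.commute)
  qed
  moreover have "{x \<in> V. \<exists>\<mu>. weight_vec \<mu> x} \<subseteq> W"
  proof clarify
    fix x \<mu> assume x: "x \<in> V" "weight_vec \<mu> x"
    have "wproj N (- 2 * int i) x = (if - 2 * int i = \<mu> N then x else 0)"
      by (rule wproj_of_weight) (rule weight_vec_circ[OF x(2)])
    moreover have "weight_vec ?\<nu> x" if "- 2 * int i = \<mu> N"
    proof (cases "x = 0")
      case False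
      then have "is_weight V \<mu>" using x by (auto simp: is_weight_iff)
      then show ?thesis using weight_extreme that x by metis
    qed (simp only: wv0)
    ultimately show "x \<in> W" using x wv0 by (auto simp: W_def)
  qed
  ultimately have "cfun.span {x \<in> V. \<exists>\<mu>. weight_vec \<mu> x} \<subseteq> W" by (rule cfun.span_minimal[rotated])
  then have "h \<in> W" using weight_decomp[OF h] by blast
  moreover have "wproj N (- 2 * int i) h = h" using wproj_of_weight[OF w, of "- 2 * int i"] by simp
  ultimately show ?thesis by (simp add: W_def)
qed

text \<open>The action multiplies \<open>s\<close> from both sides, which produces
  \<open>z^2\<close>. A weight vector restricts to a multiple of \<open>z ^ n\<close> with
  \<open>n = - \<mu> M\<close>, and the bounds on weights put \<open>n\<close> between
  \<open>0\<close> and \<open>2 * i\<close>.\<close>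

lemma circle_polynomial:
  assumes "h \<in> V"
  obtains p :: "complex poly" where "degree p \<le> 2 * i"
    "\<And>z. norm z = 1 \<Longrightarrow> h (circ M (z\<^sup>2)) = poly p z"
proof -
  define W where "W = {x \<in> V. \<exists>p :: complex poly. degree p \<le> 2 * i \<and>
     (\<forall>z. norm z = 1 \<longrightarrow> x (circ M (z\<^sup>2)) = poly p z)}"
  have "cfun.subspace W"
    unfolding cfun.subspace_def
  proof (intro conjI ballI allI)
    show "0 \<in> W" using cfun.subspace_0[OF V_sub] by (auto simp: W_def intro!: exI[of _ 0])
  next
    fix x y assume "x \<in> W" "y \<in> W"
    then obtain p q :: "complex poly" where "degree p \<le> 2 * i" "\<forall>z. norm z = 1 \<longrightarrow> x (circ M (z\<^sup>2)) = poly p z"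
      "degree q \<le> 2 * i" "\<forall>z. norm z = 1 \<longrightarrow> y (circ M (z\<^sup>2)) = poly q z" "x \<in> V" "y \<in> V"
      unfolding W_def by blast
    then show "x + y \<in> W"
      using cfun.subspace_add[OF V_sub, of x y] by (auto simp: W_def intro!: exI[of _ "p + q"] degree_add_le)
  next
    fix c x assume "x \<in> W"
    then obtain p :: "complex poly" where "degree p \<le> 2 * i" "\<forall>z. norm z = 1 \<longrightarrow> x (circ M (z\<^sup>2)) = poly p
        z" "x \<in> V"
      unfolding W_def by blast
    then show "cscale c x \<in> W"
      using cfun.subspace_scale[OF V_sub, of x c]
      by (auto simp: W_def cscale_apply intro!: exI[of _ "smult c p"] order.trans[OF degree_smult_le])
  qed
  moreover have "{x \<in> V. \<exists>\<mu>. weight_vec \<mu> x} \<subseteq> W"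
  proof clarify
    fix x \<mu> assume x: "x \<in> V" "weight_vec \<mu> x"
    show "x \<in> W"
    proof (cases "x = 0")
      case True
      then show ?thesis using cfun.subspace_0[OF V_sub] by (auto simp: W_def intro!: exI[of _ 0])
    next
      case False
      then have w: "is_weight V \<mu>" using x by (auto simp: is_weight_iff)
      define n where "n = nat (- \<mu> M)"
      have n: "\<mu> M = - int n" "n \<le> 2 * i"
        using weight_nonpos[OF w, of M] weight_lower[OF w, of M] by (auto simp: n_def)
      have "x (circ M (z\<^sup>2)) = poly (smult (x (mat 1)) (monom 1 n)) z" if z: "norm z = 1" for z
      proof -
        have "x (circ M (z\<^sup>2)) = act (circ M (cnj z)) x (mat 1)"
          using z by (simp add: act_circ circ_mult power2_eq_square)
        also have "\<dots> = cnj z powi \<mu> M * x (mat 1)"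
          using weight_vec_circ[OF x(2), of "cnj z" M] z by (simp add: cscale_apply)
        also have "cnj z powi \<mu> M = z ^ n"
        proof -
          have "inverse (cnj z) = z" using cnj_mult_norm_1[OF z] by (metis inverse_unique)
          then show ?thesis by (simp add: n power_int_minus power_inverse[symmetric])
        qed
        finally show ?thesis by (simp add: poly_monom)
      qed
      moreover have "degree (smult (x (mat 1)) (monom 1 n)) \<le> 2 * i"
        using n(2) by (intro order.trans[OF degree_smult_le] order.trans[OF degree_monom_le])
      ultimately show ?thesis using x(1) unfolding W_def by blast
    qed
  qed
  ultimately have "cfun.span {x \<in> V. \<exists>\<mu>. weight_vec \<mu> x} \<subseteq> W" by (rule cfun.span_minimal[rotated])
  then have "h \<in> W" using weight_decomp[OF assms] by blast
  then show thesis using that unfolding W_def by blast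
qed

definition f0 where "f0 = (SOME f. f \<in> V \<and> f \<noteq> 0 \<and> weight_vec (last_weight (- 2 * int i)) f)"

lemma f0: "f0 \<in> V" "f0 \<noteq> 0" "weight_vec (last_weight (- 2 * int i)) f0"
proof -
  have "\<exists>f. f \<in> V \<and> f \<noteq> 0 \<and> weight_vec (last_weight (- 2 * int i)) f"
    using hw unfolding has_highest_weight_def is_weight_iff by blast
  from someI_ex[OF this] show "f0 \<in> V" "f0 \<noteq> 0" "weight_vec (last_weight (- 2 * int i)) f0"
    by (auto simp: f0_def)
qed

lemma f0_circ: "norm z = 1 \<Longrightarrow> act (circ N z) f0 = cscale (z powi (- 2 * int i)) f0"
  using weight_vec_circ[OF f0(3), of z N] by (simp add: last_weight_def N_def)

text \<open>A reflection that fixes \<open>axis N 1\<close> is conjugate to the circle at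
  \<open>M\<close> by some \<open>k\<close> that also fixes it. Since \<open>k\<close> commutes with
  the circle at \<open>N\<close>, the translate \<open>act (adj k) f0\<close> keeps the coordinate
  \<open>-2i\<close> at \<open>N\<close>; this forces the extreme weight, which is \<open>0\<close>
  at \<open>M\<close>.\<close>

lemma f0_stabilizer:
  assumes "u \<in> unitary_group" "u *v axis N 1 = axis N 1"
  shows "act u f0 = f0"
proof -
  have "u \<in> unitary_group" "\<forall>j\<in>{N}. u *v axis j 1 = axis j 1" using assms by auto
  then show ?thesis
  proof (induction rule: unitary_refl_induct)
    case (refl u w l)
    have "M \<notin> {N}" using M_N by simp
    then obtain k where k: "k \<in> unitary_group" "k *v axis M 1 = w" "\<forall>j\<in>{N}. k *v axis j 1 = axis j 1"
      using unitary_extend[OF refl(3) refl(5)] by metis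
    have r: "refl_mat w l = k ** circ M l ** adj k"
      using refl_mat_conj_diag[OF k(1,2), of l] by (simp add: circ_def)
    have "adj k *v axis N 1 = adj k *v (k *v axis N 1)" using k by simp
    then have kN: "adj k *v axis N 1 = axis N 1" by (simp only: matrix_vector_mul_assoc unitaryD[OF
        k(1)] matrix_vector_mul_lid)
    define h where "h = act (adj k) f0"
    have hV: "h \<in> V" unfolding h_def by (intro V_act f0) (simp add: k)
    have "act (circ N z) h = cscale (z powi (- 2 * int i)) h" if z: "norm z = 1" for z
    proof -
      have "act (circ N z) h = act (adj k) (act (circ N z) f0)"
        using z k circ_commute[of "adj k" N z] kN by (simp add: h_def act_mult)
      then show ?thesis by (simp add: f0_circ[OF z] act_linear h_def)
    qed
    then have "weight_vec (last_weight (- 2 * int i)) h" using extreme_weight_vec[OF hV] by blast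
    then have hl: "act (circ M l) h = h"
      using weight_vec_circ[of _ h l M] refl(4) M_N by (simp add: last_weight_def N_def[symmetric]
          cfun.scale_one)
    have "act (refl_mat w l ** u) f0 = act (refl_mat w l) (act u f0)"
      using refl(1,3,4) by (simp add: act_mult refl_mat_unitary)
    also have "\<dots> = act k (act (circ M l) h)"
      using refl(6,4) k by (simp add: r h_def act_mult matrix_mul_assoc)
    also have "\<dots> = f0" unfolding hl unfolding h_def using k by (simp add: act_mult unitaryD)
    finally show ?case .
  qed simp
qed

lemma f0_depends:
  assumes "s \<in> sym_unitary" "s' \<in> sym_unitary" "s $ N $ N = s' $ N $ N"
  shows "f0 s = f0 s'"
proof -
  obtain u where u: "u \<in> unitary_group" "u *v axis N 1 = axis N 1" "s' = adj u ** s ** cnj_mat u"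
    using sym_unitary_orbit[OF assms] .
  have "act u f0 s = f0 s'" using u by (simp add: act_apply)
  then show ?thesis using f0_stabilizer[OF u(1,2)] by simp
qed

lemma f0_scale: 
  assumes "norm w = 1" shows "f0 (circ N w ** s ** circ N w) = w ^ (2 * i) * f0 s"
proof -
  have "inverse (cnj w) = w" using cnj_mult_norm_1[OF assms] by (metis inverse_unique)
  have "cnj w powi (- 2 * int i) = cnj w powi (- int (2 * i))" by simp
  also have "\<dots> = inverse (cnj w ^ (2 * i))" by (simp only: power_int_minus power_int_of_nat)
  also have "\<dots> = w ^ (2 * i)" by (simp only: power_inverse[symmetric] \<open>inverse (cnj w) = w\<close>)
  finally have "cnj w powi (- 2 * int i) = w ^ (2 * i)" .
  then show ?thesis
    using fun_cong[OF f0_circ[of "cnj w"], of s] assms by (simp add: act_circ cscale_apply)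
qed

lemma circ_sym_unitary [simp]:
  assumes "norm w = 1" "s \<in> sym_unitary" shows "circ j w ** s ** circ j w \<in> sym_unitary"
  using sym_unitary_conj[of "circ j w" s] assms by (simp add: transpose_circ)

lemma f0_real:
  assumes s: "s \<in> sym_unitary" "s $ N $ N = complex_of_real \<rho>" and \<rho>: "0 \<le> \<rho>" "\<rho> \<le> 1"
  shows "f0 s = f0 (mat 1) * complex_of_real \<rho> ^ i"
proof -
  have one: "(mat 1 :: ((complex, 'm) vec, 'm) vec) $ N $ N = 1" by (simp add: mat_nth)
  consider "\<rho> = 1" | "\<rho> = 0" "i > 0" | "\<rho> \<noteq> 1" "\<rho> \<noteq> 0 \<or> i = 0" by blast
  then show ?thesis
  proof cases
    case 1
    then show ?thesis using f0_depends[OF s(1) sym_unitary_mat_1] s(2) one by simp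
  next
    case 2
    \<comment> \<open>The circle at \<open>N\<close> leaves the entry \<open>0\<close> as it is, yet
      multiplies the value by \<open>w ^ (2 * i) = -1\<close>.\<close>
    define w where "w = cis (pi / (2 * i))"
    have w: "norm w = 1" by (simp add: w_def)
    have "w ^ (2 * i) = -1" using 2 by (simp add: w_def Complex.DeMoivre cis_pi del: power_mult)
    moreover have "f0 s = f0 (circ N w ** s ** circ N w)"
      using s w 2 by (intro f0_depends) (simp_all add: circ_conj_nth)
    ultimately have "f0 s = 0" using f0_scale[OF w, of s] by simp
    then show ?thesis using 2 by simp
  next
    case 3
    \<comment> \<open>Makes \<open>c \<i> = 1 - 2 * a\<close> equal to \<open>\<rho>\<close>: the
      point \<open>z = \<i>\<close> reaches the given entry, while \<open>z = 1\<close> gives the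
      identity.\<close>
    define a where "a = (1 - \<rho>) / 2"
    have a: "0 < a" "a \<le> 1 / 2" using \<rho> 3 by (auto simp: a_def)
    \<comment> \<open>The symmetric reflection \<open>k\<close> taking the last axis to this unit
      vector has \<open>sqrt a\<close> at \<open>(N, M)\<close>; conjugating the circle at
      \<open>M\<close> by \<open>k\<close> puts \<open>1 - (1 - z^2) * a\<close> at
      \<open>(N, N)\<close>.\<close>
    define y :: "(complex, 'm) vec" where "y = (\<chi> j. if j = M then complex_of_real (sqrt a) else if j =
        N then complex_of_real (sqrt (1 - a)) else 0)"
    have "herm (axis N 1) (axis N 1) = herm y y"
    proof -
      have "herm y y = (\<Sum>j\<in>UNIV. (if j = M then complex_of_real a else 0) + (if j = N then
          complex_of_real (1 - a) else 0))"
        unfolding herm_def using M_N a by (intro sum.cong) (auto simp: y_def of_real_mult[symmetric]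
            simp del: of_real_mult)
      then show ?thesis by (simp add: sum.distrib herm_axis)
    qed
    moreover have "\<forall>j. Im (axis N 1 $ j) = 0" "\<forall>j. Im (y $ j) = 0" by (auto simp: axis_def y_def)
    ultimately obtain k where k: "k \<in> unitary_group" "\<forall>i j. Im (k $ i $ j) = 0" "transpose k = k" "k *v
        axis N 1 = y"
      using real_reflection by metis
    have kc: "cnj_mat k = k" using k(2) by (simp add: vec_eq_iff complex_eq_iff)
    then have ka: "adj k = k" by (simp add: adj_def k(3))
    have kk: "k ** k = mat 1" using unitaryD(1)[OF k(1)] by (simp add: ka)
    have "k $ M $ N = complex_of_real (sqrt a)"
      using k(4) matrix_vec_axis[of k N M] by (simp add: y_def)
    then have kNM: "k $ N $ M = complex_of_real (sqrt a)" using k(3) by (metis transpose_nth)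
    define m where "m z = k ** circ M (z\<^sup>2) ** k" for z
    define c where "c z = complex_of_real a * z\<^sup>2 + complex_of_real (1 - a)" for z
    have mS: "m z \<in> sym_unitary" if "norm z = 1" for z
    proof -
      have "circ M (z\<^sup>2) \<in> sym_unitary" using that by (simp add: sym_unitary_iff transpose_circ norm_power)
      then show ?thesis using sym_unitary_conj[OF k(1)] by (simp add: m_def k(3))
    qed
    have mc: "m z $ N $ N = c z" for z
    proof -
      have "m z = refl_mat (k *v axis M 1) (z\<^sup>2)"
        using refl_mat_conj_diag[OF k(1) refl, of M "z\<^sup>2"] by (simp add: m_def circ_def ka)
      then have "m z $ N $ N = 1 - (1 - z\<^sup>2) * (k $ N $ M * cnj (k $ N $ M))"
        by (simp add: refl_mat_def matrix_vec_axis)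
      also have "k $ N $ M * cnj (k $ N $ M) = complex_of_real a"
        unfolding kNM using a by (simp add: of_real_mult[symmetric] del: of_real_mult)
      finally show ?thesis by (simp add: c_def algebra_simps)
    qed
    define h where "h = act k f0"
    have "h \<in> V" unfolding h_def by (intro V_act k f0)
    then obtain p where p: "degree p \<le> 2 * i" "\<And>z. norm z = 1 \<Longrightarrow> h (circ M (z\<^sup>2)) = poly p z"
      using circle_polynomial by metis
    have pm: "poly p z = f0 (m z)" if "norm z = 1" for z
      using p(2)[OF that] k(1) by (simp add: h_def act_apply m_def ka kc)
    have m1: "poly p 1 = f0 (mat 1)" by (simp add: pm m_def kk)
    have "norm \<i> = 1" by simp
    have ci: "c \<i> = complex_of_real \<rho>" by (simp add: c_def a_def complex_eq_iff)
    then have mi: "f0 s = poly p \<i>"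
      unfolding pm[OF \<open>norm \<i> = 1\<close>] using s mS[of \<i>] by (intro f0_depends) (simp_all add: mc)
    show ?thesis
    proof (cases "i = 0")
      case True
      then have "degree p = 0" using p(1) by simp
      then obtain r where "p = [:r:]" by (rule degree_eq_zeroE)
      then have "poly p \<i> = poly p 1" by simp
      then show ?thesis using True mi m1 by simp
    next
      case False
      then have \<rho>0: "\<rho> \<noteq> 0" using 3 by simp
      have cc: "c (cnj z) = cnj (c z)" for z by (simp add: c_def)
      \<comment> \<open>The points for \<open>z\<close> and \<open>cnj z\<close> have conjugate last
        entries, which differ by a phase \<open>w^2\<close>; the circle at \<open>N\<close> then
        relates the two values of \<open>f0\<close>.\<close>
      have sym: "cnj (c z) ^ i * poly p z = c z ^ i * poly p (cnj z)" if z: "norm z = 1" for z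
      proof (cases "c z = 0")
        case True
        then show ?thesis using False by simp
      next
        case cz: False
        define w where "w = csqrt (c z / cnj (c z))"
        have w2: "w\<^sup>2 = c z / cnj (c z)" by (simp add: w_def)
        then have "(norm w)\<^sup>2 = 1" using cz by (simp add: norm_power[symmetric] norm_divide)
        then have w: "norm w = 1" by (simp add: power2_eq_1_iff) (metis norm_ge_zero neg_0_le_iff_le
            not_one_le_zero)
        have "f0 (m z) = f0 (circ N w ** m (cnj z) ** circ N w)"
          using mS z w cz by (intro f0_depends) (simp_all add: circ_conj_nth mc w2 cc)
        also have "\<dots> = (w\<^sup>2) ^ i * f0 (m (cnj z))" by (simp add: f0_scale[OF w] power_mult)
        finally show ?thesis using z cz by (simp add: w2 pm power_divide)
      qed
      \<comment> \<open>\<open>A\<close> represents \<open>c\<close>, while \<open>D\<close> and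
        \<open>q\<close> are reversed polynomials, equal on the circle to
        \<open>z^2 * cnj (c z)\<close> and \<open>z ^ (2 * i) * poly p (cnj z)\<close>. The symmetry
        turns into \<open>D ^ i * p = A ^ i * q\<close>.\<close>
      define A where "A = [:complex_of_real (1 - a), 0, complex_of_real a:]"
      define D where "D = [:complex_of_real a, 0, complex_of_real (1 - a):]"
      define q where "q = (\<Sum>j\<le>2 * i. monom (coeff p j) (2 * i - j))"
      have pA: "poly A z = c z" for z by (simp add: A_def c_def power2_eq_square algebra_simps)
      have pD: "poly D z = z\<^sup>2 * cnj (c z)" if "norm z = 1" for z
      proof -
        have "z\<^sup>2 * (cnj z)\<^sup>2 = 1" using cnj_mult_norm_1[OF that] by (simp add: power_mult_distrib[symmetric])
        then show ?thesis by (simp add: D_def c_def power2_eq_square algebra_simps)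
      qed
      have pq: "poly q z = z ^ (2 * i) * poly p (cnj z)" if z: "norm z = 1" for z
      proof -
        have "z ^ (2 * i - j) = z ^ (2 * i) * cnj z ^ j" if "j \<le> 2 * i" for j
        proof -
          have "z ^ (2 * i) * cnj z ^ j = z ^ (2 * i - j) * (z * cnj z) ^ j"
            using that by (simp add: power_mult_distrib power_add[symmetric] mult.assoc[symmetric])
          then show ?thesis by (simp add: cnj_mult_norm_1[OF z])
        qed
        then have "poly q z = (\<Sum>j\<le>2 * i. coeff p j * (z ^ (2 * i) * cnj z ^ j))"
          by (simp add: q_def poly_sum poly_monom)
        moreover have "poly p (cnj z) = (\<Sum>j\<le>2 * i. coeff p j * cnj z ^ j)"
          unfolding poly_altdef using p(1) by (intro sum.mono_neutral_left) (auto simp: coeff_eq_0)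
        ultimately show ?thesis by (simp add: sum_distrib_left mult_ac)
      qed
      have "D ^ i * p = A ^ i * q"
      proof (rule poly_eq_on_circle)
        fix z :: complex assume z: "norm z = 1"
        have "poly (D ^ i * p) z = z ^ (2 * i) * (cnj (c z) ^ i * poly p z)"
          by (simp add: pD[OF z] power_mult_distrib power_mult[symmetric])
        also have "\<dots> = poly (A ^ i * q) z"
          unfolding sym[OF z] by (simp add: pA pq[OF z])
        finally show "poly (D ^ i * p) z = poly (A ^ i * q) z" .
      qed
      moreover have "coprime (A ^ i) (D ^ i)"
      proof -
        \<comment> \<open>A Bezout identity: the quadratic terms cancel and the constant is
          \<open>(1 - a)^2 - a^2 = 1 - 2 * a = \<rho>\<close>.\<close>
        have "smult (complex_of_real (1 - a)) A - smult (complex_of_real a) D = [:complex_of_real \<rho>:]"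
          by (simp add: A_def D_def a_def of_real_mult[symmetric] algebra_simps del: of_real_mult)
        then have bez: "d dvd [:complex_of_real \<rho>:]" if "d dvd A" "d dvd D" for d
          using that by (metis dvd_diff dvd_smult)
        have "is_unit [:complex_of_real \<rho>:]"
          using \<rho>0 by (simp add: is_unit_const_poly_iff dvd_field_iff)
        then have "coprime A D" using bez by (intro coprimeI) (blast intro: dvd_trans)
        then show ?thesis by simp
      qed
      ultimately have "A ^ i dvd p" by (metis coprime_dvd_mult_right_iff dvd_triv_left)
      then obtain r where r: "p = A ^ i * r" by blast
      \<comment> \<open>Already \<open>A ^ i\<close> has degree \<open>2 * i\<close>, so the
        quotient is a constant, found at \<open>z = 1\<close>.\<close>
      have "A \<noteq> 0" "degree A = 2" using a by (auto simp: A_def)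
      then have "degree r = 0" 
        using p(1) unfolding r by (cases "r = 0") (simp_all add: degree_mult_eq degree_power_eq)
      then obtain K where "r = [:K:]" by (metis degree_eq_zeroE)
      then have pK: "poly p z = K * c z ^ i" for z by (simp add: r pA)
      have "c 1 = 1" by (simp add: c_def)
      then have "K = f0 (mat 1)" using pK[of 1] m1 by simp
      then show ?thesis using pK[of \<i>] mi ci by simp
    qed
  qed
qed

lemma f0_eq:
  assumes s: "s \<in> sym_unitary" shows "f0 s = f0 (mat 1) * (s $ N $ N) ^ i"
proof -
  define c where "c = s $ N $ N"
  \<comment> \<open>A phase that turns the entry \<open>c\<close> into its modulus, where
    \<open>f0_real\<close> applies.\<close>
  define w where "w = (if c = 0 then 1 else csqrt (complex_of_real (norm c) / c))"
  have w2: "w\<^sup>2 * c = complex_of_real (norm c)" by (simp add: w_def)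
  have "norm (w\<^sup>2) = 1" by (simp add: w_def norm_divide)
  then have "(norm w)\<^sup>2 = 1" by (simp add: norm_power)
  then have w: "norm w = 1" by (simp add: power2_eq_1_iff) (metis norm_ge_zero neg_0_le_iff_le
      not_one_le_zero)
  have "norm c \<le> norm (s *v axis N 1)"
    unfolding c_def matrix_vec_axis[symmetric] by (rule Finite_Cartesian_Product.norm_nth_le)
  also have "\<dots> = 1" using s norm_unitary[of s "axis N 1"] herm_self_eq_1[of "axis N (1::complex)"]
    by (simp add: sym_unitary_iff herm_axis)
  finally have "f0 (circ N w ** s ** circ N w) = f0 (mat 1) * complex_of_real (norm c) ^ i"
    using s w w2 by (intro f0_real) (simp_all add: circ_conj_nth c_def)
  then have "w ^ (2 * i) * f0 s = w ^ (2 * i) * (f0 (mat 1) * c ^ i)"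
    unfolding f0_scale[OF w] w2[symmetric] by (simp add: power_mult_distrib power_mult)
  moreover have "w \<noteq> 0" using w by auto
  ultimately show ?thesis by (simp add: c_def)
qed

text \<open>Since \<open>f0\<close> is a multiple of a generator of \<open>qspace i\<close>, the
  space \<open>V\<close> contains \<open>qspace i\<close>, and irreducibility gives
  equality.\<close>

lemma eq_qspace: "V = qspace i"
proof -
  have q: "quad_form s (axis N 1) = s $ N $ N" for s :: "((complex, 'm) vec, 'm) vec"
    unfolding quad_form_def matrix_vec_axis by (simp add: axis_def if_distrib[of "\<lambda>c. c * _"] cong: if_cong)
  have "f0 s = cscale (f0 (mat 1)) (qpow i (axis N 1)) s" for s
    using f0_eq[of s] V_cont[OF f0(1)] by (simp add: cscale_apply qpow_def q cont_fun_def)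
  then have f0q: "f0 = cscale (f0 (mat 1)) (qpow i (axis N 1))" by (rule ext)
  then have ne: "f0 (mat 1) \<noteq> 0" using f0(2) by (metis cfun.scale_zero_left)
  have "cscale (1 / f0 (mat 1)) f0 \<in> V" using f0(1) by (rule cfun.subspace_scale[OF V_sub])
  then have "qpow i (axis N 1) \<in> V"
    using ne f0q by (metis cfun.scale_one cfun.scale_scale nonzero_eq_divide_eq)
  then have sub: "qspace i \<subseteq> V" by (rule qspace_least[OF inv])
  moreover have "qspace i \<noteq> ({0} :: (((complex, 'm) vec, 'm) vec \<Rightarrow> complex) set)"
    using qspace_irreducible unfolding irreducible_subspace_def by blast
  ultimately show ?thesis
    using irr qspace_invariant unfolding irreducible_subspace_def by blast
qed

end

theorem C_irr_eq_qspace: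
  assumes "2 \<le> CARD('m::{finite,linorder})"
  shows "(C_irr (last_weight (- 2 * int i)) :: (complex^('m::{finite,linorder})^('m::{finite,linorder})
      \<Rightarrow> complex) set) = qspace i"
  unfolding C_irr_def
proof (rule the_equality)
  show "irreducible_subspace (qspace i :: (complex^('m::{finite,linorder})^('m::{finite,linorder}) \<Rightarrow>
      complex) set) \<and>
      has_highest_weight (qspace i :: (complex^('m::{finite,linorder})^('m::{finite,linorder}) \<Rightarrow>
          complex) set) (last_weight (- 2 * int i))"
    using qspace_irreducible qspace_highest_weight by blast
  fix V :: "(complex^('m::{finite,linorder})^('m::{finite,linorder}) \<Rightarrow> complex) set"
  assume V: "irreducible_subspace V \<and> has_highest_weight V (last_weight (- 2 * int i))"
  then obtain B where "finite B" "V = cfun.span B" unfolding irreducible_subspace_def by blast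
  then interpret extreme_irreducible V B i "Max UNIV"
    using V assms by unfold_locales (auto simp: irreducible_subspace_def)
  show "V = qspace i" by (rule eq_qspace)
qed

text \<open>The scalar matrix \<open>z\<close> acts on \<open>qspace j\<close> by
  \<open>cnj z ^ (2 * j)\<close>. Applied to a vanishing sum at a fixed \<open>s\<close>, this gives
  a polynomial that vanishes on the circle and has the values \<open>v j s\<close> as
  coefficients.\<close>

lemma qspace_direct:
  fixes v :: "nat \<Rightarrow> complex^'m^'m \<Rightarrow> complex"
  assumes v: "\<And>i. v i \<in> qspace i" and fin: "finite {i. v i \<noteq> 0}" and zero: "(\<Sum>i | v i \<noteq> 0. v i) = 0"
  shows "v i = 0"
proof -
  define I where "I = {i. v i \<noteq> 0}"
  define rot where "rot z = diag_mat (\<lambda>_ :: 'm. z)" for z :: complex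
  have rotu: "rot z \<in> unitary_group" if "norm z = 1" for z
    unfolding rot_def using that by (intro diag_mat_unitary) (simp add: torus_elt_def)
  have scale: "act (rot z) f = cscale (cnj z ^ (2 * j)) f" if z: "norm z = 1" and f: "f \<in> qspace j" for z j f
    using f unfolding qspace_def
  proof (induction f rule: cfun.span_induct_alt)
    case base
    then show ?case by (simp only: act_linear cfun.scale_zero_right)
  next
    case (step c b h)
    then obtain u where b: "b = qpow j u" by blast
    have "cnj_mat (rot z) *v u = cnj z *s u"
      unfolding rot_def
      by (auto simp: vec_eq_iff matrix_vec_nth diag_mat_nth if_distrib[of cnj] if_distrib[of "\<lambda>c. c *
          _"] cong: if_cong)
    then have "act (rot z) b = cscale (cnj z ^ (2 * j)) b"
      unfolding b act_qpow[OF rotu[OF z]]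
      by (simp add: fun_eq_iff qpow_def cscale_apply quad_form_scale power_mult_distrib power_mult)
    then show ?case unfolding act_linear step.IH
      by (simp only: cfun.scale_right_distrib cfun.scale_scale mult.commute)
  qed
  have "v i s = 0" for s
  proof (cases "i \<in> I")
    case True
    define p where "p = (\<Sum>j\<in>I. monom (v j s) (2 * j))"
    have "p = 0"
    proof (rule poly_eq_on_circle)
      fix z :: complex assume z: "norm z = 1"
      have "(\<Sum>j\<in>I. cscale (z ^ (2 * j)) (v j)) = (\<Sum>j\<in>I. act (rot (cnj z)) (v j))"
        using z by (intro sum.cong) (simp_all add: scale[OF _ v])
      also have "\<dots> = act (rot (cnj z)) (\<Sum>j\<in>I. v j)" by (simp only: act_sum)
      also have "\<dots> = 0" using zero by (simp only: I_def act_linear)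
      finally have "(\<Sum>j\<in>I. cscale (z ^ (2 * j)) (v j)) s = 0" by simp
      then show "poly p z = poly 0 z"
        by (simp add: p_def poly_sum poly_monom sum_fun_apply cscale_apply mult.commute)
    qed
    then have "coeff p (2 * i) = 0" by simp
    then have "(\<Sum>j\<in>I. if 2 * j = 2 * i then v j s else 0) = 0" by (simp add: p_def coeff_sum)
    then show ?thesis using True fin by (simp add: I_def)
  qed (simp add: I_def)
  then show ?thesis by (simp add: fun_eq_iff)
qed

subsection \<open>Rotation invariance of the Lebesgue measure\<close>

lemma continuous_on_orthogonal:
  fixes T :: "'a::euclidean_space \<Rightarrow> 'a"
  assumes "orthogonal_transformation T" shows "continuous_on UNIV T"
  using orthogonal_transformation_linear[OF assms] linear_conv_bounded_linear linear_continuous_on by blast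

text \<open>
  Two translation invariant measures with the same value on the unit ball agree: compute the
  \<open>\<mu> \<times> \<nu>\<close>-measure of \<open>A \<times> B\<close> after a shear.
\<close>

lemma lborel_orthogonal_invariant:
  fixes T :: "'a::euclidean_space \<Rightarrow> 'a"
  assumes T: "orthogonal_transformation T"
  shows "distr lborel borel T = lborel"
proof (rule measure_eqI)
  define \<nu> where "\<nu> = distr lborel borel T"
  define B where "B = cball (0::'a) 1"
  have lin: "linear T" using T by (simp add: orthogonal_transformation_linear)
  have cont: "continuous_on UNIV T" by (rule continuous_on_orthogonal[OF T])
  have mT [measurable]: "T \<in> borel_measurable borel" using cont by (rule borel_measurable_continuous_onI)
  obtain S where S: "orthogonal_transformation S" "\<And>x. T (S x) = x" "\<And>x. S (T x) = x"
    using T orthogonal_transformation_inv[OF T] orthogonal_transformation_bij[OF T]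
    by (metis bij_inv_eq_iff)
  have sets\<nu> [measurable_cong]: "sets \<nu> = sets borel" by (simp add: \<nu>_def)
  have nn\<nu>: "(\<integral>\<^sup>+y. h y \<partial>\<nu>) = (\<integral>\<^sup>+y. h (T y) \<partial>lborel)" if [measurable]: "h \<in> borel_measurable borel" for h
    unfolding \<nu>_def by (rule nn_integral_distr) auto
  have shift: "(\<integral>\<^sup>+y. h (c + y) \<partial>lborel) = (\<integral>\<^sup>+y. h y \<partial>lborel)" if [measurable]: "h \<in> borel_measurable borel"
    for h and c :: 'a
  proof -
    have "(\<integral>\<^sup>+y. h y \<partial>lborel) = (\<integral>\<^sup>+y. h y \<partial>distr lborel borel ((+) c))" by (simp only: lborel_distr_plus)
    also have "\<dots> = (\<integral>\<^sup>+y. h (c + y) \<partial>lborel)" by (rule nn_integral_distr) auto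
    finally show ?thesis ..
  qed
  have shift\<nu>: "(\<integral>\<^sup>+y. h (c + y) \<partial>\<nu>) = (\<integral>\<^sup>+y. h y \<partial>\<nu>)" if [measurable]: "h \<in> borel_measurable borel"
    for h and c :: 'a
  proof -
    have "(\<integral>\<^sup>+y. h (c + y) \<partial>\<nu>) = (\<integral>\<^sup>+y. h (c + T y) \<partial>lborel)" by (rule nn\<nu>) simp
    also have "\<dots> = (\<integral>\<^sup>+y. h (T (S c + y)) \<partial>lborel)" by (simp add: linear_add[OF lin] S)
    also have "\<dots> = (\<integral>\<^sup>+y. h (T y) \<partial>lborel)" by (rule shift) simp
    also have "\<dots> = (\<integral>\<^sup>+y. h y \<partial>\<nu>)" by (rule nn\<nu>[symmetric]) simp
    finally show ?thesis .
  qed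
  have vimT: "T -` cball 0 r = cball 0 r" for r
    using T by (auto simp: orthogonal_transformation_norm)
  have ball\<nu>: "emeasure \<nu> (cball 0 r) = emeasure lborel (cball (0::'a) r)" for r
    unfolding \<nu>_def by (subst emeasure_distr) (auto simp: vimT)
  interpret \<nu>: sigma_finite_measure \<nu>
  proof
    show "\<exists>A. countable A \<and> A \<subseteq> sets \<nu> \<and> \<Union>A = space \<nu> \<and> (\<forall>a\<in>A. emeasure \<nu> a \<noteq> \<infinity>)"
    proof (intro exI[of _ "range (\<lambda>n. cball 0 (real n))"] conjI)
      show "\<Union> (range (\<lambda>n. cball (0::'a) (real n))) = space \<nu>"
        by (auto simp: \<nu>_def intro: real_arch_simple)
    qed (auto simp: ball\<nu> emeasure_cball sets\<nu>)
  qed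
  interpret P: pair_sigma_finite lborel \<nu> ..
  show "emeasure (distr lborel borel T) A = emeasure lborel A" if "A \<in> sets (distr lborel borel T)" for A
  proof -
    have [measurable]: "A \<in> sets borel" using that by simp
    have [measurable]: "B \<in> sets borel" by (simp add: B_def)
    let ?I = "\<lambda>A x. indicator A x :: ennreal"
    have "emeasure lborel A * emeasure \<nu> B = (\<integral>\<^sup>+y. ?I B y * (\<integral>\<^sup>+x. ?I A x \<partial>lborel) \<partial>\<nu>)"
      by (simp add: nn_integral_multc mult.commute sets\<nu>)
    also have "\<dots> = (\<integral>\<^sup>+y. \<integral>\<^sup>+x. ?I B y * ?I A (y + x) \<partial>lborel \<partial>\<nu>)"
      by (simp add: nn_integral_cmult shift)
    also have "\<dots> = (\<integral>\<^sup>+x. \<integral>\<^sup>+y. ?I B y * ?I A (y + x) \<partial>\<nu> \<partial>lborel)"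
      by (rule P.Fubini') measurable
    also have "\<dots> = (\<integral>\<^sup>+x. \<integral>\<^sup>+y. ?I B (- x + y) * ?I A y \<partial>\<nu> \<partial>lborel)"
    proof (rule nn_integral_cong)
      fix x
      show "(\<integral>\<^sup>+y. ?I B y * ?I A (y + x) \<partial>\<nu>) = (\<integral>\<^sup>+y. ?I B (- x + y) * ?I A y \<partial>\<nu>)"
        using shift\<nu>[of "\<lambda>y. ?I B (- x + y) * ?I A y" x] by (simp add: add.commute)
    qed
    also have "\<dots> = (\<integral>\<^sup>+y. \<integral>\<^sup>+x. ?I B (- x + y) * ?I A y \<partial>lborel \<partial>\<nu>)"
      by (rule P.Fubini'[symmetric]) measurable
    also have "\<dots> = (\<integral>\<^sup>+y. emeasure lborel B * ?I A y \<partial>\<nu>)"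
    proof (rule nn_integral_cong)
      fix y
      \<comment> \<open>As \<open>B\<close> is symmetric, \<open>x\<close> ranges over the unit ball
        around \<open>y\<close>, whose Lebesgue measure does not depend on \<open>y\<close>.\<close>
      have e: "?I B (- x + y) = ?I (cball y 1) x" for x
        by (auto simp: B_def indicator_def dist_norm norm_minus_commute)
      show "(\<integral>\<^sup>+x. ?I B (- x + y) * ?I A y \<partial>lborel) = emeasure lborel B * ?I A y"
        unfolding e by (subst nn_integral_multc)
          (auto simp: B_def emeasure_cball intro!: borel_measurable_indicator borel_closed)
    qed
    also have "\<dots> = emeasure lborel B * emeasure \<nu> A"
      by (subst nn_integral_cmult) (auto simp: sets\<nu>)
    finally have "emeasure lborel B * emeasure lborel A = emeasure lborel B * emeasure \<nu> A"
      by (simp add: B_def ball\<nu> mult.commute)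
    moreover have "emeasure lborel B \<noteq> 0" "emeasure lborel B \<noteq> top"
      by (auto simp: B_def emeasure_cball unit_ball_vol_pos[THEN less_imp_neq] not_le)
        (metis less_irrefl unit_ball_vol_pos of_nat_0_le_iff)
    ultimately show ?thesis by (simp add: ennreal_mult_cancel_left \<nu>_def)
  qed
qed simp

subsection \<open>The Gaussian measure\<close>

lemma sum_le_exp:
  fixes x :: real
  assumes "0 \<le> x" "finite A" shows "(\<Sum>k\<in>A. x ^ k /\<^sub>R fact k) \<le> exp x"
proof -
  have "summable (\<lambda>k. x ^ k /\<^sub>R fact k)" using exp_converges[of x] by (simp only: sums_iff)
  then have "(\<Sum>k\<in>A. x ^ k /\<^sub>R fact k) \<le> (\<Sum>k. x ^ k /\<^sub>R fact k)"
    by (rule sum_le_suminf) (use assms in auto)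
  also have "\<dots> = exp x" using exp_converges[of x] by (simp only: sums_iff)
  finally show ?thesis .
qed

lemma power_le_fact_exp:
  fixes x :: real assumes "0 \<le> x" shows "x ^ n \<le> fact n * exp x"
proof -
  have "(\<Sum>k\<in>{n}. x ^ k /\<^sub>R fact k) \<le> exp x"
    using assms by (intro sum_le_exp) auto
  then have "x ^ n / fact n \<le> exp x" by (simp add: divide_inverse mult.commute)
  then show ?thesis by (simp add: divide_le_eq mult.commute)
qed

text \<open>Where the norm lies between \<open>k\<close> and \<open>k + 1\<close> the function is at
  most \<open>exp (- a * k^2)\<close>, and the ball of radius \<open>k + 1\<close> has polynomial
  volume; the resulting series is compared with a geometric one.\<close>

lemma integrable_gaussian:
  assumes a: "a > 0"
  shows "integrable lborel (\<lambda>z :: 'a::euclidean_space. exp (- a * (norm z)\<^sup>2))"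
proof (rule integrableI_nonneg)
  define n where "n = DIM('a)"
  define c where "c k = unit_ball_vol n * (real k + 1) ^ n * exp (- a * (real k)\<^sup>2)" for k :: nat
  have vol: "0 \<le> unit_ball_vol n" by (simp add: unit_ball_vol_nonneg)
  have c0: "0 \<le> c k" for k unfolding c_def using vol by (intro mult_nonneg_nonneg) auto
  have "summable c"
  proof (rule summable_comparison_test')
    show "summable (\<lambda>k. (unit_ball_vol n * fact n * exp (1 + 1 / a)) * exp (- 1) ^ k)"
      by (intro summable_mult summable_geometric) simp
    fix k :: nat
    have "(real k + 1) ^ n \<le> fact n * exp (real k + 1)" by (rule power_le_fact_exp) simp
    then have "c k \<le> unit_ball_vol n * (fact n * exp (real k + 1)) * exp (- a * (real k)\<^sup>2)"
      unfolding c_def using vol by (intro mult_right_mono mult_left_mono) auto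
    also have "\<dots> = unit_ball_vol n * fact n * exp (real k + 1 - a * (real k)\<^sup>2)"
      by (simp add: exp_add exp_diff exp_minus divide_inverse mult_ac)
    also have "\<dots> \<le> unit_ball_vol n * fact n * exp (1 + 1 / a - real k)"
    proof (intro mult_left_mono)
      \<comment> \<open>Completing the square gives \<open>a * k^2 \<ge> 2 * k - 1 / a\<close>, the
        source of the constant \<open>1 + 1 / a\<close>.\<close>
      have "0 \<le> (a * real k - 1)\<^sup>2 / a" using a by simp
      also have "\<dots> = a * (real k)\<^sup>2 - 2 * real k + 1 / a"
        using a by (simp add: power2_diff power_mult_distrib add_divide_distrib diff_divide_distrib
            power2_eq_square[of a])
      finally show "exp (real k + 1 - a * (real k)\<^sup>2) \<le> exp (1 + 1 / a - real k)"
        unfolding exp_le_cancel_iff by linarith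
    qed (use vol in auto)
    also have "\<dots> = (unit_ball_vol n * fact n * exp (1 + 1 / a)) * exp (- 1) ^ k"
      by (simp add: exp_of_nat_mult[symmetric] exp_add[symmetric] mult.assoc)
    finally show "norm (c k) \<le> (unit_ball_vol n * fact n * exp (1 + 1 / a)) * exp (- 1) ^ k"
      using c0[of k] by simp
  qed
  have "(\<integral>\<^sup>+(z :: 'a). ennreal (exp (- a * (norm z)\<^sup>2)) \<partial>lborel) \<le>
      (\<integral>\<^sup>+(z :: 'a). (\<Sum>k. ennreal (exp (- a * (real k)\<^sup>2)) * indicator (cball 0 (real k + 1)) z) \<partial>lborel)"
  proof (rule nn_integral_mono)
    fix z :: 'a
    define k where "k = nat \<lfloor>norm z\<rfloor>"
    have k: "real k \<le> norm z" "norm z \<le> real k + 1" by (auto simp: k_def)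
    have "ennreal (exp (- a * (norm z)\<^sup>2)) \<le> ennreal (exp (- a * (real k)\<^sup>2)) * indicator (cball 0 (real
        k + 1)) z"
      using k a by (auto simp: indicator_def intro!: ennreal_leI power_mono)
    also have "\<dots> \<le> (\<Sum>k. ennreal (exp (- a * (real k)\<^sup>2)) * indicator (cball 0 (real k + 1)) z)"
    proof -
      have "g k \<le> (\<Sum>k. g k)" for g :: "nat \<Rightarrow> ennreal" using sum_le_suminf[of g "{k}"] by simp
      then show ?thesis .
    qed
    finally show "ennreal (exp (- a * (norm z)\<^sup>2)) \<le>
        (\<Sum>k. ennreal (exp (- a * (real k)\<^sup>2)) * indicator (cball 0 (real k + 1)) z)" .
  qed
  also have "\<dots> = (\<Sum>k. \<integral>\<^sup>+(z :: 'a). ennreal (exp (- a * (real k)\<^sup>2)) * indicator (cball 0 (real k + 1))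
      z \<partial>lborel)"
    by (rule nn_integral_suminf)
      (auto intro!: borel_measurable_times_ennreal borel_measurable_indicator borel_closed)
  also have "\<dots> = (\<Sum>k. ennreal (c k))"
  proof (rule suminf_cong)
    fix k
    have "(\<integral>\<^sup>+(z :: 'a). ennreal (exp (- a * (real k)\<^sup>2)) * indicator (cball 0 (real k + 1)) z \<partial>lborel) =
        ennreal (exp (- a * (real k)\<^sup>2)) * emeasure lborel (cball (0 :: 'a) (real k + 1))"
      by (rule nn_integral_cmult_indicator) (simp add: borel_closed)
    also have "\<dots> = ennreal (c k)"
      using vol by (simp add: emeasure_cball c_def n_def ennreal_mult'[symmetric] mult_ac)
    finally show "(\<integral>\<^sup>+(z :: 'a). ennreal (exp (- a * (real k)\<^sup>2)) * indicator (cball 0 (real k + 1)) z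
        \<partial>lborel) =
        ennreal (c k)" .
  qed
  also have "\<dots> < top" using ennreal_suminf_neq_top[OF \<open>summable c\<close> c0] by (simp add: top.not_eq_extremum)
  finally show "(\<integral>\<^sup>+(z :: 'a). ennreal (exp (- a * (norm z)\<^sup>2)) \<partial>lborel) < \<infinity>" by simp
qed auto

definition gauss_norm :: "'a::euclidean_space itself \<Rightarrow> real" where
  "gauss_norm _ = (\<integral>w. exp (- (norm (w :: 'a))\<^sup>2 / 2) \<partial>lborel)"

lemma gaussian_half_integrable:
  "integrable lborel (\<lambda>z :: 'a::euclidean_space. exp (- (norm z)\<^sup>2 / 2))"
  using integrable_gaussian[of "1 / 2"] by simp

lemma gauss_norm_pos: "0 < gauss_norm TYPE('a::euclidean_space)"
proof -
  have "gauss_norm TYPE('a) \<noteq> 0"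
  proof
    assume "gauss_norm TYPE('a) = 0"
    then have "AE w in lborel. exp (- (norm (w :: 'a))\<^sup>2 / 2) = 0"
      unfolding gauss_norm_def using gaussian_half_integrable
      by (subst (asm) integral_nonneg_eq_0_iff_AE) auto
    then have "AE w in lborel. (w :: 'a) \<in> {}" by simp
    then have "emeasure lborel (UNIV :: 'a set) = 0"
      using AE_iff_measurable[of "UNIV :: 'a set" lborel "\<lambda>w. w \<in> {}"] by simp
    then show False by simp
  qed
  moreover have "0 \<le> gauss_norm TYPE('a)" unfolding gauss_norm_def by (intro
      Bochner_Integration.integral_nonneg) auto
  ultimately show ?thesis by simp
qed

definition gauss_dens :: "complex^'m \<Rightarrow> real" where
  "gauss_dens z = exp (- (norm z)\<^sup>2 / 2) / gauss_norm TYPE(complex^'m)"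

lemma gauss_alt: "(gauss :: (complex^'m) measure) = density lborel (\<lambda>z. ennreal (gauss_dens z))"
  by (simp add: gauss_def gauss_dens_def gauss_norm_def)

lemma gauss_dens_nonneg: "0 \<le> gauss_dens z"
  unfolding gauss_dens_def by (intro divide_nonneg_pos gauss_norm_pos) simp

lemma gauss_dens_measurable [measurable]: "gauss_dens \<in> borel_measurable borel"
  unfolding gauss_dens_def by measurable

lemma sets_gauss [simp, measurable_cong]: "sets gauss = sets borel"
  by (simp add: gauss_def)

lemma space_gauss [simp]: "space gauss = UNIV"
  by (simp add: gauss_def)

interpretation gauss: finite_measure "gauss :: (complex^'m) measure"
proof
  have "emeasure (gauss :: (complex^'m) measure) UNIV = (\<integral>\<^sup>+(z :: complex^'m). ennreal (gauss_dens z)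
      \<partial>lborel)"
    by (simp add: gauss_alt emeasure_density)
  also have "\<dots> = ennreal (\<integral>(z :: complex^'m). gauss_dens z \<partial>lborel)"
    unfolding gauss_dens_def
    by (intro nn_integral_eq_integral integrable_divide_zero gaussian_half_integrable)
      (auto simp: gauss_norm_pos less_imp_le)
  finally show "emeasure (gauss :: (complex^'m) measure) (space gauss) \<noteq> \<infinity>" by simp
qed

interpretation gauss_pair: pair_sigma_finite "gauss :: (complex^'m) measure" "gauss :: (complex^'n)
    measure" ..

lemma gauss_integrable:
  fixes f :: "complex^'m \<Rightarrow> complex"
  assumes f: "continuous_on UNIV f" and b: "b < 1 / 2"
    and bound: "\<And>z. norm (f z) \<le> C * exp (b * (norm z)\<^sup>2)"
  shows "integrable gauss f"
proof -
  have [measurable]: "f \<in> borel_measurable borel" using f by (rule borel_measurable_continuous_onI)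
  have "integrable lborel (\<lambda>z. gauss_dens z *\<^sub>R f z)"
  proof (rule Bochner_Integration.integrable_bound)
    show "integrable lborel (\<lambda>z :: complex^'m. (C / gauss_norm TYPE(complex^'m)) * exp (- (1 / 2 - b) *
        (norm z)\<^sup>2))"
      using b by (intro integrable_mult_right integrable_gaussian) simp
    show "AE z in lborel. norm (gauss_dens z *\<^sub>R f z) \<le>
        norm ((C / gauss_norm TYPE(complex^'m)) * exp (- (1 / 2 - b) * (norm z)\<^sup>2))"
    proof (rule AE_I2)
      fix z :: "complex^'m"
      have "norm (gauss_dens z *\<^sub>R f z) \<le> gauss_dens z * (C * exp (b * (norm z)\<^sup>2))"
        using bound[of z] gauss_dens_nonneg[of z] by (simp add: mult_left_mono)
      also have "\<dots> = (C / gauss_norm TYPE(complex^'m)) * (exp (- (norm z)\<^sup>2 / 2) * exp (b * (norm z)\<^sup>2))"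
        by (simp add: gauss_dens_def)
      also have "exp (- (norm z)\<^sup>2 / 2) * exp (b * (norm z)\<^sup>2) = exp (- (1 / 2 - b) * (norm z)\<^sup>2)"
        by (simp add: exp_add[symmetric] algebra_simps)
      finally show "norm (gauss_dens z *\<^sub>R f z) \<le>
        norm ((C / gauss_norm TYPE(complex^'m)) * exp (- (1 / 2 - b) * (norm z)\<^sup>2))"
        by (rule order.trans) (simp only: real_norm_def abs_ge_self)
    qed
  qed measurable
  then show ?thesis
    unfolding gauss_alt by (subst integrable_density) (auto simp: gauss_dens_nonneg)
qed

lemma sets_gauss_pair:
  "sets (gauss \<Otimes>\<^sub>M gauss :: ((complex^'m) \<times> (complex^'n)) measure) = sets borel"
proof -
  have "sets (gauss \<Otimes>\<^sub>M gauss :: ((complex^'m) \<times> (complex^'n)) measure) = sets (borel \<Otimes>\<^sub>M borel)"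
    by (rule sets_pair_measure_cong[OF sets_gauss sets_gauss])
  also have "\<dots> = sets borel" by (simp only: borel_prod)
  finally show ?thesis .
qed

lemma gauss_pair_integrable:
  fixes f :: "(complex^'m) \<times> (complex^'n) \<Rightarrow> complex"
  assumes f: "continuous_on UNIV f" and b: "b < 1 / 2"
    and bound: "\<And>z w. norm (f (z, w)) \<le> C * exp (b * ((norm z)\<^sup>2 + (norm w)\<^sup>2))"
  shows "integrable (gauss \<Otimes>\<^sub>M gauss) f"
proof (rule Bochner_Integration.integrable_bound)
  define e where "e = (\<lambda>z :: complex^'m. complex_of_real (C * exp (b * (norm z)\<^sup>2)))"
  define e' where "e' = (\<lambda>z :: complex^'n. complex_of_real (exp (b * (norm z)\<^sup>2)))"
  define h where "h = (\<lambda>(z, w). e z * e' w)"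
  have ce: "continuous_on UNIV e" "continuous_on UNIV e'" unfolding e_def e'_def by (intro continuous_intros)+
  have ie: "integrable gauss e"
    by (rule gauss_integrable[OF ce(1) b, of "\<bar>C\<bar>"]) (simp add: e_def abs_mult norm_mult)
  have ie': "integrable gauss e'"
    by (rule gauss_integrable[OF ce(2) b, of 1]) (simp add: e'_def)
  have mh: "h \<in> borel_measurable (gauss \<Otimes>\<^sub>M gauss)"
    unfolding h_def measurable_cong_sets[OF sets_gauss_pair refl] case_prod_unfold
    by (intro borel_measurable_continuous_onI continuous_intros
      continuous_on_compose2[OF ce(1)] continuous_on_compose2[OF ce(2)]) auto
  show "integrable (gauss \<Otimes>\<^sub>M gauss) h"
  proof (rule gauss_pair.Fubini_integrable[OF mh])
    have "(\<lambda>x. \<integral>y. norm (h (x, y)) \<partial>gauss) = (\<lambda>x. norm (e x) * (\<integral>y. norm (e' y) \<partial>gauss))"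
      by (simp add: h_def norm_mult)
    moreover have "integrable gauss (\<lambda>x. norm (e x) * (\<integral>y. norm (e' y) \<partial>gauss))"
      using ie by (intro integrable_mult_left integrable_norm)
    ultimately show "integrable gauss (\<lambda>x. \<integral>y. norm (h (x, y)) \<partial>gauss)" by simp
    show "AE x in gauss. integrable gauss (\<lambda>y. h (x, y))"
      using ie' by (simp add: h_def)
  qed
  show "f \<in> borel_measurable (gauss \<Otimes>\<^sub>M gauss)"
    unfolding measurable_cong_sets[OF sets_gauss_pair refl]
    by (rule borel_measurable_continuous_onI[OF f])
  show "AE x in gauss \<Otimes>\<^sub>M gauss. norm (f x) \<le> norm (h x)"
  proof (rule AE_I2)
    fix x :: "(complex^'m) \<times> (complex^'n)"
    obtain z w where x: "x = (z, w)" by (cases x)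
    have C0: "0 \<le> C" using order.trans[OF norm_ge_zero bound[of 0 0]] by simp
    have "norm (h x) = C * exp (b * ((norm z)\<^sup>2 + (norm w)\<^sup>2))"
      using C0 by (simp add: x h_def e_def e'_def norm_mult exp_add[symmetric] distrib_left)
    then show "norm (f x) \<le> norm (h x)" using bound[of z w] by (simp add: x)
  qed
qed

lemma gauss_invariant:
  fixes f :: "complex^'m \<Rightarrow> complex" and T :: "complex^'m \<Rightarrow> complex^'m"
  assumes T: "orthogonal_transformation T" and f [measurable]: "f \<in> borel_measurable borel"
  shows "(\<integral>z. f (T z) \<partial>gauss) = (\<integral>z. f z \<partial>gauss)"
proof -
  have "continuous_on UNIV T" by (rule continuous_on_orthogonal[OF T])
  then have [measurable]: "T \<in> borel_measurable borel" by (rule borel_measurable_continuous_onI)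
  have dT: "gauss_dens (T z) = gauss_dens z" for z
    using T by (simp add: gauss_dens_def orthogonal_transformation_norm)
  have "(\<integral>z. f z \<partial>gauss) = (\<integral>z. gauss_dens z *\<^sub>R f z \<partial>lborel)"
    unfolding gauss_alt by (rule integral_density) (auto simp: gauss_dens_nonneg)
  also have "\<dots> = (\<integral>z. gauss_dens z *\<^sub>R f z \<partial>distr lborel borel T)"
    by (simp only: lborel_orthogonal_invariant[OF T])
  also have "\<dots> = (\<integral>z. gauss_dens z *\<^sub>R f (T z) \<partial>lborel)"
    by (subst integral_distr) (auto simp: dT)
  also have "\<dots> = (\<integral>z. f (T z) \<partial>gauss)"
    unfolding gauss_alt by (rule integral_density[symmetric]) (auto simp: gauss_dens_nonneg)
  finally show ?thesis ..
qed

subsection \<open>Gaussian moments\<close>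

text \<open>The rate \<open>1 / 16\<close> leaves room: the kernel of \<open>WW\<close> grows with
  rate \<open>1 / 4\<close>, the product with rate \<open>5 / 16\<close>, and the Gaussian density
  decays with rate \<open>1 / 2\<close>.\<close>

definition exp_bounded :: "(complex^'m \<Rightarrow> complex) \<Rightarrow> bool" where
  "exp_bounded f \<longleftrightarrow> continuous_on UNIV f \<and> (\<exists>C. \<forall>v. norm (f v) \<le> C * exp ((norm v)\<^sup>2 / 16))"

lemma exp_bounded_add:
  assumes "exp_bounded f" "exp_bounded g" shows "exp_bounded (f + g)"
proof -
  obtain C D where "\<And>v. norm (f v) \<le> C * exp ((norm v)\<^sup>2 / 16)" "\<And>v. norm (g v) \<le> D * exp ((norm v)\<^sup>2 / 16)"
    using assms unfolding exp_bounded_def by blast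
  then have "norm ((f + g) v) \<le> (C + D) * exp ((norm v)\<^sup>2 / 16)" for v
    by (simp add: distrib_right) (meson add_mono norm_triangle_le)
  then show ?thesis using assms by (auto simp: exp_bounded_def plus_fun_def intro: continuous_intros)
qed

lemma exp_bounded_scale:
  assumes "exp_bounded f" shows "exp_bounded (cscale c f)"
proof -
  obtain C where C: "\<And>v. norm (f v) \<le> C * exp ((norm v)\<^sup>2 / 16)"
    using assms unfolding exp_bounded_def by blast
  have "norm (cscale c f v) \<le> norm c * C * exp ((norm v)\<^sup>2 / 16)" for v
    using mult_left_mono[OF C norm_ge_zero[of c]] by (simp add: cscale_apply norm_mult mult.assoc)
  then show ?thesis using assms by (auto simp: exp_bounded_def cscale_def intro: continuous_intros)
qed

lemma norm_mon_le: "norm (mon k v) \<le> norm v ^ (\<Sum>i\<in>UNIV. k i)"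
  unfolding mon_def prod_norm[symmetric] norm_power power_sum
  by (intro prod_mono) (auto intro: power_mono Finite_Cartesian_Product.norm_nth_le)

lemma continuous_on_mon [continuous_intros]:
  "continuous_on S f \<Longrightarrow> continuous_on S (\<lambda>x. mon k (f x))"
  unfolding mon_def by (intro continuous_intros)

lemma exp_bounded_mon: "exp_bounded (mon k :: complex^'m \<Rightarrow> complex)"
proof -
  define d where "d = (\<Sum>i\<in>UNIV. k i)"
  have "norm (mon k v) \<le> (fact d * exp 4) * exp ((norm v)\<^sup>2 / 16)" for v :: "complex^'m"
  proof -
    have "norm (mon k v) \<le> norm v ^ d" unfolding d_def by (rule norm_mon_le)
    also have "\<dots> \<le> fact d * exp (norm v)" by (rule power_le_fact_exp) simp
    also have "\<dots> \<le> fact d * exp (4 + (norm v)\<^sup>2 / 16)"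
    proof -
      \<comment> \<open>Gives \<open>norm v \<le> 4 + (norm v)^2 / 16\<close>, the origin of
        \<open>exp 4\<close>.\<close>
      have "0 \<le> (norm v - 8)\<^sup>2 / 16" by simp
      also have "\<dots> = 4 + (norm v)\<^sup>2 / 16 - norm v" by (simp add: power2_eq_square field_simps)
      finally show ?thesis by simp
    qed
    also have "\<dots> = (fact d * exp 4) * exp ((norm v)\<^sup>2 / 16)" by (simp add: exp_add)
    finally show ?thesis .
  qed
  then show ?thesis unfolding exp_bounded_def by (auto intro: continuous_intros)
qed

lemma polys_eq: "polys = cfun.span (range mon)"
  by (simp add: polys_def mon_def[abs_def])

lemma exp_bounded_polys: "f \<in> polys \<Longrightarrow> exp_bounded f"
  unfolding polys_eq
proof (induction rule: cfun.span_induct_alt)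
  case base
  have "exp_bounded (cscale 0 (mon (\<lambda>_. 0)) :: complex^'a \<Rightarrow> complex)"
    by (intro exp_bounded_scale exp_bounded_mon)
  then show ?case by (simp only: cfun.scale_zero_left)
next
  case (step c b h)
  then obtain k where "b = mon k" by blast
  then show ?case using step by (simp only: exp_bounded_add exp_bounded_scale exp_bounded_mon)
qed

lemma join_nth [simp]: "join z w $ Inl i = z $ i" "join z w $ Inr i = w $ i"
  by (simp_all add: join_def)

lemma sum_UNIV_sum:
  "(\<Sum>i\<in>(UNIV :: ('a::finite + 'b::finite) set). f i) = (\<Sum>i\<in>UNIV. f (Inl i)) + (\<Sum>i\<in>UNIV. f (Inr i))"
  by (simp add: UNIV_Plus_UNIV[symmetric] sum.Plus del: UNIV_Plus_UNIV)

lemma prod_UNIV_sum: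
  "(\<Prod>i\<in>(UNIV :: ('a::finite + 'b::finite) set). f i) = (\<Prod>i\<in>UNIV. f (Inl i)) * (\<Prod>i\<in>UNIV. f (Inr i))"
  by (simp add: UNIV_Plus_UNIV[symmetric] prod.Plus del: UNIV_Plus_UNIV)

lemma norm_join: "(norm (join z w :: complex^('n::finite + 'n)))\<^sup>2 = (norm z)\<^sup>2 + (norm w)\<^sup>2"
proof -
  have "herm (join z w :: complex^('n + 'n)) (join z w) = herm z z + herm w w"
    by (simp add: herm_def sum_UNIV_sum)
  then show ?thesis unfolding herm_self of_real_add[symmetric] of_real_eq_iff .
qed

lemma continuous_on_join [continuous_intros]:
  assumes "continuous_on S f" "continuous_on S g"
  shows "continuous_on S (\<lambda>x. join (f x) (g x) :: complex^('n::finite + 'n))"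
proof -
  have "continuous_on S (\<lambda>x. \<chi> i. join (f x) (g x) $ i)"
  proof (intro continuous_on_vec_lambda)
    fix i :: "'n + 'n"
    show "continuous_on S (\<lambda>x. join (f x) (g x) $ i)"
      by (cases i) (auto intro!: continuous_intros assms)
  qed
  then show ?thesis by simp
qed

lemma cnj_vec_join: "cnj_vec (join z w) = join (cnj_vec z) (cnj_vec w)"
  by (auto simp: vec_eq_iff join_def split: sum.splits)

lemma norm_cnj_vec [simp]: "norm (cnj_vec z) = norm z"
proof -
  have "herm (cnj_vec z) (cnj_vec z) = herm z z" by (simp add: herm_def mult.commute)
  then show ?thesis unfolding herm_self of_real_eq_iff by simp
qed

lemma continuous_on_cnj_vec [continuous_intros]:
  "continuous_on S f \<Longrightarrow> continuous_on S (\<lambda>x. cnj_vec (f x))"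
  unfolding cnj_vec_def by (intro continuous_intros)

lemma mon_join:
  fixes z w :: "complex^'n"
  shows "mon k (join z w) = mon (\<lambda>i. k (Inl i)) z * mon (\<lambda>i. k (Inr i)) w"
  by (simp add: mon_def prod_UNIV_sum)

lemma mon_cnj_vec: "mon k (cnj_vec v) = cnj (mon k v)"
  by (simp add: mon_def)

lemma gauss_mon_integrable: "integrable gauss (\<lambda>z :: complex^'m. cnj (mon a z) * mon b z)"
proof -
  obtain C D where C: "\<And>v :: complex^'m. norm (mon a v) \<le> C * exp ((norm v)\<^sup>2 / 16)"
    "\<And>v :: complex^'m. norm (mon b v) \<le> D * exp ((norm v)\<^sup>2 / 16)"
    using exp_bounded_mon unfolding exp_bounded_def by metis
  show ?thesis
  proof (rule gauss_integrable[where b = "1 / 8" and C = "C * D"])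
    fix z :: "complex^'m"
    have "norm (cnj (mon a z) * mon b z) \<le> (C * exp ((norm z)\<^sup>2 / 16)) * (D * exp ((norm z)\<^sup>2 / 16))"
      unfolding norm_mult complex_mod_cnj using C(1)[of z] C(2)[of z]
      by (intro mult_mono) (auto intro: order.trans[OF norm_ge_zero])
    also have "\<dots> = C * D * exp (1 / 8 * (norm z)\<^sup>2)"
      by (simp add: mult_ac exp_add[symmetric])
    finally show "norm (cnj (mon a z) * mon b z) \<le> C * D * exp (1 / 8 * (norm z)\<^sup>2)" .
  qed (auto intro!: continuous_intros)
qed

text \<open>Rotating coordinate \<open>j\<close> by \<open>c\<close> preserves the Gaussian measure
  and multiplies the integrand by \<open>cnj c ^ a j * c ^ b j\<close>; the angle makes this factor
  \<open>-1\<close>.\<close>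

lemma gauss_moment_0:
  assumes "a \<noteq> b"
  shows "(\<integral>(z :: complex^'m). cnj (mon a z) * mon b z \<partial>gauss) = 0"
proof -
  obtain j where j: "a j \<noteq> b j" using assms by auto
  define c where "c = cis (pi / (real (b j) - real (a j)))"
  define T where "T = (\<lambda>z :: complex^'m. \<chi> i. (if i = j then c else 1) * z $ i)"
  have "orthogonal_transformation T"
    unfolding orthogonal_transformation_def
  proof (intro conjI allI)
    show "linear T" by (rule linearI) (simp_all add: T_def vec_eq_iff algebra_simps)
    fix v w
    have "herm (T v) (T w) = herm v w"
      unfolding herm_def T_def by (intro sum.cong) (auto simp: c_def cis_cnj cis_mult mult_ac) 
    then show "T v \<bullet> T w = v \<bullet> w" by (simp add: inner_herm)
  qed
  then have "(\<integral>z. cnj (mon a (T z)) * mon b (T z) \<partial>gauss) = (\<integral>z. cnj (mon a z) * mon b z \<partial>gauss)"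
    by (rule gauss_invariant) (auto intro!: borel_measurable_continuous_onI continuous_intros)
  moreover have mT: "mon k (T z) = c ^ k j * mon k z" for k z
  proof -
    have "mon k (T z) = (\<Prod>i\<in>UNIV. (if i = j then c ^ k j else 1) * (z $ i) ^ k i)"
      unfolding mon_def T_def by (intro prod.cong) (auto simp: power_mult_distrib)
    then show ?thesis by (simp add: prod.distrib mon_def)
  qed
  moreover have "cnj c ^ a j * c ^ b j = -1"
  proof -
    have "cnj c ^ a j * c ^ b j = cis (real (a j) * - (pi / (real (b j) - real (a j))) + real (b j) *
        (pi / (real (b j) - real (a j))))"
      unfolding c_def by (simp only: cis_cnj Complex.DeMoivre cis_mult)
    also have "real (a j) * - (pi / (real (b j) - real (a j))) + real (b j) * (pi / (real (b j) - real
        (a j))) =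
        (real (b j) - real (a j)) * (pi / (real (b j) - real (a j)))"
      by (simp only: left_diff_distrib)
    also have "\<dots> = pi" using j by simp
    finally show ?thesis by (simp only: cis_pi)
  qed
  moreover have "cnj (c ^ a j * mon a z) * (c ^ b j * mon b z) = (cnj c ^ a j * c ^ b j) * (cnj (mon a
      z) * mon b z)" for z
    by (simp add: mult_ac)
  ultimately have "- (\<integral>z. cnj (mon a z) * mon b z \<partial>gauss) = (\<integral>(z :: complex^'m). cnj (mon a z) * mon b z
      \<partial>gauss)"
    by (simp only: mult_minus1) simp
  then show ?thesis by simp
qed

text \<open>A zero integral would make \<open>mon a\<close> vanish almost everywhere, but it has no
  zero in the open unit ball around the all-ones vector.\<close>

lemma gauss_moment_nonzero: "(\<integral>(z :: complex^'m). cnj (mon a z) * mon a z \<partial>gauss) \<noteq> 0"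
proof
  assume z: "(\<integral>(z :: complex^'m). cnj (mon a z) * mon a z \<partial>gauss) = 0"
  have eq: "cnj (mon a z) * mon a z = complex_of_real ((norm (mon a z))\<^sup>2)" for z :: "complex^'m"
    by (simp only: complex_norm_square mult.commute)
  have int: "integrable gauss (\<lambda>z :: complex^'m. (norm (mon a z))\<^sup>2)"
    using gauss_mon_integrable[of a a] unfolding eq by (simp only: complex_of_real_integrable_eq)
  have "(\<integral>(z :: complex^'m). (norm (mon a z))\<^sup>2 \<partial>gauss) = 0"
    using z unfolding eq by (simp only: integral_complex_of_real of_real_eq_0_iff)
  then have "AE z :: complex^'m in gauss. (norm (mon a z))\<^sup>2 = 0"
    using integral_nonneg_eq_0_iff_AE[OF int] by auto
  then have "AE z :: complex^'m in lborel. 0 < ennreal (gauss_dens z) \<longrightarrow> mon a z = 0"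
    unfolding gauss_alt by (subst (asm) AE_density) auto
  moreover have "0 < gauss_dens z" for z :: "complex^'m" by (simp add: gauss_dens_def gauss_norm_pos)
  ultimately have ae: "AE z :: complex^'m in lborel. mon a z = 0" by simp
  define b :: "complex^'m" where "b = (\<chi> i. 1)"
  have ne: "mon a z \<noteq> 0" if "z \<in> ball b 1" for z
  proof -
    have "z $ i \<noteq> 0" for i
    proof
      assume "z $ i = 0"
      then have "norm ((b - z) $ i) = 1" by (simp add: b_def)
      then show False using that Finite_Cartesian_Product.norm_nth_le[of "b - z" i] by (simp add: dist_norm)
    qed
    then show ?thesis by (simp add: mon_def)
  qed
  have "AE z in lborel. z \<notin> ball b 1" using ae by eventually_elim (use ne in auto)
  then have "emeasure lborel (ball b 1) = 0"
    by (subst (asm) AE_iff_measurable[of "ball b 1"]) auto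
  then show False using unit_ball_vol_pos[of "real DIM(complex^'m)"] by (simp add: emeasure_ball)
qed

definition moment :: "(('n::finite + 'n) \<Rightarrow> nat) \<Rightarrow> complex" where
  "moment b = (\<integral>(z :: complex^'n). cnj (mon (\<lambda>i. b (Inl i)) z) * mon (\<lambda>i. b (Inl i)) z \<partial>gauss) *
     (\<integral>(z :: complex^'n). cnj (mon (\<lambda>i. b (Inr i)) z) * mon (\<lambda>i. b (Inr i)) z \<partial>gauss)"

lemma moment_nonzero: "moment b \<noteq> 0"
  by (simp add: moment_def gauss_moment_nonzero)

lemma exp_bounded_pair:
  fixes f :: "complex^('n::finite + 'n) \<Rightarrow> complex"
  assumes f: "exp_bounded f" and g: "continuous_on UNIV g"
    and gb: "\<And>v. norm (g v) \<le> D * exp ((norm v)\<^sup>2 / 4)"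
  shows "integrable (gauss \<Otimes>\<^sub>M gauss) (\<lambda>(z, w). g (join z w) * f (join z w))"
proof -
  obtain C where C: "\<And>v. norm (f v) \<le> C * exp ((norm v)\<^sup>2 / 16)" and cf: "continuous_on UNIV f"
    using f unfolding exp_bounded_def by blast
  show ?thesis
  proof (rule gauss_pair_integrable[where b = "5 / 16" and C = "D * C"])
    show "continuous_on UNIV (\<lambda>(z, w). g (join z w) * f (join z w))"
      unfolding case_prod_unfold
      by (intro continuous_intros continuous_on_compose2[OF cf] continuous_on_compose2[OF g]) auto
    fix z w :: "complex^'n"
    let ?v = "join z w"
    have "norm (g ?v * f ?v) \<le> (D * exp ((norm ?v)\<^sup>2 / 4)) * (C * exp ((norm ?v)\<^sup>2 / 16))"
      unfolding norm_mult using C[of ?v] gb[of ?v]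
      by (intro mult_mono) (auto intro: order.trans[OF norm_ge_zero])
    also have "\<dots> = D * C * (exp ((norm ?v)\<^sup>2 / 4) * exp ((norm ?v)\<^sup>2 / 16))" by (simp add: mult_ac)
    also have "exp ((norm ?v)\<^sup>2 / 4) * exp ((norm ?v)\<^sup>2 / 16) = exp (5 / 16 * (norm ?v)\<^sup>2)"
      by (simp add: exp_add[symmetric])
    finally show "norm (case (z, w) of (z, w) \<Rightarrow> g (join z w) * f (join z w)) \<le>
        D * C * exp (5 / 16 * ((norm z)\<^sup>2 + (norm w)\<^sup>2))"
      by (simp add: norm_join)
  qed simp
qed

lemma exp_bounded_le: 
  assumes "exp_bounded f" obtains D where "\<And>v. norm (f v) \<le> D * exp ((norm v)\<^sup>2 / 4)"
proof -
  obtain C where C: "\<And>v. norm (f v) \<le> C * exp ((norm v)\<^sup>2 / 16)"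
    using assms unfolding exp_bounded_def by blast
  have "norm (f v) \<le> \<bar>C\<bar> * exp ((norm v)\<^sup>2 / 4)" for v
    by (rule order.trans[OF C]) (intro mult_mono, auto)
  then show thesis by (rule that)
qed

lemma pair_moment:
  fixes a b :: "('n::finite + 'n) \<Rightarrow> nat"
  shows "integrable (gauss \<Otimes>\<^sub>M gauss) (\<lambda>(z, w). cnj (mon a (join z w)) * mon b (join z w))" (is ?int)
    and "(\<integral>(z, w). cnj (mon a (join z w)) * mon b (join z w) \<partial>(gauss \<Otimes>\<^sub>M gauss)) = (if a = b then moment
        b else 0)"
      (is ?eq)
proof -
  obtain D where D: "\<And>v :: complex^('n + 'n). norm (mon a v) \<le> D * exp ((norm v)\<^sup>2 / 4)"
    using exp_bounded_le[OF exp_bounded_mon] by blast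
  show ?int
    by (rule exp_bounded_pair[where D = D]) (auto intro!: continuous_intros exp_bounded_mon simp: D)
  define L where "L a b = (\<integral>(z :: complex^'n). cnj (mon a z) * mon b z \<partial>gauss)" for a b
  have "(\<integral>(z, w). cnj (mon a (join z w)) * mon b (join z w) \<partial>(gauss \<Otimes>\<^sub>M gauss)) =
      (\<integral>z. \<integral>w. cnj (mon a (join z w)) * mon b (join z w) \<partial>gauss \<partial>gauss)"
    using gauss_pair.integral_fst'[OF \<open>?int\<close>] by simp
  also have "\<dots> = (\<integral>(z :: complex^'n). \<integral>(w :: complex^'n). (cnj (mon (\<lambda>i. a (Inl i)) z) * mon (\<lambda>i. b (Inl
      i)) z) *
      (cnj (mon (\<lambda>i. a (Inr i)) w) * mon (\<lambda>i. b (Inr i)) w) \<partial>gauss \<partial>gauss)"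
    by (simp add: mon_join mult_ac)
  also have "\<dots> = L (\<lambda>i. a (Inl i)) (\<lambda>i. b (Inl i)) * L (\<lambda>i. a (Inr i)) (\<lambda>i. b (Inr i))"
    by (simp add: L_def)
  also have "\<dots> = (if a = b then moment b else 0)"
  proof (cases "a = b")
    case True
    then show ?thesis by (simp add: moment_def L_def)
  next
    case False
    then obtain x where x: "a x \<noteq> b x" by auto
    then have "(\<lambda>i. a (Inl i)) \<noteq> (\<lambda>i. b (Inl i)) \<or> (\<lambda>i. a (Inr i)) \<noteq> (\<lambda>i. b (Inr i))"
      by (cases x) (auto simp: fun_eq_iff)
    then show ?thesis using False by (auto simp: L_def gauss_moment_0)
  qed
  finally show ?eq .
qed

subsection \<open>The transform of a polynomial\<close>

lemma norm_quad_form_le: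
  assumes "s \<in> unitary_group" shows "norm (quad_form s v) \<le> (norm v)\<^sup>2"
proof -
  have n: "norm v = L2_set (\<lambda>i. norm (v $ i)) UNIV" for v :: "complex^'a"
    by (simp add: norm_vec_def)
  have "norm (quad_form s v) \<le> (\<Sum>i\<in>UNIV. \<bar>norm (v $ i)\<bar> * \<bar>norm ((s *v v) $ i)\<bar>)"
    unfolding quad_form_def by (rule order.trans[OF norm_sum]) (simp add: norm_mult)
  also have "\<dots> \<le> L2_set (\<lambda>i. norm (v $ i)) UNIV * L2_set (\<lambda>i. norm ((s *v v) $ i)) UNIV"
    by (rule L2_set_mult_ineq)
  also have "\<dots> = norm v * norm (s *v v)" by (simp only: n)
  finally show ?thesis by (simp add: norm_unitary[OF assms] power2_eq_square)
qed

lemma continuous_on_quad_form_vec [continuous_intros]: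
  "continuous_on S f \<Longrightarrow> continuous_on S (\<lambda>x. quad_form s (f x))"
  unfolding quad_form_sum by (intro continuous_intros)

definition kern :: "complex^'m^'m \<Rightarrow> complex^'m \<Rightarrow> complex" where
  "kern s v = exp (1 / 4 * quad_form s (cnj_vec v))"

lemma continuous_on_kern: "continuous_on UNIV (kern s)"
  unfolding kern_def by (intro continuous_intros)

lemma norm_kern_le:
  assumes "s \<in> unitary_group" shows "norm (kern s v) \<le> 1 * exp ((norm v)\<^sup>2 / 4)"
proof -
  have "norm (kern s v) \<le> exp (norm (1 / 4 * quad_form s (cnj_vec v)))"
    unfolding kern_def by (rule norm_exp)
  also have "\<dots> \<le> exp ((norm v)\<^sup>2 / 4)"
    using norm_quad_form_le[OF assms, of "cnj_vec v"] by (simp add: norm_mult)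
  finally show ?thesis by simp
qed

lemma WW_eq: "WW f s = (if s \<in> sym_unitary then
    (\<integral>(z, w). kern s (join z w) * f (join z w) \<partial>(gauss \<Otimes>\<^sub>M gauss)) else 0)"
  by (simp add: WW_def kern_def cnj_vec_join)

lemma WW_integrable:
  fixes f :: "complex^('n::finite + 'n) \<Rightarrow> complex"
  assumes "s \<in> sym_unitary" "f \<in> polys"
  shows "integrable (gauss \<Otimes>\<^sub>M gauss) (\<lambda>(z, w). kern s (join z w) * f (join z w))"
  using assms
  by (intro exp_bounded_pair[where D = 1] exp_bounded_polys continuous_on_kern norm_kern_le)
    (auto simp: sym_unitary_iff)

lemma polys_subspace: "cfun.subspace polys"
  by (simp add: polys_eq cfun.subspace_span)

lemma WW_add:
  fixes f g :: "complex^('n::finite + 'n) \<Rightarrow> complex"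
  assumes "f \<in> polys" "g \<in> polys" shows "WW (f + g) = WW f + WW g"
proof
  fix s :: "complex^('n + 'n)^('n + 'n)"
  show "WW (f + g) s = (WW f + WW g) s"
  proof (cases "s \<in> sym_unitary")
    case True
    have "(\<integral>x. (case x of (z, w) \<Rightarrow> kern s (join z w) * f (join z w)) +
        (case x of (z, w) \<Rightarrow> kern s (join z w) * g (join z w)) \<partial>(gauss \<Otimes>\<^sub>M gauss)) = WW f s + WW g s"
      using True by (subst Bochner_Integration.integral_add) (auto simp: WW_eq intro!: WW_integrable assms)
    then show ?thesis using True by (simp add: WW_eq case_prod_unfold distrib_left)
  qed (simp add: WW_eq)
qed

lemma WW_scale: "WW (cscale c f) = cscale c (WW f)"
proof
  fix s :: "complex^('a + 'a)^('a + 'a)"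
  have "(\<integral>(z, w). kern s (join z w) * cscale c f (join z w) \<partial>(gauss \<Otimes>\<^sub>M gauss)) =
      (\<integral>x. c * (case x of (z, w) \<Rightarrow> kern s (join z w) * f (join z w)) \<partial>(gauss \<Otimes>\<^sub>M gauss))"
    by (rule Bochner_Integration.integral_cong) (auto simp: cscale_apply mult_ac)
  then show "WW (cscale c f) s = cscale c (WW f) s" by (simp add: WW_eq cscale_apply)
qed

lemma WW_0: "WW 0 = 0"
  using WW_scale[of 0 0] by (simp only: cfun.scale_zero_left)

lemma WW_mon:
  fixes b :: "('n::finite + 'n) \<Rightarrow> nat"
  shows "WW (mon b) = (if even (sum b UNIV) then
    cscale (moment b / (4 ^ (sum b UNIV div 2) * fact (sum b UNIV div 2))) (qcoeff (sum b UNIV div 2) b)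
        else 0)"
proof
  fix s :: "complex^('n + 'n)^('n + 'n)"
  let ?d = "sum b UNIV"
  let ?M = "gauss \<Otimes>\<^sub>M gauss :: ((complex^'n) \<times> (complex^'n)) measure"
  show "WW (mon b) s = (if even ?d then
    cscale (moment b / (4 ^ (?d div 2) * fact (?d div 2))) (qcoeff (?d div 2) b) else 0) s"
  proof (cases "s \<in> sym_unitary")
    case False
    then have "qcoeff m b s = 0" for m by (simp add: qcoeff_def sum_fun_apply cscale_apply qpow_def)
    then show ?thesis using False by (simp add: WW_eq cscale_apply)
  next
    case True
    then have su: "s \<in> unitary_group" by (simp add: sym_unitary_iff)
    define I where "I m = (\<integral>(z, w). quad_form s (cnj_vec (join z w)) ^ m * mon b (join z w) \<partial>?M)" for m
    have qexp: "quad_form s (cnj_vec v) ^ m * mon b v =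
        (\<Sum>k\<in>expos (2 * m). qcoeff m k s * (cnj (mon k v) * mon b v))" for m v
    proof -
      have "quad_form s (cnj_vec v) ^ m = (\<Sum>k\<in>expos (2 * m). cnj (mon k v) * qcoeff m k s)"
        using fun_cong[OF qpow_expand[of m "cnj_vec v"], of s] True
        by (simp add: qpow_def sum_fun_apply cscale_apply mon_cnj_vec)
      then show ?thesis by (simp only: sum_distrib_right) (simp only: mult_ac)
    qed
    have int: "integrable ?M (\<lambda>(z, w). quad_form s (cnj_vec (join z w)) ^ m * mon b (join z w))" for m
      unfolding qexp case_prod_unfold
      using pair_moment(1)[of _ b] by (intro Bochner_Integration.integrable_sum
          Bochner_Integration.integrable_mult_right) (auto simp: case_prod_unfold)
    have Im: "I m = (if ?d = 2 * m then qcoeff m b s * moment b else 0)" for m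
    proof -
      have "I m = (\<Sum>k\<in>expos (2 * m). qcoeff m k s *
          (\<integral>(z, w). cnj (mon k (join z w)) * mon b (join z w) \<partial>?M))"
        unfolding I_def qexp case_prod_unfold
        using pair_moment(1)[of _ b] by (subst Bochner_Integration.integral_sum) (auto simp: case_prod_unfold)
      also have "\<dots> = (\<Sum>k\<in>expos (2 * m). if k = b then qcoeff m b s * moment b else 0)"
        unfolding pair_moment(2) by (intro sum.cong) auto
      also have "\<dots> = (if b \<in> expos (2 * m) then qcoeff m b s * moment b else 0)"
        by (rule sum.delta) simp
      finally show ?thesis by (simp add: expos_def)
    qed
    define S where "S j = (\<lambda>(z, w). (\<Sum>m<j. (1 / 4 * quad_form s (cnj_vec (join z w))) ^ m /\<^sub>R fact m) *
        mon b (join z w :: complex^('n + 'n)))" for j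
    have Sj: "(\<integral>x. S j x \<partial>?M) = (\<Sum>m<j. 1 / (4 ^ m * fact m) * I m)" for j
    proof -
      have "S j x = (\<Sum>m<j. 1 / (4 ^ m * fact m) *
          (case x of (z, w) \<Rightarrow> quad_form s (cnj_vec (join z w)) ^ m * mon b (join z w)))" for x
        unfolding S_def case_prod_unfold sum_distrib_right
        by (intro sum.cong) (simp_all add: scaleR_conv_of_real power_mult_distrib power_divide field_simps)
      then show ?thesis unfolding I_def using int by (simp add: Bochner_Integration.integral_sum)
    qed
    \<comment> \<open>Since \<open>s\<close> is unitary, the partial sums are bounded by
      \<open>exp ((norm v)^2 / 4)\<close>, which is integrable against the monomial.\<close>
    have "(\<lambda>j. \<integral>x. S j x \<partial>?M) \<longlonglongrightarrow> (\<integral>(z, w). kern s (join z w) * mon b (join z w) \<partial>?M)"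
    proof (rule integral_dominated_convergence)
      obtain C where C: "\<And>v :: complex^('n + 'n). norm (mon b v) \<le> C * exp ((norm v)\<^sup>2 / 16)"
        using exp_bounded_mon unfolding exp_bounded_def by metis
      show "integrable ?M (\<lambda>(z, w). norm (complex_of_real (exp ((norm (join z w :: complex^('n + 'n)))\<^sup>2
          / 4)) * mon b (join z w)))"
      proof -
        have "continuous_on UNIV (\<lambda>v :: complex^('n + 'n). complex_of_real (exp ((norm v)\<^sup>2 / 4)))"
          by (intro continuous_intros) simp
        from integrable_norm[OF exp_bounded_pair[OF exp_bounded_mon[of b] this, of 1]]
        show ?thesis by (simp add: case_prod_unfold)
      qed
      show "S j \<in> borel_measurable ?M" for j
        unfolding S_def measurable_cong_sets[OF sets_gauss_pair refl] case_prod_unfold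
        by (intro borel_measurable_continuous_onI continuous_intros)
      show "(\<lambda>(z, w). kern s (join z w) * mon b (join z w)) \<in> borel_measurable ?M"
        unfolding measurable_cong_sets[OF sets_gauss_pair refl] case_prod_unfold
        by (intro borel_measurable_continuous_onI continuous_intros continuous_on_compose2[OF
            continuous_on_kern]) auto
      show "AE x in ?M. (\<lambda>j. S j x) \<longlonglongrightarrow> (case x of (z, w) \<Rightarrow> kern s (join z w) * mon b (join z w))"
      proof (rule AE_I2)
        fix x :: "(complex^'n) \<times> (complex^'n)"
        have "(\<lambda>j. \<Sum>m<j. (1 / 4 * quad_form s (cnj_vec (join (fst x) (snd x)))) ^ m /\<^sub>R fact m)
            \<longlonglongrightarrow> kern s (join (fst x) (snd x))"
          using exp_converges[of "1 / 4 * quad_form s (cnj_vec (join (fst x) (snd x)))"]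
          unfolding sums_def kern_def .
        then show "(\<lambda>j. S j x) \<longlonglongrightarrow> (case x of (z, w) \<Rightarrow> kern s (join z w) * mon b (join z w))"
          unfolding S_def case_prod_unfold by (intro tendsto_intros)
      qed
      show "AE x in ?M. norm (S j x) \<le>
          (case x of (z, w) \<Rightarrow> norm (complex_of_real (exp ((norm (join z w :: complex^('n + 'n)))\<^sup>2 / 4))
              * mon b (join z w)))" for j
      proof (rule AE_I2)
        fix x :: "(complex^'n) \<times> (complex^'n)"
        obtain z w where x: "x = (z, w)" by (cases x)
        let ?q = "1 / 4 * quad_form s (cnj_vec (join z w))"
        have nq: "norm ?q \<le> (norm (join z w :: complex^('n + 'n)))\<^sup>2 / 4"
          using norm_quad_form_le[OF su, of "cnj_vec (join z w)"] by (simp add: norm_mult)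
        have "norm (\<Sum>m<j. ?q ^ m /\<^sub>R fact m) \<le> (\<Sum>m<j. norm ?q ^ m /\<^sub>R fact m)"
          by (rule order.trans[OF norm_sum]) (simp add: norm_power)
        also have "\<dots> \<le> exp (norm ?q)"
          by (rule sum_le_exp) auto
        also have "\<dots> \<le> exp ((norm (join z w :: complex^('n + 'n)))\<^sup>2 / 4)" using nq by simp
        finally show "norm (S j x) \<le> (case x of (z, w) \<Rightarrow>
            norm (complex_of_real (exp ((norm (join z w :: complex^('n + 'n)))\<^sup>2 / 4)) * mon b (join z w)))"
          by (simp add: x S_def norm_mult mult_right_mono)
      qed
    qed
    \<comment> \<open>By orthogonality at most the term \<open>m = ?d div 2\<close> survives, so the
      integrals are constant once \<open>j\<close> exceeds \<open>?d\<close>.\<close>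
    moreover have "(\<lambda>j. \<integral>x. S j x \<partial>?M) \<longlonglongrightarrow>
        (if even ?d then moment b / (4 ^ (?d div 2) * fact (?d div 2)) * qcoeff (?d div 2) b s else 0)"
    proof (rule tendsto_eventually)
      have "(\<Sum>m<j. 1 / (4 ^ m * fact m) * I m) =
          (if even ?d then moment b / (4 ^ (?d div 2) * fact (?d div 2)) * qcoeff (?d div 2) b s else 0)"
        if j: "?d < j" for j
      proof -
        have "(\<Sum>m<j. 1 / (4 ^ m * fact m) * I m) =
            (\<Sum>m<j. if m = ?d div 2 then (if even ?d then moment b / (4 ^ (?d div 2) * fact (?d div 2)) *
                qcoeff (?d div 2) b s else 0) else 0)"
          by (intro sum.cong) (auto simp: Im)
        also have "\<dots> = (if even ?d then moment b / (4 ^ (?d div 2) * fact (?d div 2)) * qcoeff (?d div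
            2) b s else 0)"
          using j by (subst sum.delta) auto
        finally show ?thesis .
      qed
      then show "\<forall>\<^sub>F j in sequentially. (\<integral>x. S j x \<partial>?M) =
          (if even ?d then moment b / (4 ^ (?d div 2) * fact (?d div 2)) * qcoeff (?d div 2) b s else 0)"
        unfolding Sj by (intro eventually_sequentiallyI[of "Suc ?d"]) simp
    qed
    ultimately have "(\<integral>(z, w). kern s (join z w) * mon b (join z w) \<partial>?M) =
        (if even ?d then moment b / (4 ^ (?d div 2) * fact (?d div 2)) * qcoeff (?d div 2) b s else 0)"
      by (rule LIMSEQ_unique)
    then show ?thesis using True by (simp add: WW_eq cscale_apply)
  qed
qed

theorem W1_eq: "(W1 :: (complex^('n::finite + 'n)^('n + 'n) \<Rightarrow> complex) set) = cfun.span (\<Union>i. qspace i)"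
proof
  have "f \<in> polys \<and> WW f \<in> cfun.span (\<Union>i. qspace i)" if "f \<in> cfun.span (range mon)"
    for f :: "complex^('n + 'n) \<Rightarrow> complex"
    using that
  proof (induction rule: cfun.span_induct_alt)
    case base
    then show ?case by (simp only: WW_0 cfun.span_zero polys_eq)
  next
    case (step c b h)
    then obtain k where b: "b = mon k" by blast
    have "WW (mon k) \<in> cfun.span (\<Union>i. qspace i)"
    proof (cases "even (sum k UNIV)")
      case True
      then have "k \<in> expos (2 * (sum k UNIV div 2))" by (simp add: expos_def)
      then have "qcoeff (sum k UNIV div 2) k \<in> qspace (sum k UNIV div 2)"
        unfolding qspace_alt by (intro cfun.span_base imageI)
      then have "qcoeff (sum k UNIV div 2) k \<in> cfun.span (\<Union>i. qspace i)" by (intro cfun.span_base) blast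
      then show ?thesis unfolding WW_mon using True by (simp only: if_True cfun.span_scale)
    next
      case False
      then show ?thesis unfolding WW_mon by (simp only: if_False cfun.span_zero)
    qed
    moreover have p: "b \<in> polys" "cscale c b \<in> polys" "h \<in> polys"
      using step by (simp_all add: polys_eq cfun.span_base cfun.span_scale)
    moreover have "WW (cscale c b + h) = cscale c (WW b) + WW h"
      using p(2,3) by (simp only: WW_add WW_scale)
    moreover have "cscale c b + h \<in> polys" using cfun.subspace_add[OF polys_subspace p(2,3)] .
    ultimately show ?case unfolding b using step by (simp only: cfun.span_add cfun.span_scale)
  qed
  then show "W1 \<subseteq> (cfun.span (\<Union>i. qspace i) :: (complex^('n + 'n)^('n + 'n) \<Rightarrow> complex) set)"
    unfolding W1_def polys_eq by (intro cfun.span_minimal cfun.subspace_span) blast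
  have "qcoeff i k \<in> W1" if k: "k \<in> expos (2 * i)" for i and k :: "('n + 'n) \<Rightarrow> nat"
  proof -
    have s: "sum k UNIV = 2 * i" using k by (simp add: expos_def)
    have "mon k \<in> polys" unfolding polys_eq by (intro cfun.span_base) simp
    then have "WW (mon k) \<in> W1" unfolding W1_def by (intro cfun.span_base) blast
    \<comment> \<open>Inverts the factor in \<open>WW_mon\<close>, which is nonzero because the
      moment is.\<close>
    then have "cscale (4 ^ i * fact i / moment k) (WW (mon k)) \<in> W1" unfolding W1_def by (rule
        cfun.span_scale)
    then show ?thesis using moment_nonzero[of k] by (simp add: WW_mon s cfun.scale_scale)
  qed
  then have "qspace i \<subseteq> (W1 :: (complex^('n + 'n)^('n + 'n) \<Rightarrow> complex) set)" for i
    unfolding qspace_alt W1_def by (intro cfun.span_minimal cfun.subspace_span) blast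
  then show "(cfun.span (\<Union>i. qspace i) :: (complex^('n + 'n)^('n + 'n) \<Rightarrow> complex) set) \<subseteq> W1"
    by (intro cfun.span_minimal) (auto simp: W1_def cfun.subspace_span)
qed

subsection \<open>Block matrices and the complex form of a real matrix\<close>

text \<open>
  On \<open>z = x - i y\<close> a real \<open>2n \<times> 2n\<close> matrix acts as \<open>z \<mapsto> P z + Q cnj z\<close>, with \<open>P = C_part g\<close>.
\<close>

definition Q_part :: "real^('n::finite + 'n)^('n + 'n) \<Rightarrow> complex^'n^'n" where
  "Q_part g = (\<chi> i j. Complex ((g $ Inl i $ Inl j - g $ Inr i $ Inr j) / 2)
                              (- (g $ Inl i $ Inr j + g $ Inr i $ Inl j) / 2))"

lemma parts_inject:
  assumes "C_part g = C_part h" "Q_part g = Q_part h" shows "g = h"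
proof -
  have "g $ i $ j = h $ i $ j" for i j
  proof -
    define a where "a = (case i of Inl x \<Rightarrow> x | Inr x \<Rightarrow> x)"
    define b where "b = (case j of Inl x \<Rightarrow> x | Inr x \<Rightarrow> x)"
    have "C_part g $ a $ b = C_part h $ a $ b" "Q_part g $ a $ b = Q_part h $ a $ b" using assms by simp_all
    then show ?thesis
      by (cases i; cases j) (auto simp: C_part_def Q_part_def a_def b_def field_simps)
  qed
  then show ?thesis by (simp add: vec_eq_iff)
qed

text \<open>Composition of maps \<open>z \<mapsto> P z + Q cnj z\<close>: conjugating the inner map
  exchanges the roles of its two parts.\<close>

lemma parts_mult:
  "C_part (g ** h) = C_part g ** C_part h + Q_part g ** cnj_mat (Q_part h)"
  "Q_part (g ** h) = C_part g ** Q_part h + Q_part g ** cnj_mat (C_part h)"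
proof -
  have half: "(\<Sum>k\<in>A. f k) / 2 = (\<Sum>k\<in>A. f k / 2)" for f :: "'x \<Rightarrow> real" and A by (rule sum_divide_distrib)
  have "C_part (g ** h) $ i $ j = (C_part g ** C_part h + Q_part g ** cnj_mat (Q_part h)) $ i $ j" for i j
    by (simp add: complex_eq_iff C_part_def Q_part_def matrix_mult_nth sum_UNIV_sum half
      sum.distrib[symmetric] sum_subtractf[symmetric]) (auto intro!: sum.cong simp: field_simps)
  then show "C_part (g ** h) = C_part g ** C_part h + Q_part g ** cnj_mat (Q_part h)"
    by (simp add: vec_eq_iff)
  have "Q_part (g ** h) $ i $ j = (C_part g ** Q_part h + Q_part g ** cnj_mat (C_part h)) $ i $ j" for i j
    by (simp add: complex_eq_iff C_part_def Q_part_def matrix_mult_nth sum_UNIV_sum half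
      sum.distrib[symmetric] sum_subtractf[symmetric] sum_negf[symmetric]) (auto intro!: sum.cong simp:
          field_simps)
  then show "Q_part (g ** h) = C_part g ** Q_part h + Q_part g ** cnj_mat (C_part h)"
    by (simp add: vec_eq_iff)
qed

lemma parts_1: "C_part (mat 1) = mat 1" "Q_part (mat 1) = 0"
  by (simp_all add: vec_eq_iff C_part_def Q_part_def mat_nth complex_eq_iff)

lemma block_mat_nth [simp]:
  "block_mat A B C D $ Inl i $ Inl j = A $ i $ j" "block_mat A B C D $ Inl i $ Inr j = B $ i $ j"
  "block_mat A B C D $ Inr i $ Inl j = C $ i $ j" "block_mat A B C D $ Inr i $ Inr j = D $ i $ j"
  by (simp_all add: block_mat_def)

lemma vec_eq_sum_iff:
  "(A :: 'a^('n::finite + 'n)^('n + 'n)) = B \<longleftrightarrow> (\<forall>i j. A $ Inl i $ Inl j = B $ Inl i $ Inl j \<and>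
     A $ Inl i $ Inr j = B $ Inl i $ Inr j \<and> A $ Inr i $ Inl j = B $ Inr i $ Inl j \<and>
     A $ Inr i $ Inr j = B $ Inr i $ Inr j)"
proof
  assume *: "\<forall>i j. A $ Inl i $ Inl j = B $ Inl i $ Inl j \<and>
     A $ Inl i $ Inr j = B $ Inl i $ Inr j \<and> A $ Inr i $ Inl j = B $ Inr i $ Inl j \<and>
     A $ Inr i $ Inr j = B $ Inr i $ Inr j"
  have "A $ i $ j = B $ i $ j" for i j using * by (cases i; cases j) auto
  then show "A = B" by (simp add: vec_eq_iff)
qed simp

lemma block_mat_eq_iff: "block_mat A B C D = block_mat A' B' C' D' \<longleftrightarrow> A = A' \<and> B = B' \<and> C = C' \<and> D = D'"
  unfolding vec_eq_sum_iff by (auto simp: vec_eq_iff)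

lemma block_mat_mult:
  fixes A B C D :: "'a::semiring_1^'n::finite^'n"
  shows "block_mat A B C D ** block_mat A' B' C' D' =
    block_mat (A ** A' + B ** C') (A ** B' + B ** D') (C ** A' + D ** C') (C ** B' + D ** D')"
  unfolding vec_eq_sum_iff by (simp add: matrix_mult_nth sum_UNIV_sum)

lemma block_mat_1: "block_mat (mat 1) 0 0 (mat 1) = mat 1"
  unfolding vec_eq_sum_iff by (simp add: mat_nth)

lemma transpose_block_mat: "transpose (block_mat A B C D) = block_mat (transpose A) (transpose C)
    (transpose B) (transpose D)"
  unfolding vec_eq_sum_iff by (simp add: transpose_nth)

lemma adj_block_mat: "adj (block_mat A B C D) = block_mat (adj A) (adj C) (adj B) (adj D)"
  unfolding vec_eq_sum_iff by simp

lemma block_mat_exists: "\<exists>A B C D. s = block_mat A B C D"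
  by (intro exI[of _ "\<chi> i j. s $ Inl i $ Inl j"] exI[of _ "\<chi> i j. s $ Inl i $ Inr j"]
    exI[of _ "\<chi> i j. s $ Inr i $ Inl j"] exI[of _ "\<chi> i j. s $ Inr i $ Inr j"])
    (simp add: vec_eq_sum_iff)

definition dg :: "('m \<Rightarrow> real) \<Rightarrow> complex^'m^'m" where
  "dg f = diag_mat (\<lambda>i. complex_of_real (f i))"

lemma dg_simps: "dg f ** dg g = dg (\<lambda>i. f i * g i)" "cnj_mat (dg f) = dg f" "adj (dg f) = dg f"
  "transpose (dg f) = dg f" "dg (\<lambda>i. 1) = mat 1"
  by (auto simp: dg_def diag_mat_mult adj_diag_mat transpose_diag_mat diag_mat_1 vec_eq_iff diag_mat_nth)

lemma dg_assoc: "A ** dg f ** dg g = A ** dg (\<lambda>i. f i * g i)"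
  by (simp only: matrix_mul_assoc[symmetric] dg_simps)

lemma unitary_cancel:
  assumes "k \<in> unitary_group"
  shows "A ** k ** adj k = A" "A ** adj k ** k = A" "A ** cnj_mat k ** transpose k = A"
    "A ** transpose k ** cnj_mat k = A"
  using unitaryD[OF assms] unitaryD[OF unitary_cnj[OF assms]]
  by (simp_all add: matrix_mul_assoc[symmetric] transpose_adj)

lemma matrix_diff_distrib: "A ** (B - C) = A ** B - A ** C" "(A - B) ** C = A ** C - B ** C"
  for A B C :: "'a::ring_1^'m^'m"
  by (simp_all add: vec_eq_iff matrix_mult_nth sum_subtractf algebra_simps)

lemma parts_realify: "C_part (realify k) = k" "Q_part (realify k) = 0"
  by (simp_all add: realify_def Let_def vec_eq_iff C_part_def Q_part_def complex_eq_iff)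

lemma parts_exp_H: "C_part (exp_H l) = dg (\<lambda>i. cosh (l i))" "Q_part (exp_H l) = dg (\<lambda>i. sinh (l i))"
  by (auto simp: exp_H_def vec_eq_iff C_part_def Q_part_def dg_def diag_mat_nth complex_eq_iff cosh_def
      sinh_def)

lemma parts_KAK:
  "C_part (realify k1 ** exp_H l ** realify k2) = k1 ** dg (\<lambda>i. cosh (l i)) ** k2"
  "Q_part (realify k1 ** exp_H l ** realify k2) = k1 ** dg (\<lambda>i. sinh (l i)) ** cnj_mat k2"
proof -
  have z: "cnj_mat 0 = (0 :: complex^'n^'n)" "0 ** A = (0 :: complex^'n^'n)" "A ** 0 = (0 :: complex^'n^'n)"
    for A :: "complex^'n^'n" by (simp_all add: vec_eq_iff matrix_mult_nth)
  show "C_part (realify k1 ** exp_H l ** realify k2) = k1 ** dg (\<lambda>i. cosh (l i)) ** k2"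
    "Q_part (realify k1 ** exp_H l ** realify k2) = k1 ** dg (\<lambda>i. sinh (l i)) ** cnj_mat k2"
    for k1 k2 :: "complex^'n^'n" and l
    by (simp_all add: parts_mult parts_realify parts_exp_H z)
qed

definition H_block :: "complex^'n^'n \<Rightarrow> complex^'n^'n \<Rightarrow> complex^('n::finite + 'n)^('n + 'n)" where
  "H_block P Q = (let X = matrix_inv P in
     block_mat (cnj_mat Q ** X) (mat (- \<i>) ** transpose X) (mat (- \<i>) ** X) (X ** Q))"

lemma mat_mult_nth: "(mat c ** A) $ i $ j = c * A $ i $ j" "(A ** mat c) $ i $ j = A $ i $ j * (c :: complex)"
  unfolding matrix_mult_nth mat_nth
  by (simp_all add: if_distrib[of "\<lambda>c. c * _"] if_distrib[of "\<lambda>c. _ * c"] cong: if_cong)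

lemma mat_commute: "A ** mat c = mat (c :: complex) ** A"
  by (simp add: vec_eq_iff mat_mult_nth mult.commute)

lemma HH_formula_blocks:
  fixes k1 k2 :: "complex^'n^'n"
  assumes k: "k1 \<in> unitary_group" "k2 \<in> unitary_group"
  shows "HH_formula k1 l k2 = block_mat (cnj_mat k1 ** dg (\<lambda>i. tanh (l i)) ** adj k1)
    (mat (- \<i>) ** (cnj_mat k1 ** dg (\<lambda>i. 1 / cosh (l i)) ** cnj_mat k2))
    (mat (- \<i>) ** (adj k2 ** dg (\<lambda>i. 1 / cosh (l i)) ** adj k1))
    (adj k2 ** dg (\<lambda>i. tanh (l i)) ** cnj_mat k2)"
proof -
  have S: "diag_mat (\<lambda>i. - \<i> * complex_of_real (1 / cosh (l i))) = mat (- \<i>) ** dg (\<lambda>i. 1 / cosh (l i))"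
    by (auto simp: vec_eq_iff mat_mult_nth dg_def diag_mat_nth)
  have z: "0 ** A = (0 :: complex^'n^'n)" "A ** 0 = (0 :: complex^'n^'n)" for A :: "complex^'n^'n"
    by (simp_all add: vec_eq_iff matrix_mult_nth)
  have c: "A ** (mat (- \<i>) ** B) ** C = mat (- \<i>) ** (A ** B ** C)" for A B C :: "complex^'n^'n"
    by (metis mat_commute matrix_mul_assoc)
  show ?thesis
    unfolding HH_formula_def Let_def S dg_def[symmetric] block_mat_mult matrix_inv_unitary[OF k(1)]
        adj_def[symmetric]
    by (simp add: z c)
qed

lemma matrix_inv_KAK:
  assumes k: "k1 \<in> unitary_group" "k2 \<in> unitary_group"
  shows "matrix_inv (k1 ** dg (\<lambda>i. cosh (l i)) ** k2) = adj k2 ** dg (\<lambda>i. 1 / cosh (l i)) ** adj k1"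
  by (rule matrix_inv_eqI)
    (simp add: matrix_mul_assoc unitary_cancel k dg_assoc dg_simps, simp add: unitaryD k)

lemma HH_formula_eq:
  assumes k: "k1 \<in> unitary_group" "k2 \<in> unitary_group"
  shows "HH_formula k1 l k2 = H_block (k1 ** dg (\<lambda>i. cosh (l i)) ** k2) (k1 ** dg (\<lambda>i. sinh (l i)) **
      cnj_mat k2)"
proof -
  have t: "sinh x * (1 / cosh x) = tanh x" "1 / cosh x * sinh x = tanh x" for x :: real by (simp_all
      add: tanh_def)
  show ?thesis
    unfolding HH_formula_blocks[OF k] H_block_def Let_def matrix_inv_KAK[OF k] block_mat_eq_iff
    using k by (simp add: cnj_mat_mult matrix_transpose_mul transpose_adj dg_simps matrix_mul_assoc
        unitary_cancel dg_assoc t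
      del: times_divide_eq_right times_divide_eq_left)
qed

subsection \<open>The Cartan decomposition\<close>

text \<open>Takagi for \<open>Z\<close> gives \<open>U\<close> and \<open>\<sigma>\<close>. In that
  frame \<open>X ** adj X\<close> becomes \<open>1 - \<sigma>^2\<close>, positive because
  \<open>X\<close> is invertible. So \<open>\<sigma> = tanh l\<close>, and scaling
  \<open>adj U ** X\<close> by \<open>cosh l\<close> leaves a unitary matrix. Both the Cartan
  decomposition and the description of the image rest on this.\<close>

lemma cartan_XZ:
  fixes X Z :: "complex^'n^'n"
  assumes X: "X ** Y = mat 1" and Z: "transpose Z = Z" and XZ: "X ** adj X + Z ** adj Z = mat 1"
  obtains k1 k2 l where "k1 \<in> unitary_group" "k2 \<in> unitary_group"
    "X = adj k2 ** dg (\<lambda>i. 1 / cosh (l i)) ** adj k1" "Z = adj k2 ** dg (\<lambda>i. tanh (l i)) ** cnj_mat k2"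
proof -
  obtain U \<sigma> where U: "U \<in> unitary_group" "\<forall>j. 0 \<le> \<sigma> j" "Z = U ** dg \<sigma> ** transpose U"
    using takagi[OF Z] unfolding dg_def by metis
  have ZZ: "Z ** adj Z = U ** dg (\<lambda>i. \<sigma> i * \<sigma> i) ** adj U"
    using U(1) by (simp add: U(3) adj_mult transpose_adj dg_simps matrix_mul_assoc unitary_cancel dg_assoc)
  have XX: "adj U ** (X ** adj X) ** U = dg (\<lambda>i. 1 - \<sigma> i * \<sigma> i)"
  proof -
    have "X ** adj X = mat 1 - Z ** adj Z" using XZ by (metis add_diff_cancel_right')
    moreover have "A ** (mat 1 - B) ** C = A ** C - A ** B ** C" for A B C :: "complex^'n^'n"
      by (simp add: matrix_diff_distrib)
    ultimately have "adj U ** (X ** adj X) ** U = adj U ** U - adj U ** (U ** dg (\<lambda>i. \<sigma> i * \<sigma> i) ** adj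
        U) ** U"
      by (simp add: ZZ)
    also have "\<dots> = mat 1 - dg (\<lambda>i. \<sigma> i * \<sigma> i)"
      using U(1) by (simp add: matrix_mul_assoc unitary_cancel unitaryD)
    finally show ?thesis by (auto simp: vec_eq_iff mat_nth dg_def diag_mat_nth)
  qed
  have lt: "\<sigma> j * \<sigma> j < 1" for j
  proof -
    define W where "W = adj U ** X"
    have W1: "W ** (Y ** U) = mat 1"
      unfolding W_def by (metis X U(1) matrix_mul_assoc matrix_mul_rid unitaryD(1))
    then have "(Y ** U) ** W = mat 1" using matrix_left_right_inverse by blast
    have "W ** adj W = dg (\<lambda>i. 1 - \<sigma> i * \<sigma> i)"
      unfolding XX[symmetric] W_def by (simp add: adj_mult matrix_mul_assoc)
    then have "herm (adj W *v axis j 1) (adj W *v axis j 1) = herm (dg (\<lambda>i. 1 - \<sigma> i * \<sigma> i) *v axis j 1)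
        (axis j 1)"
      by (metis adj_adj herm_adj matrix_vector_mul_assoc)
    also have "\<dots> = complex_of_real (1 - \<sigma> j * \<sigma> j)"
      unfolding herm_axis matrix_vec_axis by (simp add: dg_def diag_mat_nth)
    finally have *: "(norm (adj W *v axis j 1))\<^sup>2 = 1 - \<sigma> j * \<sigma> j"
      unfolding herm_self of_real_eq_iff .
    have "adj W *v axis j 1 \<noteq> 0"
    proof
      assume "adj W *v axis j 1 = 0"
      then have "adj (Y ** U) *v (adj W *v axis j 1) = 0" by simp
      moreover have "adj (Y ** U) ** adj W = mat 1" unfolding adj_mult[symmetric] W1 by simp
      ultimately have "axis j (1::complex) = 0" by (simp add: matrix_vector_mul_assoc)
      then show False by simp
    qed
    then show ?thesis using * by (metis diff_gt_0_iff_gt zero_less_norm_iff zero_less_power)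
  qed
  \<comment> \<open>The inverse hyperbolic tangent of \<open>\<sigma> j\<close>, in a form that
    makes \<open>sinh\<close> and \<open>cosh\<close> explicit.\<close>
  define l where "l j = arsinh (\<sigma> j / sqrt (1 - \<sigma> j * \<sigma> j))" for j
  have pos: "0 < sqrt (1 - \<sigma> j * \<sigma> j)" for j using lt[of j] by simp
  have sh: "sinh (l j) = \<sigma> j / sqrt (1 - \<sigma> j * \<sigma> j)" for j by (simp add: l_def)
  have ch: "cosh (l j) = 1 / sqrt (1 - \<sigma> j * \<sigma> j)" for j
  proof -
    have "(cosh (l j))\<^sup>2 = 1 + (sinh (l j))\<^sup>2" by (simp add: cosh_square_eq)
    also have "\<dots> = (1 / sqrt (1 - \<sigma> j * \<sigma> j))\<^sup>2"
      unfolding sh using lt[of j] pos[of j] by (simp add: power_divide field_simps power2_eq_square)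
    finally show ?thesis using pos[of j] by (simp add: power2_eq_iff_nonneg less_imp_le)
  qed
  have th: "tanh (l j) = \<sigma> j" for j using pos[of j] by (simp add: tanh_def sh ch)
  define W where "W = dg (\<lambda>i. cosh (l i)) ** adj U ** X"
  have "W ** adj W = dg (\<lambda>i. cosh (l i)) ** (adj U ** (X ** adj X) ** U) ** dg (\<lambda>i. cosh (l i))"
    unfolding W_def by (simp add: adj_mult dg_simps matrix_mul_assoc)
  also have "\<dots> = dg (\<lambda>i. cosh (l i) * (1 - \<sigma> i * \<sigma> i) * cosh (l i))"
    unfolding XX by (simp add: dg_simps)
  also have "(\<lambda>i. cosh (l i) * (1 - \<sigma> i * \<sigma> i) * cosh (l i)) = (\<lambda>i. 1)"
  proof
    fix i
    show "cosh (l i) * (1 - \<sigma> i * \<sigma> i) * cosh (l i) = 1" using lt[of i] by (simp add: ch)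
  qed
  finally have W: "W \<in> unitary_group" by (intro unitaryI') (simp add: dg_simps)
  show thesis
  proof (rule that[of "adj W" "adj U" l])
    show "adj W \<in> unitary_group" "adj U \<in> unitary_group" using W U by auto
    have "U ** dg (\<lambda>i. 1 / cosh (l i)) ** W = U ** (dg (\<lambda>i. 1 / cosh (l i)) ** dg (\<lambda>i. cosh (l i))) **
        adj U ** X"
      unfolding W_def by (simp add: matrix_mul_assoc)
    also have "\<dots> = X" using U(1) by (simp add: dg_simps unitaryD)
    finally show "X = adj (adj U) ** dg (\<lambda>i. 1 / cosh (l i)) ** adj (adj W)" by simp
    show "Z = adj (adj U) ** dg (\<lambda>i. tanh (l i)) ** cnj_mat (adj U)"
      by (simp add: th U(3) transpose_adj)
  qed
qed

section \<open>Symplectic matrices through their complex parts\<close>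

definition sp_inv :: "real^('n::finite + 'n)^('n + 'n) \<Rightarrow> real^('n + 'n)^('n + 'n)" where
  "sp_inv g = - (symp_J ** transpose g ** symp_J)"

lemma symp_J_square: "symp_J ** symp_J = - (mat 1 :: real^('n::finite + 'n)^('n + 'n))"
  unfolding symp_J_def block_mat_mult unfolding vec_eq_sum_iff
  by (simp add: mat_nth matrix_mult_nth if_distrib[of "\<lambda>c. c * _"] cong: if_cong)

lemma sp_inv_eq: "sp_inv (block_mat A B C D) = block_mat (transpose D) (- transpose B) (- transpose C)
    (transpose A)"
  unfolding sp_inv_def symp_J_def transpose_block_mat block_mat_mult
  unfolding vec_eq_sum_iff
  by (simp add: mat_nth matrix_mult_nth sum_negf if_distrib[of "\<lambda>c. c * _"] if_distrib[of "\<lambda>c. _ * c"]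
      cong: if_cong)

lemma matrix_neg_mult: "(- A) ** B = - (A ** B)" "A ** (- B) = - (A ** B)"
  for A B :: "'a::ring_1^'m^'m"
  by (simp_all add: vec_eq_iff matrix_mult_nth sum_negf)

text \<open>Because \<open>J^-1 = -J\<close>, a symplectic \<open>g\<close> has the inverse
  \<open>sp_inv g\<close>. This expression is linear in \<open>g\<close>, so its complex parts can
  be read off.\<close>

lemma Sp_iff: "g \<in> Sp \<longleftrightarrow> sp_inv g ** g = mat 1"
proof
  assume "g \<in> Sp"
  then have "transpose g ** symp_J ** g = symp_J" by (simp add: Sp_def)
  then have "sp_inv g ** g = - (symp_J ** symp_J)"
    unfolding sp_inv_def by (metis matrix_mul_assoc matrix_neg_mult(1))
  then show "sp_inv g ** g = mat 1" by (simp add: symp_J_square)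
next
  assume *: "sp_inv g ** g = mat 1"
  then have "invertible g" using invertible_left_inverse by blast
  have "symp_J ** (transpose g ** symp_J ** g) = - mat 1"
    using * unfolding sp_inv_def matrix_neg_mult by (metis matrix_mul_assoc minus_equation_iff)
  then have "symp_J ** (symp_J ** (transpose g ** symp_J ** g)) = symp_J ** (- mat 1)" by simp
  then have "- (transpose g ** symp_J ** g) = - symp_J"
    by (simp add: matrix_mul_assoc symp_J_square matrix_neg_mult)
  then show "g \<in> Sp" using \<open>invertible g\<close> by (simp add: Sp_def)
qed

lemma parts_sp_inv: "C_part (sp_inv g) = adj (C_part g)" "Q_part (sp_inv g) = - transpose (Q_part g)"
proof -
  obtain A B C D where g: "g = block_mat A B C D" using block_mat_exists by blast
  show "C_part (sp_inv g) = adj (C_part g)" "Q_part (sp_inv g) = - transpose (Q_part g)"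
    unfolding g sp_inv_eq
    by (simp_all add: vec_eq_iff C_part_def Q_part_def transpose_nth complex_eq_iff add.commute)
qed

lemma cnj_mat_uminus: "cnj_mat (- A) = - cnj_mat A"
  by (simp add: vec_eq_iff)

text \<open>The complex parts of \<open>g ** sp_inv g = mat 1\<close>. With the inverse on the
  right, the relations can be multiplied by \<open>P^-1\<close> from the left.\<close>

lemma Sp_parts:
  assumes "g \<in> Sp"
  shows "C_part g ** adj (C_part g) - Q_part g ** adj (Q_part g) = mat 1"
    "C_part g ** transpose (Q_part g) = Q_part g ** transpose (C_part g)"
proof -
  have "sp_inv g ** g = mat 1" using assms Sp_iff by blast
  then have *: "g ** sp_inv g = mat 1" using matrix_left_right_inverse by blast
  have "C_part (g ** sp_inv g) = mat 1" "Q_part (g ** sp_inv g) = 0" by (simp_all add: * parts_1)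
  then show "C_part g ** adj (C_part g) - Q_part g ** adj (Q_part g) = mat 1"
    "C_part g ** transpose (Q_part g) = Q_part g ** transpose (C_part g)"
    unfolding parts_mult parts_sp_inv by (simp_all add: cnj_mat_uminus transpose_adj matrix_neg_mult)
qed

lemma KAK_in_Sp:
  assumes k: "k1 \<in> unitary_group" "k2 \<in> unitary_group"
  shows "realify k1 ** exp_H l ** realify k2 \<in> Sp"
proof -
  let ?g = "realify k1 ** exp_H l ** realify k2"
  have "C_part (sp_inv ?g ** ?g) = adj k2 ** dg (\<lambda>i. cosh (l i) * cosh (l i)) ** k2 - adj k2 ** dg (\<lambda>i.
      sinh (l i) * sinh (l i)) ** k2"
    unfolding parts_mult(1)[of "sp_inv _"] parts_sp_inv parts_KAK using k
    by (simp add: adj_mult cnj_mat_mult matrix_transpose_mul transpose_adj dg_simps matrix_neg_mult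
        matrix_mul_assoc unitary_cancel dg_assoc)
  also have "\<dots> = adj k2 ** (dg (\<lambda>i. cosh (l i) * cosh (l i)) - dg (\<lambda>i. sinh (l i) * sinh (l i))) ** k2"
    by (simp add: matrix_diff_distrib)
  also have "dg (\<lambda>i. cosh (l i) * cosh (l i)) - dg (\<lambda>i. sinh (l i) * sinh (l i)) = mat 1"
  proof -
    have "cosh x * cosh x - sinh x * sinh x = 1" for x :: real
      using hyperbolic_pythagoras[of x] by (simp add: power2_eq_square)
    then show ?thesis by (auto simp: vec_eq_iff dg_def diag_mat_nth mat_nth of_real_mult[symmetric]
        of_real_diff[symmetric] simp del: of_real_mult of_real_diff)
  qed
  finally have 1: "C_part (sp_inv ?g ** ?g) = mat 1" using k by (simp add: unitaryD)
  have 2: "Q_part (sp_inv ?g ** ?g) = 0"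
    unfolding parts_mult(2)[of "sp_inv _"] parts_sp_inv parts_KAK using k
    by (simp add: adj_mult cnj_mat_mult matrix_transpose_mul transpose_adj dg_simps matrix_neg_mult
        matrix_mul_assoc unitary_cancel dg_assoc mult.commute)
  show ?thesis unfolding Sp_iff by (rule parts_inject) (simp_all add: 1 2 parts_1)
qed

text \<open>Positive definiteness of \<open>P ** adj P = 1 + Q ** adj Q\<close> gives
  \<open>adj P\<close> a trivial kernel.\<close>

lemma Sp_C_part_invertible:
  assumes "g \<in> Sp" obtains X where "X ** C_part g = mat 1" "C_part g ** X = mat 1"
proof -
  let ?P = "C_part g" and ?Q = "Q_part g"
  have "x = 0" if "adj ?P *v x = 0" for x
  proof -
    have "?P ** adj ?P = mat 1 + ?Q ** adj ?Q" using Sp_parts(1)[OF assms] by (metis diff_eq_eq)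
    then have "(mat 1 + ?Q ** adj ?Q) *v x = 0" using that by (metis matrix_vector_mul_assoc
        matrix_vector_mult_0_right)
    then have "x + ?Q *v (adj ?Q *v x) = 0" by (simp add: matrix_vector_mult_add_rdistrib
        matrix_vector_mul_assoc)
    then have "herm (x + ?Q *v (adj ?Q *v x)) x = 0" by (simp only: herm_simps)
    then have "herm x x + herm (adj ?Q *v x) (adj ?Q *v x) = 0"
      by (simp add: herm_simps herm_adj[of ?Q])
    then have "(norm x)\<^sup>2 + (norm (adj ?Q *v x))\<^sup>2 = 0"
      unfolding herm_self of_real_add[symmetric] of_real_eq_0_iff .
    then show ?thesis by (simp add: sum_power2_eq_zero_iff)
  qed
  then obtain B where "B ** adj ?P = mat 1" using matrix_left_invertible_ker[of "adj ?P"] by blast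
  then have "adj (B ** adj ?P) = mat 1" by simp
  then have "?P ** adj B = mat 1" by (simp add: adj_mult)
  then show thesis using that matrix_left_right_inverse by blast
qed

text \<open>Apply \<open>cartan_XZ\<close> to \<open>X = P^-1\<close> and \<open>Z = P^-1 Q\<close>:
  the second relation of \<open>Sp_parts\<close> makes \<open>Z\<close> symmetric, and the first,
  multiplied by \<open>X\<close> and \<open>adj X\<close>, is the norm condition.\<close>

theorem Sp_cartan:
  assumes g: "g \<in> Sp"
  obtains k1 k2 l where "k1 \<in> unitary_group" "k2 \<in> unitary_group" "g = realify k1 ** exp_H l ** realify k2"
proof -
  let ?P = "C_part g" and ?Q = "Q_part g"
  obtain X where X: "X ** ?P = mat 1" "?P ** X = mat 1" using Sp_C_part_invertible[OF g] .
  have sym: "transpose (X ** ?Q) = X ** ?Q"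
  proof -
    have "X ** (?P ** transpose ?Q) ** transpose X = X ** (?Q ** transpose ?P) ** transpose X"
      by (simp only: Sp_parts(2)[OF g])
    moreover have "transpose ?P ** transpose X = mat 1" by (metis X(1) matrix_transpose_mul transpose_mat)
    ultimately show ?thesis
      using X by (metis matrix_mul_assoc matrix_mul_lid matrix_mul_rid matrix_transpose_mul)
  qed
  have "X ** (?P ** adj ?P - ?Q ** adj ?Q) ** adj X = X ** adj X" by (simp add: Sp_parts(1)[OF g])
  then have "X ** ?P ** (adj ?P ** adj X) - X ** ?Q ** (adj ?Q ** adj X) = X ** adj X"
    by (simp add: matrix_diff_distrib matrix_mul_assoc)
  then have "mat 1 - X ** ?Q ** adj (X ** ?Q) = X ** adj X"
    by (simp only: adj_mult[symmetric] X adj_mat_1 matrix_mul_rid)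
  then have XZ: "X ** adj X + X ** ?Q ** adj (X ** ?Q) = mat 1" by (metis diff_add_cancel)
  obtain k1 k2 l where k: "k1 \<in> unitary_group" "k2 \<in> unitary_group"
    "X = adj k2 ** dg (\<lambda>i. 1 / cosh (l i)) ** adj k1" "X ** ?Q = adj k2 ** dg (\<lambda>i. tanh (l i)) ** cnj_mat k2"
    using cartan_XZ[OF X(1) sym XZ] by metis
  have P: "?P = k1 ** dg (\<lambda>i. cosh (l i)) ** k2"
  proof -
    have "X ** (k1 ** dg (\<lambda>i. cosh (l i)) ** k2) = mat 1"
      unfolding k(3) using k(1,2) by (simp add: matrix_mul_assoc unitary_cancel dg_assoc dg_simps unitaryD)
    then have "?P ** (X ** (k1 ** dg (\<lambda>i. cosh (l i)) ** k2)) = ?P" by simp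
    then show ?thesis by (simp add: matrix_mul_assoc X)
  qed
  have "?Q = ?P ** (X ** ?Q)" by (simp add: matrix_mul_assoc X)
  also have "\<dots> = k1 ** dg (\<lambda>i. cosh (l i) * tanh (l i)) ** cnj_mat k2"
    unfolding k(4) P using k(1,2) by (simp add: matrix_mul_assoc unitary_cancel dg_assoc)
  also have "(\<lambda>i. cosh (l i) * tanh (l i)) = (\<lambda>i. sinh (l i))" by (simp add: tanh_def)
  finally have Q: "?Q = k1 ** dg (\<lambda>i. sinh (l i)) ** cnj_mat k2" .
  show thesis
    by (rule that[OF k(1,2), of l], rule parts_inject) (simp_all add: parts_KAK P[symmetric] Q[symmetric])
qed

lemma HH_KAK:
  assumes k: "k1 \<in> unitary_group" "k2 \<in> unitary_group"
  shows "HH (realify k1 ** exp_H l ** realify k2) = HH_formula k1 l k2"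
  unfolding HH_def
proof (rule the_equality)
  fix s assume "\<exists>h1\<in>unitary_group. \<exists>h2\<in>unitary_group. \<exists>m.
    realify k1 ** exp_H l ** realify k2 = realify h1 ** exp_H m ** realify h2 \<and> s = HH_formula h1 m h2"
  then obtain h1 h2 m where h: "h1 \<in> unitary_group" "h2 \<in> unitary_group" "s = HH_formula h1 m h2"
    "realify k1 ** exp_H l ** realify k2 = realify h1 ** exp_H m ** realify h2" by blast
  show "s = HH_formula k1 l k2"
    unfolding h(3) HH_formula_eq[OF h(1,2)] HH_formula_eq[OF k] parts_KAK[symmetric] h(4) ..
qed (use k in blast)

text \<open>A block diagonal unitary \<open>L\<close> reduces the claim to the hyperbolic block
  matrix. That one is unitary because \<open>T\<close> is real, \<open>S\<close> is purely imaginary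
  and \<open>tanh^2 + 1 / cosh^2 = 1\<close>.\<close>

lemma HH_formula_sym_unitary:
  fixes k1 k2 :: "complex^'n^'n"
  assumes k: "k1 \<in> unitary_group" "k2 \<in> unitary_group"
  shows "HH_formula k1 l k2 \<in> sym_unitary"
proof -
  define T where "T = dg (\<lambda>i. tanh (l i))"
  define S where "S = diag_mat (\<lambda>i. - \<i> * complex_of_real (1 / cosh (l i)))"
  define L where "L = block_mat (cnj_mat k1) 0 0 (adj k2)"
  have z: "0 ** A = (0 :: complex^'n^'n)" "A ** 0 = (0 :: complex^'n^'n)" for A :: "complex^'n^'n"
    by (simp_all add: vec_eq_iff matrix_mult_nth)
  have z': "adj 0 = (0 :: complex^'n^'n)" "transpose 0 = (0 :: complex^'n^'n)"
    by (simp_all add: vec_eq_iff transpose_nth)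
  have L: "L \<in> unitary_group"
    unfolding L_def using k unitaryD[OF unitary_cnj[OF k(1)]]
    by (intro unitaryI) (simp add: adj_block_mat block_mat_mult z z' unitaryD block_mat_1)
  have eq: "HH_formula k1 l k2 = L ** block_mat T S S T ** transpose L"
    unfolding HH_formula_def Let_def L_def T_def S_def transpose_block_mat dg_def
    using k by (simp add: z' transpose_adj matrix_inv_unitary)
  have "block_mat T S S T \<in> sym_unitary"
  proof -
    have th: "(tanh x)\<^sup>2 + (1 / cosh x)\<^sup>2 = 1" for x :: real
    proof -
      have "(tanh x)\<^sup>2 + (1 / cosh x)\<^sup>2 = ((sinh x)\<^sup>2 + 1) / (cosh x)\<^sup>2"
        by (simp add: tanh_def power_divide add_divide_distrib)
      also have "(sinh x)\<^sup>2 + 1 = (cosh x)\<^sup>2" by (simp add: cosh_square_eq)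
      finally show ?thesis by simp
    qed
    have a: "adj S = diag_mat (\<lambda>i. \<i> * complex_of_real (1 / cosh (l i)))"
      unfolding S_def adj_diag_mat by simp
    have "T ** adj T + S ** adj S = mat 1"
    proof -
      have "(T ** adj T + S ** adj S) $ i $ j = (if i = j then complex_of_real ((tanh (l i))\<^sup>2 + (1 /
          cosh (l i))\<^sup>2) else 0)" for i j
        unfolding a T_def dg_simps unfolding S_def dg_def diag_mat_mult
        by (simp add: diag_mat_nth power2_eq_square)
      then show ?thesis unfolding th by (auto simp: vec_eq_iff mat_nth)
    qed
    moreover have "T ** adj S + S ** adj T = 0"
      unfolding a T_def dg_simps unfolding S_def dg_def diag_mat_mult
      by (auto simp: vec_eq_iff diag_mat_nth)
    moreover have "transpose T = T" "transpose S = S" by (simp_all add: T_def S_def dg_simps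
        transpose_diag_mat)
    ultimately show ?thesis
      unfolding sym_unitary_iff transpose_block_mat
      by (auto intro!: unitaryI' simp: adj_block_mat block_mat_mult block_mat_1 add.commute)
  qed
  then show ?thesis unfolding eq by (rule sym_unitary_conj[OF L])
qed

lemma HH_sym_unitary: "g \<in> Sp \<Longrightarrow> HH g \<in> sym_unitary"
  by (metis Sp_cartan HH_KAK HH_formula_sym_unitary)

subsection \<open>The image of the embedding\<close>

definition low_block :: "complex^('n::finite + 'n)^('n + 'n) \<Rightarrow> complex^'n^'n" where
  "low_block s = (\<chi> i j. s $ Inr i $ Inl j)"

text \<open>\<open>X = \<i> b'\<close> and \<open>Z = d\<close> satisfy the hypotheses of
  \<open>cartan_XZ\<close>, which yields a \<open>g\<close> with the right lower blocks. Symmetry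
  gives the upper right block; unitarity determines \<open>a ** adj b'\<close>, hence
  \<open>a\<close>, because \<open>b'\<close> is invertible.\<close>

lemma HH_surj:
  assumes s: "s \<in> sym_unitary" and inv: "invertible (low_block s)"
  obtains g where "g \<in> Sp" "HH g = s"
proof -
  obtain a b b' d where sb: "s = block_mat a b b' d" using block_mat_exists by blast
  have ts: "transpose s = s" "s \<in> unitary_group" using s by (auto simp: sym_unitary_iff)
  then have t: "transpose a = a" "b = transpose b'" "transpose d = d"
    unfolding sb transpose_block_mat block_mat_eq_iff by auto
  have "s ** adj s = mat 1" using ts by (simp add: unitaryD)
  then have u: "b' ** adj b' + d ** adj d = mat 1" "a ** adj b' + b ** adj d = 0"
    unfolding sb adj_block_mat block_mat_mult block_mat_1[symmetric] block_mat_eq_iff by auto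
  have "low_block s = b'" by (simp add: low_block_def sb vec_eq_iff)
  then obtain c where c: "b' ** c = mat 1" "c ** b' = mat 1" using inv by (auto simp: invertible_def)
  define X where "X = mat \<i> ** b'"
  have X: "X ** (mat (- \<i>) ** c) = mat 1"
  proof -
    have "X ** (mat (- \<i>) ** c) = (mat \<i> ** mat (- \<i>)) ** (b' ** c)"
      unfolding X_def by (metis mat_commute matrix_mul_assoc)
    also have "mat \<i> ** mat (- \<i>) = (mat 1 :: complex^'a^'a)" by (simp add: vec_eq_iff mat_mult_nth mat_nth)
    finally show ?thesis by (simp add: c)
  qed
  have "X ** adj X = b' ** adj b'"
  proof -
    have "(\<i> * x) * cnj (\<i> * y) = x * cnj y" for x y by (simp add: complex_eq_iff)
    then show ?thesis
      unfolding X_def vec_eq_iff matrix_mult_nth[of _ "adj _"] adj_nth mat_mult_nth by simp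
  qed
  then have XZ: "X ** adj X + d ** adj d = mat 1" using u by simp
  obtain k1 k2 l where k: "k1 \<in> unitary_group" "k2 \<in> unitary_group"
    "X = adj k2 ** dg (\<lambda>i. 1 / cosh (l i)) ** adj k1" "d = adj k2 ** dg (\<lambda>i. tanh (l i)) ** cnj_mat k2"
    using cartan_XZ[OF X t(3) XZ] by metis
  define g where "g = realify k1 ** exp_H l ** realify k2"
  have "HH g = HH_formula k1 l k2" unfolding g_def by (rule HH_KAK[OF k(1,2)])
  also have "\<dots> = s"
  proof -
    obtain a' where f: "HH_formula k1 l k2 = block_mat a' (transpose b') b' d"
    proof -
      have "mat (- \<i>) ** X = b'" unfolding X_def by (simp add: vec_eq_iff mat_mult_nth)
      then have "mat (- \<i>) ** (adj k2 ** dg (\<lambda>i. 1 / cosh (l i)) ** adj k1) = b'" by (simp only: k(3))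
      moreover have "mat (- \<i>) ** (cnj_mat k1 ** dg (\<lambda>i. 1 / cosh (l i)) ** cnj_mat k2) =
          transpose (mat (- \<i>) ** (adj k2 ** dg (\<lambda>i. 1 / cosh (l i)) ** adj k1))"
        by (simp add: matrix_transpose_mul transpose_adj dg_simps matrix_mul_assoc mat_commute)
      ultimately show thesis using that HH_formula_blocks[OF k(1,2), of l] k(4) by metis
    qed
    have "HH_formula k1 l k2 ** adj (HH_formula k1 l k2) = mat 1"
      using HH_formula_sym_unitary[OF k(1,2)] by (simp add: sym_unitary_iff unitaryD)
    then have "a' ** adj b' + b ** adj d = 0"
      unfolding f adj_block_mat block_mat_mult block_mat_1[symmetric] block_mat_eq_iff by (simp add: t(2))
    then have "a' ** adj b' = a ** adj b'" using u(2) by (metis add_right_cancel)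
    then have "a' ** (adj b' ** adj c) = a ** (adj b' ** adj c)" by (simp add: matrix_mul_assoc)
    moreover have "adj b' ** adj c = mat 1" by (metis adj_mat_1 adj_mult c(2))
    ultimately show ?thesis by (simp add: f sb t(2))
  qed
  finally show thesis using that[of g] KAK_in_Sp[OF k(1,2)] by (simp add: g_def)
qed

section \<open>Density of the image\<close>

definition is_poly_fun :: "(complex \<Rightarrow> complex) \<Rightarrow> bool" where
  "is_poly_fun f \<longleftrightarrow> (\<exists>p. \<forall>z. f z = poly p z)"

lemma is_poly_fun_intros:
  "is_poly_fun (\<lambda>z. c)" "is_poly_fun (\<lambda>z. z)"
  "is_poly_fun f \<Longrightarrow> is_poly_fun g \<Longrightarrow> is_poly_fun (\<lambda>z. f z + g z)"
  "is_poly_fun f \<Longrightarrow> is_poly_fun g \<Longrightarrow> is_poly_fun (\<lambda>z. f z - g z)"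
  "is_poly_fun f \<Longrightarrow> is_poly_fun g \<Longrightarrow> is_poly_fun (\<lambda>z. f z * g z)"
  unfolding is_poly_fun_def
  by (metis poly_pCons poly_0 mult_zero_right add.right_neutral, metis poly_pCons poly_0 poly_1
      mult_zero_right add.right_neutral add.left_neutral mult_1 mult.commute one_pCons,
    metis poly_add, metis poly_diff, metis poly_mult)

lemma is_poly_fun_sum: "(\<And>i. i \<in> A \<Longrightarrow> is_poly_fun (f i)) \<Longrightarrow> is_poly_fun (\<lambda>z. \<Sum>i\<in>A. f i z)"
  by (induction A rule: infinite_finite_induct) (auto intro: is_poly_fun_intros)

lemma is_poly_fun_prod: "(\<And>i. i \<in> A \<Longrightarrow> is_poly_fun (f i)) \<Longrightarrow> is_poly_fun (\<lambda>z. \<Prod>i\<in>A. f i z)"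
  by (induction A rule: infinite_finite_induct) (auto intro: is_poly_fun_intros)

definition good_set :: "(complex^('n::finite + 'n)^('n + 'n)) set" where
  "good_set = {s \<in> sym_unitary. det (low_block s) \<noteq> 0}"

lemma continuous_on_conj_mat:
  assumes "\<And>i j. continuous_on Z (\<lambda>z. u z $ i $ j)" "\<And>i j. continuous_on Z (\<lambda>z. f z $ i $ j)"
  shows "continuous_on Z (\<lambda>z. u z ** f z ** transpose (u z) :: complex^'m^'m)"
proof -
  have "continuous_on Z (\<lambda>z. \<chi> i j. (u z ** f z ** transpose (u z)) $ i $ j)"
    unfolding matrix_mult_nth transpose_nth by (intro continuous_intros assms)
  then show ?thesis by simp
qed

text \<open>Along \<open>z \<mapsto> refl_mat w z\<close> the determinant of the lower left block is
  a polynomial in \<open>z\<close>, nonzero at \<open>z = 1\<close>. It has finitely many zeros, so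
  every point of the circle is a limit of points where it is nonzero.\<close>

lemma closure_good_refl:
  fixes w :: "complex^('n::finite + 'n)"
  assumes s: "s \<in> good_set" and w: "herm w w = 1" and l: "norm l = 1"
  shows "refl_mat w l ** s ** transpose (refl_mat w l) \<in> closure good_set"
proof -
  define F where "F z = refl_mat w z ** s ** transpose (refl_mat w z)" for z
  have F1: "F 1 = s" by (simp add: F_def)
  have "is_poly_fun (\<lambda>z. det (low_block (F z)))"
    unfolding det_def low_block_def F_def vec_lambda_beta matrix_mult_nth transpose_nth refl_mat_def
    by (intro is_poly_fun_sum is_poly_fun_prod is_poly_fun_intros)
  then obtain p where p: "\<And>z. det (low_block (F z)) = poly p z" unfolding is_poly_fun_def by blast
  have "poly p 1 \<noteq> 0" using s by (simp add: p[symmetric] F1 good_set_def)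
  then have "p \<noteq> 0" by auto
  then have fin: "finite {z. poly p z = 0}" by (rule poly_roots_finite)
  define C where "C = sphere (0::complex) 1 - {z. poly p z = 0}"
  have "l islimpt sphere 0 1"
  proof (rule connected_imp_perfect)
    show "connected (sphere (0::complex) 1)" by (rule connected_sphere) simp
    show "l \<in> sphere 0 1" using l by simp
    have "1 \<in> sphere (0::complex) 1" "-1 \<in> sphere (0::complex) 1" by simp_all
    then show "sphere (0::complex) 1 \<noteq> {x}" for x by (metis one_neq_neg_one singletonD)
  qed
  then have "l islimpt (C \<union> {z. poly p z = 0})"
    by (rule islimpt_subset) (auto simp: C_def)
  then have "l islimpt C" using fin islimpt_Un_finite[of "{z. poly p z = 0}" l C] by (simp add: Un_commute)
  then have lC: "l \<in> closure C" by (simp add: closure_def)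
  have cont: "continuous_on UNIV F"
    unfolding F_def
  proof (rule continuous_on_conj_mat[where u = "refl_mat w" and f = "\<lambda>_. s"])
    show "continuous_on UNIV (\<lambda>z. refl_mat w z $ i $ j)" for i j
      unfolding refl_mat_def vec_lambda_beta by (intro continuous_intros)
  qed simp
  have "F ` C \<subseteq> good_set"
    using s w by (auto simp: C_def good_set_def p F_def[symmetric]) (auto simp: F_def refl_mat_unitary)
  then have "F ` closure C \<subseteq> closure good_set"
    by (intro image_closure_subset continuous_on_subset[OF cont]) (use closure_subset in auto)
  then show ?thesis using lC by (auto simp: F_def)
qed

text \<open>Unitary matrices are products of reflections, and by continuity each reflection maps the
  closure into itself.\<close>

lemma closure_good_unitary:
  fixes u :: "complex^('n::finite + 'n)^('n + 'n)"
  assumes "u \<in> unitary_group"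
  shows "\<forall>s\<in>closure (good_set :: (complex^('n + 'n)^('n + 'n)) set). u ** s ** transpose u \<in> closure good_set"
proof -
  have "u \<in> unitary_group" "\<forall>j\<in>{}. u *v axis j 1 = axis j 1" using assms by auto
  then show ?thesis
  proof (induction rule: unitary_refl_induct)
    case (refl u w l)
    have cont: "continuous_on UNIV (\<lambda>s :: complex^('n + 'n)^('n + 'n). refl_mat w l ** s ** transpose
        (refl_mat w l))"
      by (rule continuous_on_conj_mat) (intro continuous_intros)+
    have "(\<lambda>s. refl_mat w l ** s ** transpose (refl_mat w l)) ` good_set \<subseteq> closure good_set"
      using closure_good_refl refl(3,4) by blast
    then have *: "(\<lambda>s. refl_mat w l ** s ** transpose (refl_mat w l)) ` closure good_set \<subseteq> closure good_set"
      by (intro image_closure_subset continuous_on_subset[OF cont]) auto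
    show ?case
    proof
      fix s :: "complex^('n + 'n)^('n + 'n)" assume "s \<in> closure good_set"
      then have "refl_mat w l ** (u ** s ** transpose u) ** transpose (refl_mat w l) \<in> closure good_set"
        using refl(6) * by blast
      then show "refl_mat w l ** u ** s ** transpose (refl_mat w l ** u) \<in> closure good_set"
        by (simp add: matrix_transpose_mul matrix_mul_assoc)
    qed
  qed simp
qed

text \<open>The closure contains \<open>s0\<close> and is stable under a group that acts
  transitively.\<close>

lemma good_set_dense: "sym_unitary \<subseteq> (closure good_set :: (complex^('n::finite + 'n)^('n + 'n)) set)"
proof
  fix s :: "complex^('n + 'n)^('n + 'n)" assume s: "s \<in> sym_unitary"
  define s0 :: "complex^('n + 'n)^('n + 'n)" where "s0 = block_mat 0 (mat 1) (mat 1) 0"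
  have z: "0 ** A = (0 :: complex^'n^'n)" "A ** 0 = (0 :: complex^'n^'n)" "adj 0 = (0 :: complex^'n^'n)"
    "transpose 0 = (0 :: complex^'n^'n)" for A :: "complex^'n^'n"
    by (simp_all add: vec_eq_iff matrix_mult_nth transpose_nth)
  have s0: "s0 \<in> sym_unitary"
    unfolding sym_unitary_iff s0_def transpose_block_mat
    by (auto intro!: unitaryI simp: adj_block_mat block_mat_mult z block_mat_1)
  have "low_block s0 = mat 1" by (simp add: low_block_def s0_def vec_eq_iff)
  then have G: "s0 \<in> closure good_set"
    using s0 closure_subset by (intro subsetD[OF closure_subset]) (simp add: good_set_def)
  obtain g where g: "g \<in> unitary_group" "s = g ** transpose g" using sym_unitary_transitive[OF s] .
  obtain h where h: "h \<in> unitary_group" "s0 = h ** transpose h" using sym_unitary_transitive[OF s0] .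
  have "(g ** adj h) ** s0 ** transpose (g ** adj h) = s"
    unfolding h(2) g(2) using h(1)
    by (simp add: matrix_transpose_mul transpose_adj matrix_mul_assoc unitary_cancel)
  then show "s \<in> closure good_set"
    using closure_good_unitary[of "g ** adj h"] G g h by (metis unitary_adj unitary_mult)
qed

lemma cont_fun_eqI:
  fixes \<phi> \<psi> :: "complex^('n::finite + 'n)^('n + 'n) \<Rightarrow> complex"
  assumes "\<phi> \<in> cont_fun" "\<psi> \<in> cont_fun" and eq: "\<And>g. g \<in> Sp \<Longrightarrow> \<phi> (HH g) = \<psi> (HH g)"
  shows "\<phi> = \<psi>"
proof
  fix s
  show "\<phi> s = \<psi> s"
  proof (cases "s \<in> sym_unitary")
    case True
    then obtain x where x: "\<And>n. x n \<in> good_set" "x \<longlonglongrightarrow> s"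
      using good_set_dense closure_sequential by blast
    have xs: "x n \<in> sym_unitary" for n using x(1)[of n] by (simp add: good_set_def)
    have "\<phi> (x n) = \<psi> (x n)" for n
    proof -
      have "invertible (low_block (x n))" using x(1)[of n] by (simp add: good_set_def invertible_det_nz)
      then obtain g where "g \<in> Sp" "HH g = x n" using HH_surj[OF xs] by blast
      then show ?thesis using eq by metis
    qed
    moreover have "(\<lambda>n. \<phi> (x n)) \<longlonglongrightarrow> \<phi> s" "(\<lambda>n. \<psi> (x n)) \<longlonglongrightarrow> \<psi> s"
      using assms(1,2) True xs x(2) by (auto simp: cont_fun_def continuous_on_sequentially o_def)
    ultimately show ?thesis using LIMSEQ_unique by simp
  next
    case False
    then show ?thesis using assms by (simp add: cont_fun_def)
  qed
qed

subsection \<open>Matrix coefficients of the oscillator representation\<close>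

text \<open>Chosen so that \<open>\<i>\<close> times it is \<open>cnj_vec z\<close>, which turns the
  kernel of \<open>osc\<close> into that of \<open>WW\<close>. Being real orthogonal, it preserves
  \<open>gauss\<close>.\<close>

definition icnj :: "complex^'n \<Rightarrow> complex^'n" where
  "icnj z = (\<chi> i. - \<i> * cnj (z $ i))"

lemma icnj_orthogonal: "orthogonal_transformation icnj"
  unfolding orthogonal_transformation_def
proof (intro conjI allI)
  show "linear icnj"
    by (rule linearI) (simp_all add: icnj_def vec_eq_iff scaleR_conv_of_real[where 'a=complex] algebra_simps)
  fix v w :: "complex^'a"
  have "herm (icnj v) (icnj w) = cnj (herm v w)"
    unfolding herm_def cnj_sum by (intro sum.cong) (simp_all add: icnj_def complex_eq_iff)
  then show "icnj v \<bullet> icnj w = v \<bullet> w" by (simp add: inner_herm)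
qed

lemma i_times_icnj: "(\<chi> i. \<i> * icnj z $ i) = cnj_vec z"
  by (simp add: vec_eq_iff icnj_def)

text \<open>\<open>v\<close> takes the first block, the outer integration variable. The two
  conjugations cancel, so a polynomial \<open>v\<close> contributes a polynomial.\<close>

definition tensor :: "(complex^'n \<Rightarrow> complex) \<Rightarrow> (complex^'n \<Rightarrow> complex) \<Rightarrow> complex^('n::finite + 'n) \<Rightarrow>
    complex" where
  "tensor u v x = u (\<chi> i. x $ Inr i) * cnj (v (icnj (\<chi> i. x $ Inl i)))"

lemma tensor_join: "tensor u v (join z w) = u w * cnj (v (icnj z))"
  by (simp add: tensor_def)

lemma mon_icnj: "cnj (mon k (icnj z)) = \<i> ^ (\<Sum>i\<in>UNIV. k i) * mon k z"
  by (simp add: mon_def icnj_def power_mult_distrib prod.distrib power_sum)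

lemma tensor_mon:
  fixes k m :: "'n::finite \<Rightarrow> nat"
  shows "tensor (mon m) (mon k) = cscale (\<i> ^ (\<Sum>i\<in>UNIV. k i)) (mon (case_sum k m))"
  by (simp add: fun_eq_iff tensor_def mon_icnj cscale_apply) (simp add: mon_def prod_UNIV_sum)

lemma tensor_linear:
  "tensor (u + u') v = tensor u v + tensor u' v" "tensor (cscale c u) v = cscale c (tensor u v)"
  "tensor u (v + v') = tensor u v + tensor u v'" "tensor u (cscale c v) = cscale (cnj c) (tensor u v)"
  "tensor 0 v = 0" "tensor u 0 = 0"
  by (simp_all add: tensor_def fun_eq_iff cscale_apply algebra_simps)

lemma tensor_polys:
  assumes u: "u \<in> polys" and v: "v \<in> polys" shows "tensor u v \<in> polys"
proof -
  have 1: "tensor u (mon k) \<in> cfun.span (range mon)" for k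
    using u unfolding polys_eq
  proof (induction u rule: cfun.span_induct_alt)
    case base
    show ?case by (simp only: tensor_linear cfun.span_zero)
  next
    case (step c b h)
    then obtain m where "b = mon m" by blast
    then show ?case using step unfolding tensor_linear
      by (simp only: tensor_mon cfun.span_add cfun.span_scale cfun.span_base rangeI)
  qed
  show ?thesis
    using v unfolding polys_eq
  proof (induction v rule: cfun.span_induct_alt)
    case base
    show ?case by (simp only: tensor_linear cfun.span_zero)
  next
    case (step c b h)
    then obtain m where "b = mon m" by blast
    then show ?case using step 1 unfolding tensor_linear
      by (simp only: cfun.span_add cfun.span_scale)
  qed
qed

lemma matrix_coeff_eq:
  fixes u v :: "complex^'n \<Rightarrow> complex"
  assumes x: "(l, g) \<in> Mp" and u: "u \<in> polys" and v: "v \<in> polys"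
  shows "matrix_coeff u v (l, g) = l * WW (tensor u v) (HH g)"
proof -
  have g: "g \<in> Sp" using x by (simp add: Mp_def)
  define s where "s = HH g"
  have s: "s \<in> sym_unitary" unfolding s_def by (rule HH_sym_unitary[OF g])
  have cu: "continuous_on UNIV u" and cv: "continuous_on UNIV v"
    using exp_bounded_polys u v by (auto simp: exp_bounded_def)
  define G where "G z w = l * exp (1 / 4 * quad_form s (join (\<chi> i. \<i> * z $ i) (cnj_vec w))) * u w" for z w
  have "continuous_on UNIV (\<lambda>x. G (fst x) (snd x))"
    unfolding G_def by (intro continuous_intros continuous_on_compose2[OF cu]) auto
  then have "case_prod G \<in> borel_measurable (borel \<Otimes>\<^sub>M gauss)"
    unfolding measurable_cong_sets[OF sets_pair_measure_cong[OF refl sets_gauss] refl] borel_prod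
        case_prod_unfold
    by (rule borel_measurable_continuous_onI)
  then have mG: "(\<lambda>z. \<integral>w. G z w \<partial>gauss) \<in> borel_measurable borel"
    by (rule gauss.borel_measurable_lebesgue_integral)
  have mv: "(\<lambda>z. cnj (v z)) \<in> borel_measurable borel"
    by (intro borel_measurable_continuous_onI continuous_intros cv)
  have "matrix_coeff u v (l, g) = (\<integral>z. (\<integral>w. G z w \<partial>gauss) * cnj (v z) \<partial>gauss)"
    using x by (simp add: matrix_coeff_def fock_inner_def osc_def G_def s_def)
  also have "\<dots> = (\<integral>z. (\<integral>w. G (icnj z) w \<partial>gauss) * cnj (v (icnj z)) \<partial>gauss)"
    by (rule gauss_invariant[OF icnj_orthogonal, symmetric]) (intro borel_measurable_times mG mv)
  also have "\<dots> = (\<integral>z. \<integral>w. l * (kern s (join z w) * tensor u v (join z w)) \<partial>gauss \<partial>gauss)"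
  proof -
    have "G (icnj z) w * cnj (v (icnj z)) = l * (kern s (join z w) * tensor u v (join z w))" for z w
      by (simp add: G_def kern_def tensor_join i_times_icnj cnj_vec_join)
    then show ?thesis by (simp flip: integral_mult_left_zero)
  qed
  also have "\<dots> = l * (\<integral>z. \<integral>w. kern s (join z w) * tensor u v (join z w) \<partial>gauss \<partial>gauss)"
    by simp
  also have "(\<integral>z. \<integral>w. kern s (join z w) * tensor u v (join z w) \<partial>gauss \<partial>gauss) = WW (tensor u v) s"
    using gauss_pair.integral_fst'[OF WW_integrable[OF s tensor_polys[OF u v]]] s by (simp add: WW_eq)
  finally show ?thesis by (simp add: s_def)
qed

section \<open>Correspondence between \<open>M1\<close> and \<open>W1\<close>\<close>

lemma Mp_lift:
  assumes "g \<in> Sp" obtains l where "(l, g) \<in> Mp"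
proof -
  obtain X where "X ** C_part g = mat 1" "C_part g ** X = mat 1" using Sp_C_part_invertible[OF assms] .
  then have "det (C_part g) \<noteq> 0" by (metis invertible_def invertible_det_nz)
  then show thesis using that[of "csqrt (1 / det (C_part g))"] assms by (simp add: Mp_def)
qed

lemma Mp_nonzero: "(l, g) \<in> Mp \<Longrightarrow> l \<noteq> 0 \<and> g \<in> Sp"
  by (auto simp: Mp_def)

text \<open>The push-forward relation stated on the double cover, where it is linear in the pair of
  functions and free of division by \<open>l\<close>.\<close>

definition lifts :: "(complex \<times> (real^('n::finite + 'n)^('n + 'n)) \<Rightarrow> complex) \<Rightarrow>
    (complex^('n + 'n)^('n + 'n) \<Rightarrow> complex) \<Rightarrow> bool" where
  "lifts f \<phi> \<longleftrightarrow> (\<forall>l g. (l, g) \<in> Mp \<longrightarrow> f (l, g) = l * \<phi> (HH g))"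

lemma W1_subspace: "cfun.subspace W1"
  unfolding W1_def by (rule cfun.subspace_span)

lemma lifts_linear:
  "lifts 0 0" "lifts f \<phi> \<Longrightarrow> lifts (cscale c f) (cscale c \<phi>)"
  "lifts f \<phi> \<Longrightarrow> lifts f' \<phi>' \<Longrightarrow> lifts (f + f') (\<phi> + \<phi>')"
  by (auto simp: lifts_def cscale_apply algebra_simps)

lemma M1_lifts:
  assumes "f \<in> M1" obtains \<phi> where "\<phi> \<in> W1" "lifts f \<phi>"
proof -
  have "\<exists>\<phi>. \<phi> \<in> W1 \<and> lifts f \<phi>"
    using assms unfolding M1_def
  proof (induction rule: cfun.span_induct_alt)
    case base
    show ?case using cfun.subspace_0[OF W1_subspace] lifts_linear(1) by blast
  next
    case (step c b h)
    then obtain u v \<phi> where *: "u \<in> polys" "v \<in> polys" "b = matrix_coeff u v" "\<phi> \<in> W1" "lifts h \<phi>" by blast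
    have "WW (tensor u v) \<in> W1"
      unfolding W1_def using tensor_polys[OF *(1,2)] by (intro cfun.span_base) blast
    moreover have "lifts b (WW (tensor u v))"
      using matrix_coeff_eq * by (auto simp: lifts_def)
    ultimately have "cscale c (WW (tensor u v)) + \<phi> \<in> W1" "lifts (cscale c b + h) (cscale c (WW (tensor
        u v)) + \<phi>)"
      using * lifts_linear cfun.subspace_add[OF W1_subspace] cfun.subspace_scale[OF W1_subspace] by blast+
    then show ?case by blast
  qed
  then show thesis using that by blast
qed

text \<open>A monomial in \<open>2n\<close> variables is, up to a power of \<open>\<i>\<close>, the
  tensor of two monomials, so products with separated variables span all polynomials.\<close>

lemma W1_lifts:
  fixes \<phi> :: "complex^('n::finite + 'n)^('n + 'n) \<Rightarrow> complex"
  assumes "\<phi> \<in> W1" obtains f where "f \<in> M1" "lifts f \<phi>"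
proof -
  have sub: "cfun.subspace (M1 :: (complex \<times> (real^('n + 'n)^('n + 'n)) \<Rightarrow> complex) set)"
    unfolding M1_def by (rule cfun.subspace_span)
  have poly: "\<exists>f :: complex \<times> (real^('n + 'n)^('n + 'n)) \<Rightarrow> complex. f \<in> M1 \<and> lifts f (WW p)"
    if "p \<in> cfun.span (range mon)" for p :: "complex^('n + 'n) \<Rightarrow> complex"
  proof -
    have "p \<in> polys \<and> (\<exists>f :: complex \<times> (real^('n + 'n)^('n + 'n)) \<Rightarrow> complex. f \<in> M1 \<and> lifts f (WW p))"
      using that
    proof (induction rule: cfun.span_induct_alt)
      case base
      show ?case using cfun.subspace_0[OF sub] cfun.subspace_0[OF polys_subspace] lifts_linear(1) WW_0
          by metis
    next
      case (step c b h)
      then obtain k f where *: "b = mon k" "h \<in> polys" "f \<in> M1" "lifts f (WW h)" by blast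
      let ?u = "mon (\<lambda>i. k (Inr i)) :: complex^'n \<Rightarrow> complex"
      let ?v = "mon (\<lambda>i. k (Inl i)) :: complex^'n \<Rightarrow> complex"
      \<comment> \<open>The factor that \<open>icnj\<close> puts before the monomial in
        \<open>tensor\<close>; dividing by it recovers \<open>mon k\<close>.\<close>
      define a :: complex where "a = \<i> ^ (\<Sum>i\<in>UNIV. k (Inl i))"
      have "a \<noteq> 0" by (simp add: a_def)
      have uv: "?u \<in> polys" "?v \<in> polys" unfolding polys_eq by (intro cfun.span_base rangeI)+
      have "case_sum (\<lambda>i. k (Inl i)) (\<lambda>i. k (Inr i)) = k" by (auto simp: fun_eq_iff split: sum.splits)
      then have t: "tensor ?u ?v = cscale a (mon k)" by (simp add: tensor_mon a_def)
      have "matrix_coeff ?u ?v \<in> M1" unfolding M1_def using uv by (intro cfun.span_base) blast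
      then have m: "cscale (c / a) (matrix_coeff ?u ?v) \<in> M1" by (rule cfun.subspace_scale[OF sub])
      have "lifts (matrix_coeff ?u ?v) (WW (tensor ?u ?v))"
        using matrix_coeff_eq uv by (auto simp: lifts_def)
      then have "lifts (cscale (c / a) (matrix_coeff ?u ?v)) (cscale (c / a) (WW (tensor ?u ?v)))"
        by (rule lifts_linear)
      also have "cscale (c / a) (WW (tensor ?u ?v)) = WW (cscale c b)"
        using \<open>a \<noteq> 0\<close> by (simp add: t *(1) WW_scale cfun.scale_scale)
      finally have "lifts (cscale (c / a) (matrix_coeff ?u ?v)) (WW (cscale c b))" .
      then have "lifts (cscale (c / a) (matrix_coeff ?u ?v) + f) (WW (cscale c b) + WW h)"
        using *(4) by (rule lifts_linear)
      moreover have cb: "cscale c b \<in> polys"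
        unfolding *(1) polys_eq by (intro cfun.span_scale cfun.span_base rangeI)
      moreover have "WW (cscale c b + h) = WW (cscale c b) + WW h"
        using cb *(2) by (rule WW_add)
      ultimately have "lifts (cscale (c / a) (matrix_coeff ?u ?v) + f) (WW (cscale c b + h))" by (simp only:)
      moreover have "cscale (c / a) (matrix_coeff ?u ?v) + f \<in> M1"
        using m *(3) by (rule cfun.subspace_add[OF sub])
      moreover have "cscale c b + h \<in> polys" using cb *(2) by (rule cfun.subspace_add[OF polys_subspace])
      ultimately show ?case by blast
    qed
    then show ?thesis by blast
  qed
  have "\<exists>f. f \<in> M1 \<and> lifts f \<phi>"
    using assms unfolding W1_def
  proof (induction rule: cfun.span_induct_alt)
    case base
    show ?case using cfun.subspace_0[OF sub] lifts_linear(1) by blast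
  next
    case (step c b h)
    then obtain p f where *: "p \<in> polys" "b = WW p" "f \<in> M1" "lifts f h" by blast
    then obtain f' where f': "f' \<in> M1" "lifts f' b" using poly unfolding polys_eq by blast
    have "cscale c f' + f \<in> M1" "lifts (cscale c f' + f) (cscale c b + h)"
      using f' * lifts_linear cfun.subspace_add[OF sub] cfun.subspace_scale[OF sub] by blast+
    then show ?case by blast
  qed
  then show thesis using that by blast
qed

text \<open>Every symplectic matrix has a lift to \<open>Mp\<close>, and \<open>\<Lambda>\<close>
  has no zero there, so the value of \<open>F\<close> is forced.\<close>

lemma descends_unique:
  assumes \<phi>: "lifts f \<phi>" shows "descends_to f F \<longleftrightarrow> F = (\<lambda>g. if g \<in> Sp then \<phi> (HH g) else 0)"
proof
  assume F: "descends_to f F"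
  show "F = (\<lambda>g. if g \<in> Sp then \<phi> (HH g) else 0)"
  proof
    fix g
    show "F g = (if g \<in> Sp then \<phi> (HH g) else 0)"
    proof (cases "g \<in> Sp")
      case True
      then obtain l where l: "(l, g) \<in> Mp" using Mp_lift by blast
      then have "F g = f (l, g) / l" "f (l, g) = l * \<phi> (HH g)"
        using F \<phi> by (auto simp: descends_to_def lifts_def)
      then show ?thesis using Mp_nonzero[OF l] by simp
    next
      case False
      then show ?thesis using F by (simp add: descends_to_def)
    qed
  qed
next
  assume F: "F = (\<lambda>g. if g \<in> Sp then \<phi> (HH g) else 0)"
  have "F g = f (l, g) / l" if "(l, g) \<in> Mp" for l g
  proof -
    have "f (l, g) = l * \<phi> (HH g)" using that \<phi> by (auto simp: lifts_def)
    then show ?thesis using Mp_nonzero[OF that] by (simp add: F)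
  qed
  moreover have "F g = 0" if "g \<notin> Sp" for g using that by (simp add: F)
  ultimately show "descends_to f F" unfolding descends_to_def by blast
qed

lemma W1_cont: "(W1 :: (complex^('n::finite + 'n)^('n + 'n) \<Rightarrow> complex) set) \<subseteq> cont_fun"
  unfolding W1_eq using qspace_invariant
  by (intro cfun.span_minimal cont_fun_subspace) (auto simp: invariant_subspace_def)

text \<open>Density of the image leaves only one continuous extension.\<close>

lemma push_forward_iff:
  assumes \<phi>: "\<phi> \<in> W1"
  shows "is_push_forward (\<lambda>g. if g \<in> Sp then \<phi> (HH g) else 0) \<psi> \<longleftrightarrow> \<psi> = \<phi>"
proof
  assume "is_push_forward (\<lambda>g. if g \<in> Sp then \<phi> (HH g) else 0) \<psi>"
  then have "\<psi> \<in> cont_fun" "\<And>g. g \<in> Sp \<Longrightarrow> \<psi> (HH g) = \<phi> (HH g)" by (auto simp: is_push_forward_def)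
  then show "\<psi> = \<phi>" using W1_cont \<phi> by (intro cont_fun_eqI) auto
next
  assume "\<psi> = \<phi>"
  then show "is_push_forward (\<lambda>g. if g \<in> Sp then \<phi> (HH g) else 0) \<psi>"
    using W1_cont \<phi> by (auto simp: is_push_forward_def)
qed

lemma M1_over_Lambda_eq:
  "(M1_over_Lambda :: (real^('n::finite + 'n)^('n + 'n) \<Rightarrow> complex) set) =
    (\<lambda>\<phi> g. if g \<in> Sp then \<phi> (HH g) else 0) ` W1"
proof
  show "(M1_over_Lambda :: (real^('n + 'n)^('n + 'n) \<Rightarrow> complex) set) \<subseteq> (\<lambda>\<phi> g. if g \<in> Sp then \<phi> (HH g)
      else 0) ` W1"
  proof
    fix F :: "real^('n + 'n)^('n + 'n) \<Rightarrow> complex" assume "F \<in> M1_over_Lambda"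
    then obtain f where f: "f \<in> M1" "descends_to f F" by (auto simp: M1_over_Lambda_def)
    obtain \<phi> where "\<phi> \<in> W1" "lifts f \<phi>" using M1_lifts[OF f(1)] .
    then show "F \<in> (\<lambda>\<phi> g. if g \<in> Sp then \<phi> (HH g) else 0) ` W1" using f(2) descends_unique by blast
  qed
  show "(\<lambda>\<phi> g. if g \<in> Sp then \<phi> (HH g) else 0) ` W1 \<subseteq> (M1_over_Lambda :: (real^('n + 'n)^('n + 'n) \<Rightarrow>
      complex) set)"
  proof clarify
    fix \<phi> :: "complex^('n + 'n)^('n + 'n) \<Rightarrow> complex" assume "\<phi> \<in> W1"
    then obtain f where "f \<in> M1" "lifts f \<phi>" using W1_lifts by blast
    then show "(\<lambda>g. if g \<in> Sp then \<phi> (HH g) else 0) \<in> M1_over_Lambda"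
      unfolding M1_over_Lambda_def using descends_unique by blast
  qed
qed

subsection \<open>Algebraicity\<close>

text \<open>The definition of \<open>polynomial_function\<close> tests against all real linear
  functionals; on complex values these are combinations of \<open>Re\<close> and \<open>Im\<close>.
  In this form products of complex polynomial functions can be treated.\<close>

lemma polynomial_function_complex_iff:
  fixes f :: "'a::real_normed_vector \<Rightarrow> complex"
  shows "polynomial_function f \<longleftrightarrow>
    real_polynomial_function (\<lambda>x. Re (f x)) \<and> real_polynomial_function (\<lambda>x. Im (f x))"
proof
  assume "polynomial_function f"
  then show "real_polynomial_function (\<lambda>x. Re (f x)) \<and> real_polynomial_function (\<lambda>x. Im (f x))"
    unfolding polynomial_function_def o_def using bounded_linear_Re bounded_linear_Im by blast
next
  assume *: "real_polynomial_function (\<lambda>x. Re (f x)) \<and> real_polynomial_function (\<lambda>x. Im (f x))"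
  show "polynomial_function f"
    unfolding polynomial_function_def
  proof (intro allI impI)
    fix h :: "complex \<Rightarrow> real" assume "bounded_linear h"
    then interpret h: bounded_linear h .
    have hz: "h z = Re z * h 1 + Im z * h \<i>" for z
    proof -
      have "z = Re z *\<^sub>R 1 + Im z *\<^sub>R \<i>" by (simp add: complex_eq_iff)
      then have "h z = h (Re z *\<^sub>R 1 + Im z *\<^sub>R \<i>)" by simp
      then show ?thesis by (simp only: h.add h.scaleR real_scaleR_def)
    qed
    have "h \<circ> f = (\<lambda>x. Re (f x) * h 1 + Im (f x) * h \<i>)" unfolding o_def by (rule ext) (rule hz)
    then show "real_polynomial_function (h \<circ> f)"
      using * by (simp only: real_polynomial_function.intros(2-4))
  qed
qed

lemma polynomial_function_complex_mult:
  fixes f g :: "'a::real_normed_vector \<Rightarrow> complex"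
  assumes "polynomial_function f" "polynomial_function g"
  shows "polynomial_function (\<lambda>x. f x * g x)"
  using assms unfolding polynomial_function_complex_iff
  by (auto intro!: real_polynomial_function.intros(3,4) real_polynomial_function_diff)

lemma polynomial_function_complex_power:
  fixes f :: "'a::real_normed_vector \<Rightarrow> complex"
  assumes "polynomial_function f" shows "polynomial_function (\<lambda>x. f x ^ n)"
  by (induction n) (simp_all add: polynomial_function_const polynomial_function_complex_mult assms)

lemma algebraic_fun_subspace: "cfun.subspace algebraic_fun"
  unfolding cfun.subspace_def
proof (intro conjI ballI allI)
  show "0 \<in> algebraic_fun"
    unfolding algebraic_fun_def by (auto intro!: exI[of _ "\<lambda>_. 0"] polynomial_function_const)
next
  fix f g :: "complex^'a^'a \<Rightarrow> complex" assume "f \<in> algebraic_fun" "g \<in> algebraic_fun"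
  then obtain p q where "polynomial_function p" "polynomial_function q"
    "\<forall>s\<in>sym_unitary. f s = p s" "\<forall>s\<in>sym_unitary. g s = q s"
    "\<forall>s. s \<notin> sym_unitary \<longrightarrow> f s = 0" "\<forall>s. s \<notin> sym_unitary \<longrightarrow> g s = 0"
    unfolding algebraic_fun_def by blast
  then show "f + g \<in> algebraic_fun"
    unfolding algebraic_fun_def
    by (auto intro!: exI[of _ "\<lambda>s. p s + q s"] polynomial_function_add)
next
  fix c and f :: "complex^'a^'a \<Rightarrow> complex" assume "f \<in> algebraic_fun"
  then obtain p where "polynomial_function p" "\<forall>s\<in>sym_unitary. f s = p s" "\<forall>s. s \<notin> sym_unitary \<longrightarrow> f s = 0"
    unfolding algebraic_fun_def by blast
  then show "cscale c f \<in> algebraic_fun"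
    unfolding algebraic_fun_def
    by (auto simp: cscale_apply intro!: exI[of _ "\<lambda>s. c * p s"] polynomial_function_complex_mult
        polynomial_function_const)
qed

lemma qpow_algebraic: "qpow i u \<in> algebraic_fun"
proof -
  have entry: "polynomial_function (\<lambda>s :: complex^'a^'a. s $ a $ b)" for a b
    using bounded_linear_compose[OF bounded_linear_vec_nth[of b] bounded_linear_vec_nth[of a]]
    by (intro polynomial_function_bounded_linear) simp
  have "polynomial_function (\<lambda>s :: complex^'a^'a. quad_form s u)"
    unfolding quad_form_sum
    by (intro polynomial_function_sum polynomial_function_complex_mult entry polynomial_function_const) auto
  then have "polynomial_function (\<lambda>s :: complex^'a^'a. quad_form s u ^ i)"
    by (rule polynomial_function_complex_power)
  then show ?thesis unfolding algebraic_fun_def qpow_def by auto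
qed

theorem theorem4p1:
  shows "algebraic_direct_sum
           (W1 :: (complex^('n::{finite,linorder} + 'n)^('n + 'n) \<Rightarrow> complex) set)
           (\<lambda>i :: nat. C_irr (last_weight (- 2 * int i)))
    \<and> (W1 :: (complex^('n + 'n)^('n + 'n) \<Rightarrow> complex) set) \<subseteq> algebraic_fun
    \<and> (\<forall>f \<in> (M1 :: (complex \<times> (real^('n + 'n)^('n + 'n)) \<Rightarrow> complex) set). \<exists>!F. descends_to f F)
    \<and> (\<forall>F \<in> (M1_over_Lambda :: (real^('n + 'n)^('n + 'n) \<Rightarrow> complex) set).
           \<exists>!\<phi>. is_push_forward F \<phi>)
    \<and> (W1 :: (complex^('n + 'n)^('n + 'n) \<Rightarrow> complex) set) =
           {\<phi>. \<exists>F\<in>M1_over_Lambda. is_push_forward F \<phi>}"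
proof (intro conjI)
  have card: "2 \<le> CARD('n + 'n)"
  proof -
    have "0 < CARD('n)" by (rule zero_less_card_finite)
    moreover have "CARD('n + 'n) = CARD('n) + CARD('n)" by simp
    ultimately show ?thesis by linarith
  qed
  have C: "C_irr (last_weight (- 2 * int i)) = (qspace i :: (complex^('n + 'n)^('n + 'n) \<Rightarrow> complex) set)" for i
    by (rule C_irr_eq_qspace[OF card])
  show "algebraic_direct_sum (W1 :: (complex^('n + 'n)^('n + 'n) \<Rightarrow> complex) set)
      (\<lambda>i :: nat. C_irr (last_weight (- 2 * int i)))"
    unfolding algebraic_direct_sum_def C
  proof (intro conjI allI impI)
    show "cfun.subspace (qspace i :: (complex^('n + 'n)^('n + 'n) \<Rightarrow> complex) set)" for i
      unfolding qspace_def by (rule cfun.subspace_span)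
    show "(W1 :: (complex^('n + 'n)^('n + 'n) \<Rightarrow> complex) set) = cfun.span (\<Union>i. qspace i)" by (rule W1_eq)
    fix v :: "nat \<Rightarrow> complex^('n + 'n)^('n + 'n) \<Rightarrow> complex" and i
    assume "(\<forall>i. v i \<in> qspace i) \<and> finite {i. v i \<noteq> 0} \<and> (\<Sum>i | v i \<noteq> 0. v i) = 0"
    then have "\<And>i. v i \<in> qspace i" "finite {i. v i \<noteq> 0}" "(\<Sum>i | v i \<noteq> 0. v i) = 0" by blast+
    then show "v i = 0" by (rule qspace_direct)
  qed
  show "(W1 :: (complex^('n + 'n)^('n + 'n) \<Rightarrow> complex) set) \<subseteq> algebraic_fun"
    unfolding W1_eq
  proof (intro cfun.span_minimal algebraic_fun_subspace UN_least)
    show "(qspace i :: (complex^('n + 'n)^('n + 'n) \<Rightarrow> complex) set) \<subseteq> algebraic_fun" for i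
      unfolding qspace_def using qpow_algebraic by (intro cfun.span_minimal algebraic_fun_subspace) blast
  qed
  show "\<forall>f \<in> (M1 :: (complex \<times> (real^('n + 'n)^('n + 'n)) \<Rightarrow> complex) set). \<exists>!F. descends_to f F"
  proof
    fix f :: "complex \<times> (real^('n + 'n)^('n + 'n)) \<Rightarrow> complex" assume "f \<in> M1"
    then obtain \<phi> where "lifts f \<phi>" using M1_lifts by blast
    then show "\<exists>!F. descends_to f F" by (simp only: descends_unique ex1_eq)
  qed
  show "\<forall>F \<in> (M1_over_Lambda :: (real^('n + 'n)^('n + 'n) \<Rightarrow> complex) set). \<exists>!\<phi>. is_push_forward F \<phi>"
  proof
    fix F :: "real^('n + 'n)^('n + 'n) \<Rightarrow> complex" assume "F \<in> M1_over_Lambda"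
    then obtain \<phi> where \<phi>: "\<phi> \<in> W1" "F = (\<lambda>g. if g \<in> Sp then \<phi> (HH g) else 0)"
      unfolding M1_over_Lambda_eq by blast
    show "\<exists>!\<phi>. is_push_forward F \<phi>" unfolding \<phi>(2) push_forward_iff[OF \<phi>(1)] by blast
  qed
  show "(W1 :: (complex^('n + 'n)^('n + 'n) \<Rightarrow> complex) set) =
      {\<phi>. \<exists>F\<in>M1_over_Lambda. is_push_forward F \<phi>}"
    unfolding M1_over_Lambda_eq by (auto simp: push_forward_iff)
qed

end
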